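(* Fix integers $r\ge1$ and $k\ge0$. Suppose that the coefficient of $t^{k}$ in $P^{\nu}_{\lambda\mu}(t)$ is nonnegative for every triple $(\lambda,\mu,\nu)$ of partitions of length at most $r$ with $|\lambda|+|\mu|=|\nu|$ whose hive polytope $H(\lambda,\mu,\nu)\subset\mathbb{R}^{D}$ of size $r$, $D=\binom{r-1}{2}$, is full-dimensional (i.e. has dimension $D$). Then the coefficient of $t^{k}$ in $P^{\nu}_{\lambda\mu}(t)$ is nonnegative for every triple $(\lambda,\mu,\nu)$ of partitions of length at most $r$ with $|\lambda|+|\mu|=|\nu|$.
   Context: $c^{\nu}_{\lambda\mu}$ is the Littlewood--Richardson coefficient (multiplicity of $s_\nu$ in $s_\lambda s_\mu$). For a positive integer $t$, $t\lambda=(t\lambda_1,t\lambda_2,\dots)$. By a theorem of Derksen and Weyman, $t\mapsto c^{t\nu}_{t\lambda,t\mu}$ agrees for all integers $t\ge1$ with a polynomial, denoted $P^{\nu}_{\lambda\mu}(t)$. Hives. A hive of size $r$ is a real function $h$ on $\{(i,j)\in\mathbb{Z}^2:0\le j\le i\le r\}$ satisfying all rhombus inequalities (whenever all four points lie in the array): $h(i+1,j)+h(i+1,j+1)\ge h(i,j)+h(i+2,j+1)$; $h(i,j)+h(i+1,j+1)\ge h(i+1,j)+h(i,j+1)$; $h(i,j)+h(i+1,j)\ge h(i+1,j+1)+h(i,j-1)$. For partitions $\lambda,\mu,\nu$ of length at most $r$ (padded with zeros to $r$ parts) with $|\lambda|+|\mu|=|\nu|$, the hive polytope $H(\lambda,\mu,\nu)\subset\mathbb{R}^{D}$,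 $D=\binom{r-1}{2}$, is the set of vectors of interior entries $(h(i,j))_{0<j<i<r}$ of hives of size $r$ with border values $h(i,0)=\lambda_1+\dots+\lambda_i$, $h(i,i)=\nu_1+\dots+\nu_i$, $h(r,j)=|\lambda|+\mu_1+\dots+\mu_j$. *)

theory Defs
  imports "HOL-Analysis.Affine" "HOL-Analysis.Finite_Function_Topology" "HOL-Computational_Algebra.Polynomial"
begin

text \<open>Partitions are weakly decreasing sequences that are eventually zero, indexed from 0:
  the part usually written with subscript \<open>i + 1\<close> is \<open>la i\<close>. Padding with zeros is implicit.\<close>

definition partition :: "(nat \<Rightarrow> nat) \<Rightarrow> bool" where
  "partition la \<longleftrightarrow> antimono la \<and> finite {i. la i \<noteq> 0}"

definition partition_of_length_le :: "nat \<Rightarrow> (nat \<Rightarrow> nat) \<Rightarrow> bool" where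
  "partition_of_length_le r la \<longleftrightarrow> partition la \<and> (\<forall>i\<ge>r. la i = 0)"

definition psize :: "(nat \<Rightarrow> nat) \<Rightarrow> nat" where
  "psize la = (\<Sum>i | la i \<noteq> 0. la i)"

definition stretch :: "nat \<Rightarrow> (nat \<Rightarrow> nat) \<Rightarrow> nat \<Rightarrow> nat" where
  "stretch t la = (\<lambda>i. t * la i)"


definition cells :: "(nat \<Rightarrow> nat) \<Rightarrow> (nat \<times> nat) set" where
  "cells la = {(i, j). j < la i}"

text \<open>Semistandard tableaux with entries in \<open>{..<n}\<close>; the last condition only
  normalises the values outside the diagram, so that tableaux are not counted repeatedly.\<close>

definition ssyt :: "nat \<Rightarrow> (nat \<Rightarrow> nat) \<Rightarrow> (nat \<Rightarrow> nat \<Rightarrow> nat) set" where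
  "ssyt n la = {T.
     (\<forall>(i, j) \<in> cells la. T i j < n) \<and>
     (\<forall>i j. (i, j) \<in> cells la \<and> (i, Suc j) \<in> cells la \<longrightarrow> T i j \<le> T i (Suc j)) \<and>
     (\<forall>i j. (i, j) \<in> cells la \<and> (Suc i, j) \<in> cells la \<longrightarrow> T i j < T (Suc i) j) \<and>
     (\<forall>i j. (i, j) \<notin> cells la \<longrightarrow> T i j = 0)}"

type_synonym mpoly = "(nat \<Rightarrow>\<^sub>0 nat) \<Rightarrow>\<^sub>0 int"

definition var :: "nat \<Rightarrow> mpoly" where
  "var i = Poly_Mapping.single (Poly_Mapping.single i 1) 1"

text \<open>The Schur polynomial in the variables \<open>var 0, \<dots>, var (n - 1)\<close>.\<close>

definition schur :: "nat \<Rightarrow> (nat \<Rightarrow> nat) \<Rightarrow> mpoly" where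
  "schur n la = (\<Sum>T \<in> ssyt n la. \<Prod>(i, j) \<in> cells la. var (T i j))"

text \<open>A symmetric function is a compatible family of symmetric polynomials, one for each
  number \<open>n\<close> of variables; the Schur function of \<open>la\<close> is the family \<open>\<lambda>n. schur n la\<close>.
  Hence the condition for all \<open>n\<close> below is the expansion of a product of two Schur functions
  in the basis of Schur functions, and \<open>lr_coeff la mu nu\<close> is the multiplicity of the Schur
  function of \<open>nu\<close> in the product of those of \<open>la\<close> and \<open>mu\<close>.\<close>

definition schur_expansion ::
    "(nat \<Rightarrow> nat) \<Rightarrow> (nat \<Rightarrow> nat) \<Rightarrow> ((nat \<Rightarrow> nat) \<Rightarrow> int) \<Rightarrow> bool" where
  "schur_expansion la mu c \<longleftrightarrow>
     finite {nu. c nu \<noteq> 0} \<and> (\<forall>nu. c nu \<noteq> 0 \<longrightarrow> partition nu) \<and>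
     (\<forall>n. schur n la * schur n mu = (\<Sum>nu | c nu \<noteq> 0. of_int (c nu) * schur n nu))"

definition lr_coeff :: "(nat \<Rightarrow> nat) \<Rightarrow> (nat \<Rightarrow> nat) \<Rightarrow> (nat \<Rightarrow> nat) \<Rightarrow> int" where
  "lr_coeff la mu nu = (THE c. schur_expansion la mu c) nu"

text \<open>The polynomial exists by a theorem of Derksen and Weyman; it is unique because its
  values at all positive integers are prescribed.\<close>

definition lr_poly :: "(nat \<Rightarrow> nat) \<Rightarrow> (nat \<Rightarrow> nat) \<Rightarrow> (nat \<Rightarrow> nat) \<Rightarrow> real poly" where
  "lr_poly la mu nu = (THE p. \<forall>t::nat. t \<ge> 1 \<longrightarrow>
     poly p (of_nat t) = of_int (lr_coeff (stretch t la) (stretch t mu) (stretch t nu)))"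


definition hive :: "nat \<Rightarrow> (nat \<Rightarrow> nat \<Rightarrow> real) \<Rightarrow> bool" where
  "hive r h \<longleftrightarrow> (let A = {(i, j). j \<le> i \<and> i \<le> r} in
     (\<forall>i j. {(i+1, j), (i+1, j+1), (i, j), (i+2, j+1)} \<subseteq> A \<longrightarrow>
        h (i+1) j + h (i+1) (j+1) \<ge> h i j + h (i+2) (j+1)) \<and>
     (\<forall>i j. {(i, j), (i+1, j+1), (i+1, j), (i, j+1)} \<subseteq> A \<longrightarrow>
        h i j + h (i+1) (j+1) \<ge> h (i+1) j + h i (j+1)) \<and>
     (\<forall>i j. j \<ge> 1 \<and> {(i, j), (i+1, j), (i+1, j+1), (i, j-1)} \<subseteq> A \<longrightarrow>
        h i j + h (i+1) j \<ge> h (i+1) (j+1) + h i (j-1)))"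

definition hive_border ::
    "nat \<Rightarrow> (nat \<Rightarrow> nat) \<Rightarrow> (nat \<Rightarrow> nat) \<Rightarrow> (nat \<Rightarrow> nat) \<Rightarrow> (nat \<Rightarrow> nat \<Rightarrow> real) \<Rightarrow> bool" where
  "hive_border r la mu nu h \<longleftrightarrow>
     (\<forall>i\<le>r. h i 0 = (\<Sum>l<i. real (la l))) \<and>
     (\<forall>i\<le>r. h i i = (\<Sum>l<i. real (nu l))) \<and>
     (\<forall>j\<le>r. h r j = real (psize la) + (\<Sum>l<j. real (mu l)))"

definition interior_indices :: "nat \<Rightarrow> (nat \<times> nat) set" where
  "interior_indices r = {(i, j). 0 < j \<and> j < i \<and> i < r}"

text \<open>The ambient space of dimension \<open>(r - 1) choose 2\<close> (which is 0 for \<open>r \<le> 2\<close>) is the space of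
  vectors \<open>v\<close> with \<open>Poly_Mapping.keys v \<subseteq> interior_indices r\<close>.\<close>

definition hive_polytope ::
    "nat \<Rightarrow> (nat \<Rightarrow> nat) \<Rightarrow> (nat \<Rightarrow> nat) \<Rightarrow> (nat \<Rightarrow> nat) \<Rightarrow> ((nat \<times> nat) \<Rightarrow>\<^sub>0 real) set" where
  "hive_polytope r la mu nu = {v. Poly_Mapping.keys v \<subseteq> interior_indices r \<and>
     (\<exists>h. hive r h \<and> hive_border r la mu nu h \<and>
        (\<forall>(i, j) \<in> interior_indices r. Poly_Mapping.lookup v (i, j) = h i j))}"

text \<open>\<^const>\<open>aff_dim\<close> is confined to Euclidean spaces, a class that contains neither
  finitely supported functions nor the zero space; this is the same notion for arbitrary
  real vector spaces: the dimension of the direction space, and \<open>-1\<close> for the empty set.\<close>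

definition affine_dim :: "'a::real_vector set \<Rightarrow> int" where
  "affine_dim S = (if S = {} then -1 else int (dim {x - y |x y. x \<in> S \<and> y \<in> S}))"

definition lr_triple :: "nat \<Rightarrow> (nat \<Rightarrow> nat) \<Rightarrow> (nat \<Rightarrow> nat) \<Rightarrow> (nat \<Rightarrow> nat) \<Rightarrow> bool" where
  "lr_triple r la mu nu \<longleftrightarrow>
     partition_of_length_le r la \<and> partition_of_length_le r mu \<and> partition_of_length_le r nu \<and>
     psize la + psize mu = psize nu"

lemma card_interior_indices: "card (interior_indices r) = (r - 1) choose 2"
proof (induction r)
  case 0
  then show ?case by (simp add: interior_indices_def)
next
  case (Suc r)
  have eq: "interior_indices (Suc r) = interior_indices r \<union> Pair r ` {0<..<r}"
    by (auto simp: interior_indices_def less_Suc_eq)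
  have fin: "finite (interior_indices r)"
    by (rule finite_subset[of _ "{..<r} \<times> {..<r}"]) (auto simp: interior_indices_def)
  have "card (interior_indices (Suc r)) = card (interior_indices r) + (r - 1)"
    unfolding eq using fin
    by (subst card_Un_disjoint) (auto simp: interior_indices_def card_image inj_on_def)
  then show ?case
    using Suc by (cases r) (auto simp: numeral_2_eq_2)
qed

end

theory Submission
  imports Defs "HOL-Combinatorics.Permutations"
begin

text \<open>Write \<open>c(x)\<close> for the Littlewood-Richardson coefficient of a triple \<open>x = (la, mu, nu)\<close> and
  \<open>P_x(t)\<close> for the polynomial with values \<open>c(t x)\<close>. If \<open>c(t x) = 0\<close> for all \<open>t \<ge> 1\<close>, then
  \<open>P_x = 0\<close>. Otherwise some multiple of \<open>x\<close> has an integer hive, so \<open>x\<close> has a real hive. Take a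
  triple \<open>y\<close> that has a hive with strict rhombus inequalities. Then \<open>a x + y\<close> has such a hive,
  too, its hive polytope is full-dimensional, and the hypothesis applies to it, for all natural
  numbers \<open>a\<close>.

  The link between \<open>x\<close> and the triples \<open>a x + y\<close> is a single polynomial \<open>Q\<close> in two variables
  with \<open>c(a x + b y) = Q(a, b)\<close> for all natural numbers \<open>a\<close> and \<open>b\<close> with \<open>a \<ge> K b + 1\<close>, where
  \<open>K\<close> is a constant (\<open>lr_count_two_parameter\<close>). It matters that \<open>b = 0\<close> is included and that no
  period occurs: then \<open>P_x(t) = Q(t, 0)\<close> and, for \<open>a > K\<close>, the polynomial of \<open>a x + y\<close> is
  \<open>Q(a t, t)\<close>. Its coefficient of \<open>t^k\<close>, divided by \<open>a^k\<close>, tends to the coefficient of \<open>t^k\<close> in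
  \<open>P_x\<close> as \<open>a\<close> grows, and a limit of nonnegative numbers is nonnegative. (The proof divides by
  \<open>s^k\<close> with \<open>a = K + 1 + s\<close>.)

  The polynomial \<open>Q\<close> comes from two descriptions of \<open>c\<close>.

  First, \<open>c\<close> is the number of integer hives (\<open>lr_count_hives\<close>). This is derived by Stembridge's
  argument: in the expansion of an alternant times a Schur polynomial the terms that violate a
  condition of dominance cancel (\<open>alternant_schur_dominant\<close>). Tableaux are treated as
  Gelfand-Tsetlin patterns, for which Bender-Knuth involutions are reflections of the entries of
  a row in intervals, and for which the passage to hives is linear. So \<open>c\<close> is a value of a
  vector partition function. For these, a difference equation and induction on the number of
  vectors show that the values along suitable progressions are polynomial from the first term
  on, including progressions that start at a multiple of \<open>x\<close> and continue in the direction of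
  \<open>K x + y\<close> (\<open>vpf_poly_on_ray\<close>, \<open>vpf_poly_near_ray\<close>). But the step of the progressions has to be
  divisible by an unknown period.

  Secondly, multiplication by the Vandermonde product turns \<open>c\<close> into a signed sum of values of
  Kostant's partition function of type A (Steinberg's formula). The same difference equation,
  and the fact that sets of roots of type A span saturated lattices, show that \<open>c\<close> is polynomial
  along every progression from some term on, without any period (\<open>lr_count_ev_poly\<close>).

  Together: \<open>c\<close> is polynomial, without a period, from the first term on. Two such directions
  give \<open>Q\<close> by interpolation.\<close>

abbreviation "lookup \<equiv> Poly_Mapping.lookup"
abbreviation "single \<equiv> Poly_Mapping.single"
abbreviation "keys \<equiv> Poly_Mapping.keys"

section \<open>Vector partition functions\<close>

text \<open>The index set carries multiplicities: different indices may stand for the same vector.\<close>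

definition vpf_sols :: "'i set \<Rightarrow> ('i \<Rightarrow> 'a::real_vector) \<Rightarrow> 'a \<Rightarrow> ('i \<Rightarrow> nat) set" where
  "vpf_sols J b v = {f. (\<forall>i. i \<notin> J \<longrightarrow> f i = 0) \<and> (\<Sum>i\<in>J. real (f i) *\<^sub>R b i) = v}"

text \<open>The vector partition function of the family \<open>b\<close>. It is only meaningful when all solution sets
  are finite; it is real-valued because it is going to be compared with polynomials.\<close>

definition vpf :: "'i set \<Rightarrow> ('i \<Rightarrow> 'a::real_vector) \<Rightarrow> 'a \<Rightarrow> real" where
  "vpf J b v = real (card (vpf_sols J b v))"

lemma vpf_sols_mono:
  assumes "finite I" "J \<subseteq> I"
  shows "vpf_sols J b v \<subseteq> vpf_sols I b v"
proof
  fix f assume f: "f \<in> vpf_sols J b v"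
  have "(\<Sum>i\<in>I. real (f i) *\<^sub>R b i) = (\<Sum>i\<in>J. real (f i) *\<^sub>R b i)"
    using f assms by (intro sum.mono_neutral_right) (auto simp: vpf_sols_def)
  then show "f \<in> vpf_sols I b v" using f assms by (auto simp: vpf_sols_def)
qed

lemma finite_vsol_subset:
  assumes "finite I" "J \<subseteq> I" "\<And>v. finite (vpf_sols I b v)"
  shows "finite (vpf_sols J b v)"
  using vpf_sols_mono[OF assms(1,2)] assms(3) finite_subset by blast

text \<open>A solution either uses the vector \<open>b j\<close>, and then one copy of it can be removed, or does not
  use it. This difference equation is the only property of vector partition functions on which
  the polynomiality results below rest.\<close>

lemma vpf_step:
  assumes J: "finite J" "j \<in> J" and fin: "\<And>v. finite (vpf_sols J b v)"
  shows "vpf J b (v + b j) = vpf J b v + vpf (J - {j}) b (v + b j)"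
proof -
  let ?A = "vpf_sols J b (v + b j)"
  have spl: "(\<Sum>i\<in>J. real (f i) *\<^sub>R b i) = real (f j) *\<^sub>R b j + (\<Sum>i\<in>J-{j}. real (f i) *\<^sub>R b i)" for f :: "_ \<Rightarrow> nat"
    using J by (simp add: sum.remove)
  have 0: "{f\<in>?A. f j = 0} = vpf_sols (J - {j}) b (v + b j)"
    using J by (auto simp: vpf_sols_def spl)
  have "bij_betw (\<lambda>f. f(j := Suc (f j))) (vpf_sols J b v) {f\<in>?A. f j \<noteq> 0}"
  proof (rule bij_betw_byWitness[where f' = "\<lambda>f. f(j := f j - 1)"])
    have upd: "(\<Sum>i\<in>J-{j}. real ((f(j:=k)) i) *\<^sub>R b i) = (\<Sum>i\<in>J-{j}. real (f i) *\<^sub>R b i)" for f k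
      by (rule sum.cong) auto
    show "(\<lambda>f. f(j := Suc (f j))) ` vpf_sols J b v \<subseteq> {f\<in>?A. f j \<noteq> 0}"
      using J by (auto simp: vpf_sols_def spl upd algebra_simps)
    show "(\<lambda>f. f(j := f j - 1)) ` {f\<in>?A. f j \<noteq> 0} \<subseteq> vpf_sols J b v"
      using J by (auto simp: vpf_sols_def spl upd algebra_simps of_nat_diff)
  qed (auto simp: fun_eq_iff)
  then have 1: "card {f\<in>?A. f j \<noteq> 0} = card (vpf_sols J b v)"
    by (simp add: bij_betw_same_card)
  have "card ?A = card ({f\<in>?A. f j = 0} \<union> {f\<in>?A. f j \<noteq> 0})"
    by (rule arg_cong[where f=card]) auto
  also have "\<dots> = card {f\<in>?A. f j = 0} + card {f\<in>?A. f j \<noteq> 0}"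
    using fin by (intro card_Un_disjoint) auto
  finally show ?thesis unfolding vpf_def 0 1 by simp
qed

section \<open>Polynomial functions on the natural numbers\<close>

text \<open>The bound on the degree makes it possible to interpolate with the same nodes for all values of
  a second parameter.\<close>

definition poly_fun :: "nat \<Rightarrow> (nat \<Rightarrow> real) \<Rightarrow> bool" where
  "poly_fun d g \<longleftrightarrow> (\<exists>p. degree p \<le> d \<and> (\<forall>n. g n = poly p (real n)))"

lemma poly_fun_const: "poly_fun d (\<lambda>n. c)"
  unfolding poly_fun_def by (rule exI[of _ "[:c:]"]) auto

lemma poly_fun_add: "poly_fun d f \<Longrightarrow> poly_fun d g \<Longrightarrow> poly_fun d (\<lambda>n. f n + g n)"
  unfolding poly_fun_def by (metis degree_add_le poly_add)

lemma poly_fun_sum_list: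
  "(\<And>x. x \<in> set L \<Longrightarrow> poly_fun d (f x)) \<Longrightarrow> poly_fun d (\<lambda>n. \<Sum>x\<leftarrow>L. f x n)"
  by (induction L) (auto intro: poly_fun_const poly_fun_add)

text \<open>Induction on the degree: the difference of \<open>c x^(d + 2)\<close> has degree \<open>d + 1\<close>, and \<open>c\<close> can be
  chosen to cancel the leading coefficient of \<open>q\<close>.\<close>

lemma poly_antidifference:
  fixes q :: "real poly"
  assumes "degree q \<le> d"
  shows "\<exists>p. degree p \<le> Suc d \<and> (\<forall>x. poly p (x + 1) - poly p x = poly q x)"
  using assms
proof (induction d arbitrary: q)
  case 0
  then obtain c where q: "q = [:c:]" by (metis degree_eq_zeroE le_zero_eq)
  show ?case by (rule exI[of _ "[:0, c:]"]) (auto simp: q algebra_simps)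
next
  case (Suc d)
  define c where "c = coeff q (Suc d) / real (d + 2)"
  define m where "m = monom c (d + 2)"
  define e where "e = pcompose m [:1,1:] - m"
  have e: "poly e x = poly m (x + 1) - poly m x" for x
    by (simp add: e_def poly_pcompose add.commute)
  have e': "poly e x = (\<Sum>k\<le>Suc d. c * of_nat ((d+2) choose k) * x ^ k)" for x
  proof -
    have "(x + 1) ^ (d+2) = (\<Sum>k\<le>Suc d. of_nat ((d+2) choose k) * x ^ k) + x ^ (d+2)"
      using binomial_ring[of x 1 "d+2"] by (simp del: binomial_Suc_Suc)
    then show ?thesis
      unfolding e m_def poly_monom
      by (simp add: algebra_simps sum_distrib_left del: sum.atMost_Suc)
  qed
  define e2 where "e2 = (\<Sum>k\<le>Suc d. monom (c * of_nat ((d+2) choose k)) k)"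
  have "e = e2"
    by (rule poly_eq_poly_eq_iff[THEN iffD1]) (simp add: fun_eq_iff e' e2_def poly_sum poly_monom del: sum.atMost_Suc)
  have ce: "coeff e (Suc d) = coeff q (Suc d)"
    unfolding \<open>e = e2\<close> e2_def coeff_sum coeff_monom
    by (simp add: c_def del: binomial_Suc_Suc sum.atMost_Suc)
  have de: "degree e \<le> Suc d"
    unfolding \<open>e = e2\<close> e2_def by (rule degree_sum_le) (auto intro: order_trans[OF degree_monom_le])
  have "degree (q - e) \<le> d"
  proof (rule degree_le, intro allI impI)
    fix i assume "d < i"
    then consider "i = Suc d" | "i > Suc d" by linarith
    then show "coeff (q - e) i = 0"
      using ce de Suc.prems by cases (auto simp: coeff_eq_0)
  qed
  from Suc.IH[OF this] obtain p where p: "degree p \<le> Suc d" "\<And>x. poly p (x + 1) - poly p x = poly (q - e) x"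
    by blast
  have "degree (p + m) \<le> Suc (Suc d)"
    using p(1) by (intro degree_add_le) (auto simp: m_def intro: order_trans[OF degree_monom_le])
  moreover have "poly (p + m) (x + 1) - poly (p + m) x = poly q x" for x
    using p(2)[of x] e[of x] by simp
  ultimately show ?case by blast
qed

lemma poly_fun_antidifference:
  assumes "poly_fun d (\<lambda>n. g (Suc n) - g n)"
  shows "poly_fun (Suc d) g"
proof -
  obtain q where q: "degree q \<le> d" "\<And>n. g (Suc n) - g n = poly q (real n)"
    using assms unfolding poly_fun_def by auto
  obtain p where p: "degree p \<le> Suc d" "\<And>x. poly p (x + 1) - poly p x = poly q x"
    using poly_antidifference[OF q(1)] by auto
  have "g n = poly (p + [:g 0 - poly p 0:]) (real n)" for n
  proof (induction n)
    case (Suc n)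
    show ?case using Suc q(2)[of n] p(2)[of "real n"] by (simp add: add.commute)
  qed simp
  moreover have "degree (p + [:g 0 - poly p 0:]) \<le> Suc d"
    using p(1) by (intro degree_add_le) auto
  ultimately show ?thesis unfolding poly_fun_def by blast
qed

section \<open>Polynomiality of vector partition functions along progressions\<close>

definition qcone :: "'i set \<Rightarrow> ('i \<Rightarrow> 'a::real_vector) \<Rightarrow> 'a set" where
  "qcone J b = {v. \<exists>c. (\<forall>i\<in>J. 0 \<le> c i \<and> c i \<in> \<rat>) \<and> v = (\<Sum>i\<in>J. c i *\<^sub>R b i)}"

text \<open>A point \<open>y\<close> that moves in direction \<open>u\<close> drags a lattice point \<open>y - \<Sum>\<theta> b\<close> along: the coordinate
  \<open>\<theta> i\<close> grows at the rate \<open>\<gamma> i\<close>, so that the lattice point stays where it is, until a coordinate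
  reaches 1; then it is reset to 0, and the lattice point jumps by the corresponding vector. By
  \<open>vpf_step\<close> a jump costs a value of the partition function of the remaining vectors, at a point
  of the same form: the coordinate that jumps is 0 at that moment and can be left out. The list
  records the jumps. It does not depend on the translation \<open>t\<close>, so that it serves all terms of
  an arithmetic progression at once. The number \<open>r i\<close> counts the jumps that coordinate \<open>i\<close> has
  yet to make, and the proof is an induction on their total.\<close>

lemma vpf_path:
  fixes b :: "'i \<Rightarrow> 'a::real_vector"
  assumes J: "finite J" and fin: "\<And>v. finite (vpf_sols J b v)"
    and C: "\<And>y t. y \<in> C \<Longrightarrow> t \<in> \<rat> \<Longrightarrow> 0 \<le> t \<Longrightarrow> y + t *\<^sub>R u \<in> C"
    and "y \<in> C" "s \<in> \<rat>" "0 \<le> s" "(\<Sum>i\<in>J. \<gamma> i *\<^sub>R b i) = s *\<^sub>R u"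
    and "\<And>i. i \<in> J \<Longrightarrow> \<theta> i \<in> \<rat> \<and> 0 \<le> \<theta> i \<and> \<theta> i \<le> 1"
    and "\<And>i. i \<in> J \<Longrightarrow> \<gamma> i \<in> \<rat> \<and> 0 \<le> \<gamma> i"
    and "\<And>i. i \<in> J \<Longrightarrow> 0 \<le> \<theta> i + \<gamma> i - real (r i) \<and> \<theta> i + \<gamma> i - real (r i) \<le> 1"
    and "(\<Sum>i\<in>J. r i) = N"
  shows "\<exists>L. (\<forall>(j, y', \<theta>') \<in> set L. j \<in> J \<and> y' \<in> C \<and> (\<forall>i\<in>J-{j}. \<theta>' i \<in> \<rat> \<and> 0 \<le> \<theta>' i \<and> \<theta>' i \<le> 1)) \<and>
     (\<forall>t. vpf J b (y - (\<Sum>i\<in>J. \<theta> i *\<^sub>R b i) + (\<Sum>i\<in>J. real (r i) *\<^sub>R b i) + t) =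
          vpf J b (y - (\<Sum>i\<in>J. \<theta> i *\<^sub>R b i) + t) +
          (\<Sum>(j, y', \<theta>')\<leftarrow>L. vpf (J-{j}) b (y' - (\<Sum>i\<in>J-{j}. \<theta>' i *\<^sub>R b i) + t)))"
  using assms(4-)
proof (induction N arbitrary: y s \<gamma> \<theta> r)
  case 0
  then have "\<And>i. i \<in> J \<Longrightarrow> r i = 0" using J by simp
  then have "(\<Sum>i\<in>J. real (r i) *\<^sub>R b i) = 0" by simp
  then show ?case by (intro exI[of _ "[]"]) auto
next
  case (Suc N)
  note th = Suc.prems(5) and ga = Suc.prems(6) and sl = Suc.prems(7)
  define R where "R = {i\<in>J. r i \<noteq> 0}"
  have R: "finite R" "R \<noteq> {}"
  proof -
    show "R \<noteq> {}"
    proof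
      assume "R = {}"
      then have "(\<Sum>i\<in>J. r i) = 0" by (intro sum.neutral) (auto simp: R_def)
      then show False using Suc.prems(8) by simp
    qed
  qed (use J in \<open>simp add: R_def\<close>)
  define tm where "tm i = (1 - \<theta> i) / \<gamma> i" for i
  \<comment> \<open>The coordinate that is the next to reach 1; \<open>t0\<close> is the moment at which it does.\<close>
  have "\<exists>j\<in>R. \<forall>i\<in>R. tm j \<le> tm i"
    using R by (metis arg_min_if_finite(1) arg_min_least)
  then obtain j where j: "j \<in> R" and jmin: "\<And>i. i \<in> R \<Longrightarrow> tm j \<le> tm i" by blast
  define t0 where "t0 = tm j"
  have jJ: "j \<in> J" and rj: "r j \<ge> 1" using j by (auto simp: R_def)
  have g1: "\<theta> i + \<gamma> i \<ge> 1" if "i \<in> R" for i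
  proof -
    have "real (r i) \<ge> 1" using that by (auto simp: R_def)
    then show ?thesis using sl[of i] that by (auto simp: R_def)
  qed
  have t0Q: "t0 \<in> \<rat>" using th[OF jJ] ga[OF jJ] by (auto simp: t0_def tm_def)
  have t0: "0 \<le> t0" using th[OF jJ] ga[OF jJ] by (auto simp: t0_def tm_def)
  have t01: "t0 \<le> 1"
    using th[OF jJ] ga[OF jJ] g1[OF j] by (cases "\<gamma> j = 0") (auto simp: t0_def tm_def field_simps)
  have hit: "\<theta> j + t0 * \<gamma> j = 1"
    using th[OF jJ] ga[OF jJ] g1[OF j] by (cases "\<gamma> j = 0") (auto simp: t0_def tm_def field_simps)
  define \<theta>1 where "\<theta>1 i = \<theta> i + t0 * \<gamma> i" for i
  have th1: "\<theta>1 i \<in> \<rat> \<and> 0 \<le> \<theta>1 i \<and> \<theta>1 i \<le> 1" if "i \<in> J" for i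
  proof -
    have "\<theta>1 i \<le> 1"
    proof (cases "i \<in> R")
      case True
      have "t0 * \<gamma> i \<le> 1 - \<theta> i"
      proof (cases "\<gamma> i = 0")
        case True
        then show ?thesis using th[OF that] by simp
      next
        case False
        then show ?thesis using jmin[OF \<open>i \<in> R\<close>] ga[OF that]
          by (simp add: t0_def[symmetric]) (simp add: tm_def field_simps)
      qed
      then show ?thesis by (simp add: \<theta>1_def)
    next
      case False
      then have "\<theta> i + \<gamma> i \<le> 1" using sl[OF that] that by (auto simp: R_def)
      moreover have "t0 * \<gamma> i \<le> \<gamma> i" using ga[OF that] t01 t0 by (simp add: mult_left_le_one_le)
      ultimately show ?thesis by (simp add: \<theta>1_def)
    qed
    then show ?thesis using th[OF that] ga[OF that] t0 t0Q by (auto simp: \<theta>1_def)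
  qed
  define y1 where "y1 = y + (t0 * s) *\<^sub>R u"
  have y1C: "y1 \<in> C" unfolding y1_def using C Suc.prems(1,2,3) t0 t0Q by auto
  have su: "(\<Sum>i\<in>J. (t0 * \<gamma> i) *\<^sub>R b i) = (t0 * s) *\<^sub>R u"
    using arg_cong[OF Suc.prems(4), of "\<lambda>x. t0 *\<^sub>R x"] by (simp add: scaleR_right.sum)
  have v: "y1 - (\<Sum>i\<in>J. \<theta>1 i *\<^sub>R b i) = y - (\<Sum>i\<in>J. \<theta> i *\<^sub>R b i)"
    unfolding y1_def \<theta>1_def by (simp add: scaleR_add_left sum.distrib su algebra_simps)
  have v2: "y1 - (\<Sum>i\<in>J-{j}. \<theta>1 i *\<^sub>R b i) = y - (\<Sum>i\<in>J. \<theta> i *\<^sub>R b i) + b j"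
    unfolding v[symmetric] using jJ J hit by (simp add: sum.remove[of J j] \<theta>1_def)
  define \<theta>2 where "\<theta>2 = \<theta>1(j := 0)"
  define \<gamma>2 where "\<gamma>2 i = (1 - t0) * \<gamma> i" for i
  define r2 where "r2 = r(j := r j - 1)"
  have v3: "y1 - (\<Sum>i\<in>J. \<theta>2 i *\<^sub>R b i) = y - (\<Sum>i\<in>J. \<theta> i *\<^sub>R b i) + b j"
    unfolding v2[symmetric] using jJ J by (simp add: sum.remove[of J j] \<theta>2_def)
  have r2s: "(\<Sum>i\<in>J. real (r i) *\<^sub>R b i) = b j + (\<Sum>i\<in>J. real (r2 i) *\<^sub>R b i)"
  proof -
    have "(\<Sum>i\<in>J-{j}. real (r2 i) *\<^sub>R b i) = (\<Sum>i\<in>J-{j}. real (r i) *\<^sub>R b i)"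
      by (rule sum.cong) (auto simp: r2_def)
    then show ?thesis using jJ J rj
      by (simp add: sum.remove[of J j] r2_def of_nat_diff algebra_simps)
  qed
  have r2N: "(\<Sum>i\<in>J. r2 i) = N"
  proof -
    have "(\<Sum>i\<in>J-{j}. r2 i) = (\<Sum>i\<in>J-{j}. r i)"
      by (rule sum.cong) (auto simp: r2_def)
    then show ?thesis using jJ J rj Suc.prems(8)
      by (simp add: sum.remove[of J j] r2_def)
  qed
  have "\<exists>L. (\<forall>(j, y', \<theta>') \<in> set L. j \<in> J \<and> y' \<in> C \<and> (\<forall>i\<in>J-{j}. \<theta>' i \<in> \<rat> \<and> 0 \<le> \<theta>' i \<and> \<theta>' i \<le> 1)) \<and>
     (\<forall>t. vpf J b (y1 - (\<Sum>i\<in>J. \<theta>2 i *\<^sub>R b i) + (\<Sum>i\<in>J. real (r2 i) *\<^sub>R b i) + t) =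
          vpf J b (y1 - (\<Sum>i\<in>J. \<theta>2 i *\<^sub>R b i) + t) +
          (\<Sum>(j, y', \<theta>')\<leftarrow>L. vpf (J-{j}) b (y' - (\<Sum>i\<in>J-{j}. \<theta>' i *\<^sub>R b i) + t)))"
  proof (rule Suc.IH[where s = "(1 - t0) * s" and \<gamma> = \<gamma>2])
    show "y1 \<in> C" by fact
    show "(1 - t0) * s \<in> \<rat>" "0 \<le> (1 - t0) * s" using t0Q t01 Suc.prems(2,3) by auto
    show "(\<Sum>i\<in>J. \<gamma>2 i *\<^sub>R b i) = ((1 - t0) * s) *\<^sub>R u"
      using arg_cong[OF Suc.prems(4), of "\<lambda>x. (1 - t0) *\<^sub>R x"] by (simp add: \<gamma>2_def scaleR_right.sum)
    show "\<theta>2 i \<in> \<rat> \<and> 0 \<le> \<theta>2 i \<and> \<theta>2 i \<le> 1" if "i \<in> J" for i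
      using th1[OF that] by (auto simp: \<theta>2_def)
    show "\<gamma>2 i \<in> \<rat> \<and> 0 \<le> \<gamma>2 i" if "i \<in> J" for i
      using ga[OF that] t0Q t01 by (auto simp: \<gamma>2_def)
    show "0 \<le> \<theta>2 i + \<gamma>2 i - real (r2 i) \<and> \<theta>2 i + \<gamma>2 i - real (r2 i) \<le> 1" if "i \<in> J" for i
    proof (cases "i = j")
      case True
      then have "\<theta>2 i + \<gamma>2 i - real (r2 i) = \<theta> j + \<gamma> j - real (r j)"
        using hit rj by (simp add: \<theta>2_def \<gamma>2_def r2_def of_nat_diff algebra_simps)
      then show ?thesis using sl[OF jJ] by simp
    next
      case False
      then have "\<theta>2 i + \<gamma>2 i - real (r2 i) = \<theta> i + \<gamma> i - real (r i)"
        by (simp add: \<theta>2_def \<gamma>2_def r2_def \<theta>1_def algebra_simps)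
      then show ?thesis using sl[OF that] by simp
    qed
    show "(\<Sum>i\<in>J. r2 i) = N" by fact
  qed
  then obtain L where L: "\<forall>(j, y', \<theta>') \<in> set L. j \<in> J \<and> y' \<in> C \<and> (\<forall>i\<in>J-{j}. \<theta>' i \<in> \<rat> \<and> 0 \<le> \<theta>' i \<and> \<theta>' i \<le> 1)"
    and Lt: "\<And>t. vpf J b (y1 - (\<Sum>i\<in>J. \<theta>2 i *\<^sub>R b i) + (\<Sum>i\<in>J. real (r2 i) *\<^sub>R b i) + t) =
          vpf J b (y1 - (\<Sum>i\<in>J. \<theta>2 i *\<^sub>R b i) + t) +
          (\<Sum>(j, y', \<theta>')\<leftarrow>L. vpf (J-{j}) b (y' - (\<Sum>i\<in>J-{j}. \<theta>' i *\<^sub>R b i) + t))"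
    by auto
  show ?case
  proof (intro exI[of _ "(j, y1, \<theta>1) # L"] conjI allI)
    show "\<forall>(j, y', \<theta>') \<in> set ((j, y1, \<theta>1) # L). j \<in> J \<and> y' \<in> C \<and> (\<forall>i\<in>J-{j}. \<theta>' i \<in> \<rat> \<and> 0 \<le> \<theta>' i \<and> \<theta>' i \<le> 1)"
      using L jJ y1C th1 by auto
    fix t
    let ?v = "y - (\<Sum>i\<in>J. \<theta> i *\<^sub>R b i)"
    have "vpf J b (?v + (\<Sum>i\<in>J. real (r i) *\<^sub>R b i) + t)
        = vpf J b (?v + b j + t) + (\<Sum>(j, y', \<theta>')\<leftarrow>L. vpf (J-{j}) b (y' - (\<Sum>i\<in>J-{j}. \<theta>' i *\<^sub>R b i) + t))"
      using Lt[of t] unfolding r2s v3 by (simp add: algebra_simps)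
    also have "vpf J b (?v + b j + t) = vpf J b (?v + t) + vpf (J-{j}) b (?v + b j + t)"
      using vpf_step[OF J jJ fin, of "?v + t"] by (simp add: algebra_simps)
    finally show "vpf J b (?v + (\<Sum>i\<in>J. real (r i) *\<^sub>R b i) + t) = vpf J b (?v + t) +
       (\<Sum>(j, y', \<theta>')\<leftarrow>(j, y1, \<theta>1) # L. vpf (J-{j}) b (y' - (\<Sum>i\<in>J-{j}. \<theta>' i *\<^sub>R b i) + t))"
      using v2 by simp
  qed
qed

lemma common_denominator:
  assumes "finite J" "\<And>i. i \<in> J \<Longrightarrow> 0 \<le> c i \<and> c i \<in> \<rat>"
  shows "\<exists>m::nat. m \<ge> 1 \<and> (\<forall>i\<in>J. \<exists>k::nat. real m * c i = real k)"
  using assms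
proof (induction J)
  case empty
  then show ?case by auto
next
  case (insert j J)
  then obtain m :: nat where m: "m \<ge> 1" "\<And>i. i \<in> J \<Longrightarrow> \<exists>k::nat. real m * c i = real k" by auto
  have "c j \<in> \<rat>" "0 \<le> c j" using insert.prems by auto
  then obtain a d :: nat where ad: "d \<noteq> 0" "\<bar>c j\<bar> = real a / real d" by (metis Rats_abs_nat_div_natE)
  have "\<exists>k::nat. real (m * d) * c i = real k" if "i \<in> insert j J" for i
  proof (cases "i = j")
    case True
    have "real (m * d) * c i = real (m * a)" using ad True \<open>0 \<le> c j\<close> by (simp add: field_simps)
    then show ?thesis by blast
  next
    case False
    then have "i \<in> J" using that by simp
    from m(2)[OF this] obtain k :: nat where "real m * c i = real k" by blast
    then have "real (m * d) * c i = real (k * d)" by simp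
    then show ?thesis by blast
  qed
  then show ?case using m(1) ad(1) by (intro exI[of _ "m * d"]) auto
qed

text \<open>An Ehrhart-type statement: the values along a progression are polynomial from the first term
  on. The proof is an induction on the set \<open>J\<close> of vectors. If the cone of \<open>J\<close> contains \<open>u\<close>, then
  a multiple \<open>M u\<close> is a combination of vectors of \<open>J\<close> with natural coefficients, and \<open>vpf_path\<close>
  writes the difference of consecutive terms as a sum of terms for smaller sets. If the cone of
  \<open>J\<close> misses \<open>C\<close>, then all terms vanish, because a solution for \<open>y - \<Sum>\<theta> b\<close> with \<open>\<theta> \<ge> 0\<close> would
  put \<open>y\<close> into the cone. The shift by \<open>\<Sum>\<theta> b\<close> is needed for the induction; it also allows a
  progression to start slightly outside \<open>C\<close>, which is how points on the boundary of \<open>C\<close> are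
  reached later.\<close>

theorem vpf_poly_on_ray:
  fixes b :: "'i \<Rightarrow> 'a::real_vector"
  assumes I: "finite I" and fin: "\<And>v. finite (vpf_sols I b v)"
    and C: "\<And>y t. y \<in> C \<Longrightarrow> t \<in> \<rat> \<Longrightarrow> 0 \<le> t \<Longrightarrow> y + t *\<^sub>R u \<in> C"
    and dich: "\<And>J. J \<subseteq> I \<Longrightarrow> C \<inter> qcone J b = {} \<or> u \<in> qcone J b"
  shows "\<exists>M::nat. M \<ge> 1 \<and> (\<forall>y\<in>C. \<forall>\<theta>. (\<forall>i\<in>I. \<theta> i \<in> \<rat> \<and> 0 \<le> \<theta> i \<and> \<theta> i \<le> 1) \<longrightarrow>
      poly_fun (card I) (\<lambda>n. vpf I b (y - (\<Sum>i\<in>I. \<theta> i *\<^sub>R b i) + (real n * real M) *\<^sub>R u)))"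
proof -
  define scales where "scales J m \<longleftrightarrow> (\<exists>k::'i \<Rightarrow> nat. real m *\<^sub>R u = (\<Sum>i\<in>J. real (k i) *\<^sub>R b i))" for J m
  have ex: "\<exists>m::nat. m \<ge> 1 \<and> (u \<in> qcone J b \<longrightarrow> scales J m)" if "J \<subseteq> I" for J
  proof (cases "u \<in> qcone J b")
    case True
    then obtain c where c: "\<And>i. i \<in> J \<Longrightarrow> 0 \<le> c i \<and> c i \<in> \<rat>" "u = (\<Sum>i\<in>J. c i *\<^sub>R b i)"
      by (auto simp: qcone_def)
    obtain m :: nat where m: "m \<ge> 1" "\<forall>i\<in>J. \<exists>k::nat. real m * c i = real k"
      using common_denominator[of J c] c I \<open>J \<subseteq> I\<close> finite_subset by blast
    obtain k :: "'i \<Rightarrow> nat" where k: "\<And>i. i \<in> J \<Longrightarrow> real m * c i = real (k i)" using m(2) by metis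
    have "real m *\<^sub>R u = (\<Sum>i\<in>J. real (k i) *\<^sub>R b i)"
      unfolding c(2) scaleR_right.sum by (rule sum.cong) (auto simp: k[symmetric])
    then show ?thesis using m(1) by (auto simp: scales_def)
  qed auto
  then obtain mm where mm: "\<And>J. J \<subseteq> I \<Longrightarrow> mm J \<ge> (1::nat)" "\<And>J. J \<subseteq> I \<Longrightarrow> u \<in> qcone J b \<Longrightarrow> scales J (mm J)"
    by metis
  \<comment> \<open>One multiple that clears the denominators of \<open>u\<close> with respect to all subsets.\<close>
  define M where "M = (\<Prod>J\<in>Pow I. mm J)"
  have M1: "M \<ge> 1" unfolding M_def using mm(1) by (auto intro!: Suc_leI prod_pos) (metis not_less_eq_eq zero_less_iff_neq_zero le_zero_eq)
  have scalesM: "scales J M" if J: "J \<subseteq> I" "u \<in> qcone J b" for J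
  proof -
    obtain k :: "'i \<Rightarrow> nat" where k: "real (mm J) *\<^sub>R u = (\<Sum>i\<in>J. real (k i) *\<^sub>R b i)"
      using mm(2)[OF J] by (auto simp: scales_def)
    have "mm J dvd M" unfolding M_def using I J by (intro dvd_prodI) auto
    then obtain q where q: "M = mm J * q" by blast
    have "real M *\<^sub>R u = real q *\<^sub>R (real (mm J) *\<^sub>R u)" by (simp add: q mult.commute)
    also have "\<dots> = (\<Sum>i\<in>J. real (q * k i) *\<^sub>R b i)" unfolding k scaleR_right.sum by simp
    finally have "real M *\<^sub>R u = (\<Sum>i\<in>J. real (q * k i) *\<^sub>R b i)" .
    then show ?thesis unfolding scales_def by (intro exI[of _ "\<lambda>i. q * k i"]) auto
  qed
  have main: "poly_fun (card J) (\<lambda>n. vpf J b (y - (\<Sum>i\<in>J. \<theta> i *\<^sub>R b i) + (real n * real M) *\<^sub>R u))"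
    if "J \<subseteq> I" "y \<in> C" "\<And>i. i \<in> J \<Longrightarrow> \<theta> i \<in> \<rat> \<and> 0 \<le> \<theta> i \<and> \<theta> i \<le> 1" for J y \<theta>
    using that
  proof (induction "card J" arbitrary: J y \<theta> rule: less_induct)
    case less
    have J: "finite J" using I less.prems finite_subset by auto
    have finJ: "finite (vpf_sols J b v)" for v by (rule finite_vsol_subset[OF I less.prems(1) fin])
    show ?case
    proof (cases "C \<inter> qcone J b = {}")
      case True
      have "vpf_sols J b (y - (\<Sum>i\<in>J. \<theta> i *\<^sub>R b i) + (real n * real M) *\<^sub>R u) = {}" for n
      proof (rule ccontr)
        assume "vpf_sols J b (y - (\<Sum>i\<in>J. \<theta> i *\<^sub>R b i) + (real n * real M) *\<^sub>R u) \<noteq> {}"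
        then obtain f where f: "(\<Sum>i\<in>J. real (f i) *\<^sub>R b i) = y - (\<Sum>i\<in>J. \<theta> i *\<^sub>R b i) + (real n * real M) *\<^sub>R u"
          by (auto simp: vpf_sols_def)
        have "y + (real n * real M) *\<^sub>R u = (\<Sum>i\<in>J. (real (f i) + \<theta> i) *\<^sub>R b i)"
          by (simp add: scaleR_add_left sum.distrib f)
        then have "y + (real n * real M) *\<^sub>R u \<in> qcone J b"
          using less.prems(3) unfolding qcone_def by (intro CollectI exI[of _ "\<lambda>i. real (f i) + \<theta> i"]) auto
        moreover have "y + (real n * real M) *\<^sub>R u \<in> C" using C[OF less.prems(2)] by auto
        ultimately show False using True by blast
      qed
      then show ?thesis by (simp add: vpf_def poly_fun_const)
    next
      case False
      then have uJ: "u \<in> qcone J b" using dich less.prems(1) by blast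
      obtain k :: "'i \<Rightarrow> nat" where k: "real M *\<^sub>R u = (\<Sum>i\<in>J. real (k i) *\<^sub>R b i)"
        using scalesM[OF less.prems(1) uJ] by (auto simp: scales_def)
      let ?v = "y - (\<Sum>i\<in>J. \<theta> i *\<^sub>R b i)"
      have "\<exists>L. (\<forall>(j, y', \<theta>') \<in> set L. j \<in> J \<and> y' \<in> C \<and> (\<forall>i\<in>J-{j}. \<theta>' i \<in> \<rat> \<and> 0 \<le> \<theta>' i \<and> \<theta>' i \<le> 1)) \<and>
       (\<forall>t. vpf J b (?v + (\<Sum>i\<in>J. real (k i) *\<^sub>R b i) + t) = vpf J b (?v + t) +
          (\<Sum>(j, y', \<theta>')\<leftarrow>L. vpf (J-{j}) b (y' - (\<Sum>i\<in>J-{j}. \<theta>' i *\<^sub>R b i) + t)))"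
        by (rule vpf_path[OF J finJ C less.prems(2), where s = "real M" and \<gamma> = "\<lambda>i. real (k i)"])
           (use less.prems(3) k in auto)
      then obtain L where L: "\<And>j y' \<theta>'. (j, y', \<theta>') \<in> set L \<Longrightarrow> j \<in> J \<and> y' \<in> C \<and> (\<forall>i\<in>J-{j}. \<theta>' i \<in> \<rat> \<and> 0 \<le> \<theta>' i \<and> \<theta>' i \<le> 1)"
        and Lt: "\<And>t. vpf J b (?v + (\<Sum>i\<in>J. real (k i) *\<^sub>R b i) + t) = vpf J b (?v + t) +
          (\<Sum>(j, y', \<theta>')\<leftarrow>L. vpf (J-{j}) b (y' - (\<Sum>i\<in>J-{j}. \<theta>' i *\<^sub>R b i) + t))"
        by fast
      let ?g = "\<lambda>n. vpf J b (?v + (real n * real M) *\<^sub>R u)"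
      have step: "?g (Suc n) - ?g n = (\<Sum>x\<leftarrow>L. (case x of (j, y', \<theta>') \<Rightarrow> vpf (J-{j}) b (y' - (\<Sum>i\<in>J-{j}. \<theta>' i *\<^sub>R b i) + (real n * real M) *\<^sub>R u)))" for n
      proof -
        have "?v + (real (Suc n) * real M) *\<^sub>R u = ?v + (\<Sum>i\<in>J. real (k i) *\<^sub>R b i) + (real n * real M) *\<^sub>R u"
          unfolding k[symmetric] by (simp add: algebra_simps)
        then show ?thesis using Lt[of "(real n * real M) *\<^sub>R u"] by (simp only:)
      qed
      show ?thesis
      proof (cases "J = {}")
        case True
        then have "u = 0 " using k M1 by auto
        then show ?thesis by (simp add: poly_fun_const)
      next
        case False
        then obtain d where d: "card J = Suc d" using J by (metis card_eq_0_iff not0_implies_Suc)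
        have "poly_fun d (\<lambda>n. ?g (Suc n) - ?g n)"
          unfolding step
        proof (rule poly_fun_sum_list)
          fix x assume x: "x \<in> set L"
          obtain j y' \<theta>' where xe: "x = (j, y', \<theta>')" by (cases x)
          note Lx = L[OF x[unfolded xe]]
          have cd: "card (J - {j}) = d" using Lx d J by simp
          have "poly_fun (card (J - {j})) (\<lambda>n. vpf (J-{j}) b (y' - (\<Sum>i\<in>J-{j}. \<theta>' i *\<^sub>R b i) + (real n * real M) *\<^sub>R u))"
            by (rule less.hyps) (use cd d Lx less.prems(1) in auto)
          then show "poly_fun d (\<lambda>n. case x of (j, y', \<theta>') \<Rightarrow> vpf (J-{j}) b (y' - (\<Sum>i\<in>J-{j}. \<theta>' i *\<^sub>R b i) + (real n * real M) *\<^sub>R u))"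
            unfolding xe cd by simp
        qed
        from poly_fun_antidifference[OF this] show ?thesis using d by simp
      qed
    qed
  qed
  show ?thesis using M1 main[of I] by blast
qed

section \<open>Eventual polynomiality of vector partition functions\<close>

definition zspan :: "'i set \<Rightarrow> ('i \<Rightarrow> 'a::real_vector) \<Rightarrow> 'a set" where
  "zspan J b = {v. \<exists>c. v = (\<Sum>i\<in>J. real_of_int (c i) *\<^sub>R b i)}"

lemma zspan_add: "v \<in> zspan J b \<Longrightarrow> w \<in> zspan J b \<Longrightarrow> v + w \<in> zspan J b"
proof -
  assume "v \<in> zspan J b" "w \<in> zspan J b"
  then obtain c d where "v = (\<Sum>i\<in>J. real_of_int (c i) *\<^sub>R b i)" "w = (\<Sum>i\<in>J. real_of_int (d i) *\<^sub>R b i)"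
    unfolding zspan_def by blast
  then have "v + w = (\<Sum>i\<in>J. real_of_int (c i + d i) *\<^sub>R b i)"
    by (simp add: scaleR_add_left sum.distrib)
  then show ?thesis unfolding zspan_def by (intro CollectI exI[of _ "\<lambda>i. c i + d i"])
qed

lemma zspan_scale: "v \<in> zspan J b \<Longrightarrow> real_of_int m *\<^sub>R v \<in> zspan J b"
proof -
  assume "v \<in> zspan J b"
  then obtain c where "v = (\<Sum>i\<in>J. real_of_int (c i) *\<^sub>R b i)"
    unfolding zspan_def by blast
  then have "real_of_int m *\<^sub>R v = (\<Sum>i\<in>J. real_of_int (m * c i) *\<^sub>R b i)"
    by (simp add: scaleR_right.sum)
  then show ?thesis unfolding zspan_def by (intro CollectI exI[of _ "\<lambda>i. m * c i"])
qed

lemma zspan_zero: "0 \<in> zspan J b"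
  unfolding zspan_def by (intro CollectI exI[of _ "\<lambda>_. 0"]) simp

lemma zspan_uminus: "v \<in> zspan J b \<Longrightarrow> - v \<in> zspan J b"
  using zspan_scale[of v J b "-1"] by simp

lemma zspan_diff: "v \<in> zspan J b \<Longrightarrow> w \<in> zspan J b \<Longrightarrow> v - w \<in> zspan J b"
  using zspan_add[OF _ zspan_uminus] by force

lemma zspan_sum: "(\<And>x. x \<in> A \<Longrightarrow> f x \<in> zspan J b) \<Longrightarrow> (\<Sum>x\<in>A. f x) \<in> zspan J b"
  by (induction A rule: infinite_finite_induct) (auto intro: zspan_zero zspan_add)

lemma zspan_base: "finite J \<Longrightarrow> j \<in> J \<Longrightarrow> b j \<in> zspan J b"
  unfolding zspan_def
  by (intro CollectI exI[of _ "\<lambda>i. if i = j then 1 else 0"])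
     (simp add: if_distrib[of "\<lambda>x. real_of_int x *\<^sub>R _"] sum.delta cong: if_cong)

lemma vpf_sols_in_zspan:
  assumes "f \<in> vpf_sols J b v" shows "v \<in> zspan J b"
  using assms unfolding vpf_sols_def zspan_def by (intro CollectI exI[of _ "\<lambda>i. int (f i)"]) auto

definition ev_poly :: "(nat \<Rightarrow> real) \<Rightarrow> bool" where
  "ev_poly g \<longleftrightarrow> (\<exists>p N. \<forall>n\<ge>N. g n = poly p (real n))"

lemma ev_poly_const: "ev_poly (\<lambda>n. c)"
  unfolding ev_poly_def by (rule exI[of _ "[:c:]"]) auto

lemma ev_poly_add: assumes "ev_poly f" "ev_poly g" shows "ev_poly (\<lambda>n. f n + g n)"
proof -
  obtain p N q M where "\<forall>n\<ge>N. f n = poly p (real n)" "\<forall>n\<ge>M. g n = poly q (real n)"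
    using assms unfolding ev_poly_def by auto
  then show ?thesis unfolding ev_poly_def
    by (intro exI[of _ "p + q"] exI[of _ "max N M"]) auto
qed

lemma ev_poly_cmult: assumes "ev_poly f" shows "ev_poly (\<lambda>n. c * f n)"
proof -
  obtain p N where "\<forall>n\<ge>N. f n = poly p (real n)"
    using assms unfolding ev_poly_def by auto
  then show ?thesis unfolding ev_poly_def
    by (intro exI[of _ "smult c p"] exI[of _ N]) auto
qed

lemma ev_poly_sum_list:
  "(\<And>x. x \<in> set L \<Longrightarrow> ev_poly (f x)) \<Longrightarrow> ev_poly (\<lambda>n. \<Sum>x\<leftarrow>L. f x n)"
  by (induction L) (auto intro: ev_poly_const ev_poly_add)

lemma ev_poly_sum:
  "(\<And>x. x \<in> A \<Longrightarrow> ev_poly (f x)) \<Longrightarrow> ev_poly (\<lambda>n. \<Sum>x\<in>A. f x n)"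
  by (induction A rule: infinite_finite_induct) (auto intro: ev_poly_const ev_poly_add)

lemma ev_poly_antidifference:
  assumes "ev_poly (\<lambda>n. g (Suc n) - g n)"
  shows "ev_poly g"
proof -
  obtain q N where q: "\<And>n. n \<ge> N \<Longrightarrow> g (Suc n) - g n = poly q (real n)"
    using assms unfolding ev_poly_def by auto
  obtain p where p: "\<And>x. poly p (x + 1) - poly p x = poly q x"
    using poly_antidifference[of q, OF order_refl] by auto
  have "g n = poly (p + [:g N - poly p (real N):]) (real n)" if "n \<ge> N" for n
    using that
  proof (induction n rule: dec_induct)
    case (step n)
    show ?case using step q[of n] p[of "real n"] by (simp add: add.commute)
  qed simp
  then show ?thesis unfolding ev_poly_def by blast
qed

text \<open>Every vector of the lattice is a sum of steps \<open>b j\<close> and \<open>- b j\<close>, and each step changes the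
  partition function by a value of the partition function of fewer vectors.\<close>

lemma vpf_telescope:
  fixes b :: "'i \<Rightarrow> 'a::real_vector"
  assumes J: "finite J" and fin: "\<And>v. finite (vpf_sols J b v)" and v: "v \<in> zspan J b"
  shows "\<exists>L. (\<forall>(s, j, w)\<in>set L. j \<in> J) \<and>
    (\<forall>t. vpf J b (v + t) = vpf J b t + (\<Sum>(s, j, w)\<leftarrow>L. s * vpf (J - {j}) b (w + t)))"
proof -
  define P where "P v \<longleftrightarrow> (\<exists>L. (\<forall>(s, j, w)\<in>set L. j \<in> J) \<and>
    (\<forall>t. vpf J b (v + t) = vpf J b t + (\<Sum>(s, j, w)\<leftarrow>L. s * vpf (J - {j}) b (w + t))))" for v
  have P0: "P 0" unfolding P_def by (rule exI[of _ "[]"]) simp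
  have Pp: "P (v + b j)" if Pv: "P v" and "j \<in> J" for v j
  proof -
    obtain L where L: "\<forall>(s, j, w)\<in>set L. j \<in> J"
      "\<And>t. vpf J b (v + t) = vpf J b t + (\<Sum>(s, j, w)\<leftarrow>L. s * vpf (J - {j}) b (w + t))"
      using Pv unfolding P_def by fast
    show ?thesis unfolding P_def
    proof (intro exI[of _ "(1, j, v + b j) # L"] conjI allI)
      fix t
      show "vpf J b (v + b j + t) = vpf J b t + (\<Sum>(s, j, w)\<leftarrow>(1, j, v + b j) # L. s * vpf (J - {j}) b (w + t))"
        using L(2)[of t] vpf_step[OF J \<open>j \<in> J\<close> fin, of "v + t"] by (simp add: add_ac)
    qed (use L(1) that in auto)
  qed
  have Pm: "P (v - b j)" if Pv: "P v" and "j \<in> J" for v j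
  proof -
    obtain L where L: "\<forall>(s, j, w)\<in>set L. j \<in> J"
      "\<And>t. vpf J b (v + t) = vpf J b t + (\<Sum>(s, j, w)\<leftarrow>L. s * vpf (J - {j}) b (w + t))"
      using Pv unfolding P_def by fast
    show ?thesis unfolding P_def
    proof (intro exI[of _ "(-1, j, v) # L"] conjI allI)
      fix t
      show "vpf J b (v - b j + t) = vpf J b t + (\<Sum>(s, j, w)\<leftarrow>(-1, j, v) # L. s * vpf (J - {j}) b (w + t))"
        using L(2)[of t] vpf_step[OF J \<open>j \<in> J\<close> fin, of "v - b j + t"] by (simp add: algebra_simps)
    qed (use L(1) that in auto)
  qed
  have Pn: "P (v + real_of_int c *\<^sub>R b j)" if "P v" "j \<in> J" for v j c
  proof (induction c rule: int_induct[where k = 0])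
    case base
    then show ?case using that by simp
  next
    case (step1 i)
    show ?case using Pp[OF step1(2) that(2)] by (simp add: algebra_simps)
  next
    case (step2 i)
    show ?case using Pm[OF step2(2) that(2)] by (simp add: algebra_simps)
  qed
  have "P (\<Sum>i\<in>A. real_of_int (c i) *\<^sub>R b i)" if "finite A" "A \<subseteq> J" for A c
    using that
  proof (induction A)
    case (insert x F)
    then show ?case using Pn[of "\<Sum>i\<in>F. real_of_int (c i) *\<^sub>R b i" x "c x"] by (simp add: add.commute)
  qed (simp add: P0)
  then show ?thesis using v J unfolding zspan_def P_def by blast
qed

text \<open>If \<open>u\<close> lies in the lattice spanned by \<open>J\<close>, then the differences are handled by \<open>vpf_telescope\<close>
  and induction. If it does not, then by saturation two terms of the progression cannot both lie
  in the lattice, so that the values are eventually 0. It is saturation that gives polynomials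
  in place of quasi-polynomials.\<close>

theorem vpf_ev_poly:
  fixes b :: "'i \<Rightarrow> 'a::real_vector"
  assumes I: "finite I" and fin: "\<And>v. finite (vpf_sols I b v)"
    and sat: "\<And>J m. J \<subseteq> I \<Longrightarrow> m \<noteq> 0 \<Longrightarrow> real_of_int m *\<^sub>R u \<in> zspan J b \<Longrightarrow> u \<in> zspan J b"
  shows "ev_poly (\<lambda>n. vpf I b (real n *\<^sub>R u + w))"
proof -
  have "ev_poly (\<lambda>n. vpf J b (real n *\<^sub>R u + w))" if "J \<subseteq> I" for J w
    using that
  proof (induction "card J" arbitrary: J w rule: less_induct)
    case less
    have J: "finite J" using I less.prems finite_subset by auto
    have finJ: "finite (vpf_sols J b v)" for v by (rule finite_vsol_subset[OF I less.prems(1) fin])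
    show ?case
    proof (cases "u \<in> zspan J b")
      case True
      obtain L where L: "\<forall>(s, j, w)\<in>set L. j \<in> J"
        "\<And>t. vpf J b (u + t) = vpf J b t + (\<Sum>(s, j, w)\<leftarrow>L. s * vpf (J - {j}) b (w + t))"
        using vpf_telescope[OF J finJ True] by blast
      let ?g = "\<lambda>n. vpf J b (real n *\<^sub>R u + w)"
      have eq: "?g (Suc n) - ?g n = (\<Sum>x\<leftarrow>L. (case x of (s, j, w') \<Rightarrow> s * vpf (J - {j}) b (real n *\<^sub>R u + (w' + w))))" for n
        using L(2)[of "real n *\<^sub>R u + w"] by (simp add: algebra_simps)
      have "ev_poly (\<lambda>n. ?g (Suc n) - ?g n)"
        unfolding eq
      proof (rule ev_poly_sum_list)
        fix x assume x: "x \<in> set L"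
        obtain s j w' where xe: "x = (s, j, w')" by (cases x)
        have "j \<in> J" using x L(1) xe by auto
        then have "ev_poly (\<lambda>n. vpf (J - {j}) b (real n *\<^sub>R u + (w' + w)))"
          using J less.prems by (intro less.hyps card_Diff1_less) auto
        then show "ev_poly (\<lambda>n. case x of (s, j, w') \<Rightarrow> s * vpf (J - {j}) b (real n *\<^sub>R u + (w' + w)))"
          unfolding xe by (simp add: ev_poly_cmult)
      qed
      then show ?thesis by (rule ev_poly_antidifference)
    next
      case False
      have uniq: "n = n'" if "real n *\<^sub>R u + w \<in> zspan J b" "real n' *\<^sub>R u + w \<in> zspan J b" for n n' :: nat
      proof (rule ccontr)
        assume ne: "n \<noteq> n'"
        have "real_of_int (int n - int n') *\<^sub>R u \<in> zspan J b"
          using zspan_diff[OF that] by (simp add: algebra_simps)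
        then show False using sat[OF less.prems, of "int n - int n'"] ne False by simp
      qed
      have "\<exists>N. \<forall>n\<ge>N. real n *\<^sub>R u + w \<notin> zspan J b"
      proof (cases "\<exists>n. real n *\<^sub>R u + w \<in> zspan J b")
        case True
        then obtain n where "real n *\<^sub>R u + w \<in> zspan J b" by blast
        then have "\<forall>m\<ge>Suc n. real m *\<^sub>R u + w \<notin> zspan J b" using uniq by fastforce
        then show ?thesis by blast
      qed auto
      then obtain N where N: "\<And>n. n \<ge> N \<Longrightarrow> real n *\<^sub>R u + w \<notin> zspan J b" by blast
      have "vpf J b (real n *\<^sub>R u + w) = 0" if "n \<ge> N" for n
        using vpf_sols_in_zspan[of _ J b] N[OF that] unfolding vpf_def by (auto simp: card_eq_0_iff)
      then show ?thesis unfolding ev_poly_def by (intro exI[of _ 0] exI[of _ N]) auto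
    qed
  qed
  then show ?thesis by blast
qed

lemma finite_bounded_funs: "finite I \<Longrightarrow> finite {f::'i \<Rightarrow> nat. (\<forall>i. i \<notin> I \<longrightarrow> f i = 0) \<and> (\<forall>i\<in>I. f i \<le> B)}"
  by (rule finite_subset[OF _ finite_set_of_finite_funs[of I "{..B}" 0]]) auto

lemma finite_vsol_of_functional:
  assumes I: "finite I" and phi: "linear \<phi>" and pos: "\<And>i. i \<in> I \<Longrightarrow> \<phi> (b i) \<ge> (1::real)"
  shows "finite (vpf_sols I b v)"
proof (rule finite_subset[OF _ finite_bounded_funs[OF I, of "nat \<lceil>\<phi> v\<rceil>"]], safe)
  fix f i assume f: "f \<in> vpf_sols I b v"
  show "f i = 0" if "i \<notin> I" using f that by (auto simp: vpf_sols_def)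
  assume i: "i \<in> I"
  have "v = (\<Sum>i\<in>I. real (f i) *\<^sub>R b i)" using f by (simp add: vpf_sols_def)
  then have "\<phi> v = (\<Sum>i\<in>I. real (f i) * \<phi> (b i))"
    by (simp add: linear_sum[OF phi] linear_scale[OF phi])
  also have "\<dots> \<ge> (\<Sum>i\<in>I. real (f i))"
    using mult_left_mono[OF pos] by (intro sum_mono) force
  finally have "(\<Sum>i\<in>I. real (f i)) \<le> \<phi> v" .
  moreover have "real (f i) \<le> (\<Sum>i\<in>I. real (f i))" using I i by (intro member_le_sum) auto
  ultimately show "f i \<le> nat \<lceil>\<phi> v\<rceil>" by linarith
qed

section \<open>Kostant's partition function of type A\<close>

definition pos_root :: "nat \<times> nat \<Rightarrow> (nat \<Rightarrow>\<^sub>0 real)" where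
  "pos_root p = single (fst p) 1 - single (snd p) 1"

definition index_pairs :: "nat \<Rightarrow> (nat \<times> nat) set" where
  "index_pairs r = {(i, j). i < j \<and> j < r}"

lemma finite_index_pairs: "finite (index_pairs r)"
  by (rule finite_subset[of _ "{..<r} \<times> {..<r}"]) (auto simp: index_pairs_def)

lemma lookup_scaleR: "lookup (c *\<^sub>R x) k = c *\<^sub>R lookup x k"
  unfolding scaleR_poly_mapping_def
  by (subst lookup_Abs_poly_mapping) (auto intro: finite_subset[OF _ finite_lookup[of x]])

lemma finite_vsol_pos_root: "finite (vpf_sols (index_pairs r) pos_root v)"
proof (rule finite_vsol_of_functional[OF finite_index_pairs, where \<phi> = "\<lambda>v. \<Sum>i<r. (real r - real i) * lookup v i"])
  show "linear (\<lambda>v. \<Sum>i<r. (real r - real i) * lookup v i)"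
    by (rule linearI) (simp_all add: lookup_add lookup_scaleR distrib_left sum.distrib sum_distrib_left mult_ac)
  fix p assume "p \<in> index_pairs r"
  then obtain i j where p: "p = (i, j)" "i < j" "j < r" by (auto simp: index_pairs_def)
  have "(\<Sum>l<r. (real r - real l) * lookup (pos_root p) l)
      = (\<Sum>l<r. (if l = i then real r - real i else 0) - (if l = j then real r - real j else 0))"
    by (rule sum.cong) (use p in \<open>auto simp: pos_root_def lookup_minus lookup_single when_def\<close>)
  also have "\<dots> = real j - real i"
    using p by (simp add: sum_subtractf)
  finally show "1 \<le> (\<Sum>l<r. (real r - real l) * lookup (pos_root p) l)" using p by simp
qed

text \<open>Call two indices equivalent if the difference of their unit vectors lies in the lattice
  spanned by \<open>J\<close>. A vector with integral coordinates lies in the lattice if and only if its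
  coordinates add up to 0 over each equivalence class, and this condition does not distinguish
  \<open>u\<close> from its multiples.\<close>

lemma pos_root_saturated:
  assumes J: "J \<subseteq> index_pairs r" and m: "m \<noteq> 0" and mu: "real_of_int m *\<^sub>R u \<in> zspan J pos_root"
    and int: "\<And>i. lookup u i \<in> \<int>" and keys: "keys u \<subseteq> {..<r}"
  shows "u \<in> zspan J pos_root"
proof -
  let ?e = "\<lambda>i::nat. single i (1::real)"
  have finJ: "finite J" using J finite_index_pairs finite_subset by blast
  define eqv where "eqv i j \<longleftrightarrow> ?e i - ?e j \<in> zspan J pos_root" for i j
  have refl: "eqv i i" for i by (simp add: eqv_def zspan_zero)
  have sym: "eqv i j \<Longrightarrow> eqv j i" for i j
    unfolding eqv_def using zspan_uminus by fastforce
  have trans: "eqv i j \<Longrightarrow> eqv j k \<Longrightarrow> eqv i k" for i j k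
    unfolding eqv_def using zspan_add by fastforce
  define rep where "rep i = (LEAST j. eqv j i)" for i
  have rep: "eqv (rep i) i" for i unfolding rep_def by (rule LeastI[of _ i]) (rule refl)
  have repeq: "rep i = rep j" if "eqv i j" for i j
  proof -
    have "eqv k i \<longleftrightarrow> eqv k j" for k using that sym trans by blast
    then show ?thesis by (simp add: rep_def)
  qed
  define s where "s q v = (\<Sum>i<r. if rep i = q then lookup v i else 0)" for q and v :: "nat \<Rightarrow>\<^sub>0 real"
  have s_lin: "linear (s q)" for q
  proof (rule linearI)
    show "s q (x + y) = s q x + s q y" for x y
      unfolding s_def sum.distrib[symmetric] by (rule sum.cong) (auto simp: lookup_add)
    show "s q (c *\<^sub>R x) = c *\<^sub>R s q x" for c x
      unfolding s_def real_scaleR_def sum_distrib_left by (rule sum.cong) (auto simp: lookup_scaleR)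
  qed
  have s_pos_root: "s q (pos_root p) = 0" if pJ: "p \<in> J" for q p
  proof -
    obtain i j where p: "p = (i, j)" "i < j" "j < r" using pJ J by (auto simp: index_pairs_def)
    have "eqv i j" using zspan_base[OF finJ that, of pos_root] by (simp add: eqv_def pos_root_def p)
    then have e: "rep i = rep j" by (rule repeq)
    have "s q (pos_root p) = (\<Sum>l<r. (if l = i then (if rep i = q then 1 else 0) else 0) - (if l = j then (if rep j = q then 1 else 0) else 0))"
      unfolding s_def
      by (rule sum.cong) (use p in \<open>auto simp: pos_root_def lookup_minus lookup_single when_def\<close>)
    also have "\<dots> = 0" using p e by (simp add: sum_subtractf)
    finally show ?thesis .
  qed
  have s0: "s q u = 0" for q
  proof -
    obtain c where "real_of_int m *\<^sub>R u = (\<Sum>i\<in>J. real_of_int (c i) *\<^sub>R pos_root i)"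
      using mu unfolding zspan_def by blast
    then have "s q (real_of_int m *\<^sub>R u) = 0"
      by (simp add: linear_sum[OF s_lin] linear_scale[OF s_lin] s_pos_root)
    then show ?thesis using m by (simp add: linear_scale[OF s_lin])
  qed
  have ex: "(\<Sum>i<r. lookup u i *\<^sub>R ?e i) = u"
  proof (rule poly_mapping_eqI)
    fix k
    have "lookup (\<Sum>i<r. lookup u i *\<^sub>R ?e i) k = (\<Sum>i<r. if i = k then lookup u i else 0)"
      unfolding lookup_sum by (rule sum.cong) (auto simp: lookup_scaleR lookup_single when_def)
    also have "\<dots> = lookup u k"
      using keys by (auto simp: in_keys_iff subset_iff)
    finally show "lookup (\<Sum>i<r. lookup u i *\<^sub>R ?e i) k = lookup u k" .
  qed
  \<comment> \<open>Moving each unit vector to the representative of its class collects the class sums, which vanish.\<close>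
  have z: "(\<Sum>i<r. lookup u i *\<^sub>R ?e (rep i)) = 0"
  proof (rule poly_mapping_eqI)
    fix k
    have "lookup (\<Sum>i<r. lookup u i *\<^sub>R ?e (rep i)) k = s k u"
      unfolding lookup_sum s_def by (rule sum.cong) (auto simp: lookup_scaleR lookup_single when_def)
    then show "lookup (\<Sum>i<r. lookup u i *\<^sub>R ?e (rep i)) k = lookup 0 k"
      using s0 by simp
  qed
  have "u = (\<Sum>i<r. lookup u i *\<^sub>R (?e i - ?e (rep i)))"
    using ex z by (simp add: scaleR_diff_right sum_subtractf)
  also have "\<dots> \<in> zspan J pos_root"
  proof (rule zspan_sum)
    fix i
    obtain c where c: "lookup u i = real_of_int c" using int[of i] by (elim Ints_cases)
    have "?e i - ?e (rep i) \<in> zspan J pos_root" using rep[of i] sym unfolding eqv_def by blast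
    then show "lookup u i *\<^sub>R (?e i - ?e (rep i)) \<in> zspan J pos_root"
      unfolding c by (rule zspan_scale)
  qed
  finally show ?thesis .
qed

theorem kostant_ev_poly:
  assumes "\<And>i. lookup u i \<in> \<int>" "keys u \<subseteq> {..<r}"
  shows "ev_poly (\<lambda>n. vpf (index_pairs r) pos_root (real n *\<^sub>R u + w))"
  by (rule vpf_ev_poly[OF finite_index_pairs finite_vsol_pos_root]) (rule pos_root_saturated[OF _ _ _ assms])

section \<open>Gelfand-Tsetlin patterns and Schur polynomials\<close>

text \<open>Gelfand-Tsetlin patterns: row \<open>k\<close> is the shape formed by the entries less than \<open>k\<close> of a
  semistandard tableau of shape \<open>mu\<close>. The rows are continued by \<open>mu\<close> beyond \<open>n\<close>, so that the
  interlacing conditions hold everywhere; they force \<open>x k i = 0\<close> for \<open>i \<ge> k\<close>.\<close>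

definition gt_patterns :: "nat \<Rightarrow> (nat \<Rightarrow> nat) \<Rightarrow> (nat \<Rightarrow> nat \<Rightarrow> nat) set" where
  "gt_patterns n mu = {x. (\<forall>i. x 0 i = 0) \<and> (\<forall>k i. x k i \<le> x (Suc k) i \<and> x (Suc k) (Suc i) \<le> x k i) \<and> (\<forall>k\<ge>n. x k = mu)}"

definition row_sum :: "(nat \<Rightarrow> nat \<Rightarrow> nat) \<Rightarrow> nat \<Rightarrow> nat" where
  "row_sum x k = (\<Sum>i<k. x k i)"

definition weight :: "(nat \<Rightarrow> nat \<Rightarrow> nat) \<Rightarrow> nat \<Rightarrow> nat" where
  "weight x k = row_sum x (Suc k) - row_sum x k"

lemma gtD:
  assumes "x \<in> gt_patterns n mu"
  shows "x 0 i = 0" "x k i \<le> x (Suc k) i" "x (Suc k) (Suc i) \<le> x k i" "k \<ge> n \<Longrightarrow> x k = mu"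
  using assms by (auto simp: gt_patterns_def)

lemma gt_mono: assumes "x \<in> gt_patterns n mu" "k \<le> l" shows "x k i \<le> x l i"
  using lift_Suc_mono_le[of "\<lambda>k. x k i", OF gtD(2)[OF assms(1)] assms(2)] .

lemma gt_zero: assumes "x \<in> gt_patterns n mu" "k \<le> i" shows "x k i = 0"
  using assms(2)
proof (induction k arbitrary: i)
  case 0
  then show ?case using gtD(1)[OF assms(1)] by simp
next
  case (Suc k)
  then obtain j where j: "i = Suc j" "k \<le> j" by (cases i) auto
  show ?case using gtD(3)[OF assms(1), of k j] Suc.IH[OF j(2)] j(1) by simp
qed

lemma gt_anti: assumes "x \<in> gt_patterns n mu" shows "antimono (x k)"
proof (rule antimonoI)
  fix i j :: nat assume "i \<le> j"
  then show "x k j \<le> x k i"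
  proof (induction rule: dec_induct)
    case (step m)
    have "x k (Suc m) \<le> x k m" using gtD(2)[OF assms, of k "Suc m"] gtD(3)[OF assms, of k m] by simp
    then show ?case using step by simp
  qed simp
qed

lemma gt_le: assumes "x \<in> gt_patterns n mu" shows "x k i \<le> mu i"
  using gt_mono[OF assms, of k "max k n" i] gtD(4)[OF assms, of "max k n"] by auto

lemma row_sum_eq: assumes "x \<in> gt_patterns n mu" "k \<le> N" shows "row_sum x k = (\<Sum>i<N. x k i)"
  unfolding row_sum_def using assms(2) gt_zero[OF assms(1)]
  by (intro sum.mono_neutral_left) auto

lemma row_sum_mono: assumes "x \<in> gt_patterns n mu" shows "row_sum x k \<le> row_sum x (Suc k)"
  using row_sum_eq[OF assms, of k "Suc k"] sum_mono[of "{..<Suc k}" "x k" "x (Suc k)"] gtD(2)[OF assms]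
  by (simp add: row_sum_def)

lemma weight_add: assumes "x \<in> gt_patterns n mu" shows "row_sum x k + weight x k = row_sum x (Suc k)"
  using row_sum_mono[OF assms, of k] by (simp add: weight_def)

lemma gt_empty: assumes "mu i \<noteq> 0" "n \<le> i" shows "gt_patterns n mu = {}"
  using assms gt_zero gtD(4) by fastforce

lemma finite_gt: "finite (gt_patterns n mu)"
proof (cases "gt_patterns n mu = {}")
  case False
  then obtain x0 where x0: "x0 \<in> gt_patterns n mu" by blast
  then have anti: "antimono mu" using gt_anti[OF x0, of n] gtD(4)[OF x0] by simp
  define F where "F = {f::nat \<Rightarrow> nat. (\<forall>i. i \<notin> {..<n} \<longrightarrow> f i = 0) \<and> (\<forall>i\<in>{..<n}. f i \<le> mu 0)}"
  have "finite F" unfolding F_def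
    by (rule finite_subset[OF _ finite_set_of_finite_funs[of "{..<n}" "{..mu 0}" 0]]) auto
  then have "finite (PiE {..<n} (\<lambda>_. F))" by (intro finite_PiE) auto
  moreover have "(\<lambda>x. restrict x {..<n}) ` gt_patterns n mu \<subseteq> PiE {..<n} (\<lambda>_. F)"
  proof safe
    fix x k assume x: "x \<in> gt_patterns n mu" and k: "k < n"
    show "restrict x {..<n} k \<in> F" using k gt_zero[OF x, of k] order_trans[OF gt_le[OF x] antimonoD[OF anti, of 0]]
      by (auto simp: F_def)
  qed auto
  moreover have "inj_on (\<lambda>x. restrict x {..<n}) (gt_patterns n mu)"
  proof (rule inj_onI)
    fix x y assume xy: "x \<in> gt_patterns n mu" "y \<in> gt_patterns n mu" "restrict x {..<n} = restrict y {..<n}"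
    show "x = y"
    proof
      fix k show "x k = y k"
        using fun_cong[OF xy(3), of k] gtD(4)[OF xy(1), of k] gtD(4)[OF xy(2), of k] by (cases "k < n") auto
    qed
  qed
  ultimately show ?thesis by (metis (no_types, lifting) inj_on_finite)
qed simp

lemma less_card_downclosed:
  fixes A :: "nat set"
  assumes "finite A" "\<And>i j. j \<in> A \<Longrightarrow> i \<le> j \<Longrightarrow> i \<in> A"
  shows "j < card A \<longleftrightarrow> j \<in> A"
proof -
  have "\<exists>c. A = {..<c}"
  proof (cases "A = {}")
    case False
    have "A = {..<Suc (Max A)}"
    proof
      show "A \<subseteq> {..<Suc (Max A)}" using Max_ge[OF assms(1)] by (auto simp: less_Suc_eq_le)
      show "{..<Suc (Max A)} \<subseteq> A"
      proof
        fix i assume "i \<in> {..<Suc (Max A)}"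
        then have "i \<le> Max A" by simp
        then show "i \<in> A" using assms(2)[OF Max_in[OF assms(1) False]] by blast
      qed
    qed
    then show ?thesis by blast
  qed auto
  then obtain c where "A = {..<c}" ..
  then show ?thesis by simp
qed

definition gt_of_tab :: "(nat \<Rightarrow> nat) \<Rightarrow> (nat \<Rightarrow> nat \<Rightarrow> nat) \<Rightarrow> nat \<Rightarrow> nat \<Rightarrow> nat" where
  "gt_of_tab mu T k i = card {j. j < mu i \<and> T i j < k}"

definition tab_of_gt :: "(nat \<Rightarrow> nat) \<Rightarrow> (nat \<Rightarrow> nat \<Rightarrow> nat) \<Rightarrow> nat \<Rightarrow> nat \<Rightarrow> nat" where
  "tab_of_gt mu x i j = (if j < mu i then LEAST k. j < x (Suc k) i else 0)"

lemma ssytD: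
  assumes "T \<in> ssyt n mu"
  shows "j < mu i \<Longrightarrow> T i j < n" "Suc j < mu i \<Longrightarrow> T i j \<le> T i (Suc j)"
    "j < mu i \<Longrightarrow> j < mu (Suc i) \<Longrightarrow> T i j < T (Suc i) j" "\<not> j < mu i \<Longrightarrow> T i j = 0"
proof -
  have "\<forall>(i, j)\<in>cells mu. T i j < n"
    and 2: "\<forall>i j. (i, j) \<in> cells mu \<and> (i, Suc j) \<in> cells mu \<longrightarrow> T i j \<le> T i (Suc j)"
    and 3: "\<forall>i j. (i, j) \<in> cells mu \<and> (Suc i, j) \<in> cells mu \<longrightarrow> T i j < T (Suc i) j"
    and 4: "\<forall>i j. (i, j) \<notin> cells mu \<longrightarrow> T i j = 0"
    using assms unfolding ssyt_def by blast+
  then show "j < mu i \<Longrightarrow> T i j < n" by (simp add: cells_def)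
  show "Suc j < mu i \<Longrightarrow> T i j \<le> T i (Suc j)" using 2[rule_format, of i j] by (simp add: cells_def)
  show "j < mu i \<Longrightarrow> j < mu (Suc i) \<Longrightarrow> T i j < T (Suc i) j" using 3[rule_format, of i j] by (simp add: cells_def)
  show "\<not> j < mu i \<Longrightarrow> T i j = 0" using 4[rule_format, of i j] by (simp add: cells_def)
qed

lemma ssyt_row_mono:
  assumes "T \<in> ssyt n mu" "j \<le> j'" "j' < mu i"
  shows "T i j \<le> T i j'"
  using assms(2,3)
proof (induction rule: dec_induct)
  case (step m)
  then show ?case using ssytD(2)[OF assms(1), of m i] by simp
qed simp

lemma less_gt_of_tab:
  assumes "T \<in> ssyt n mu"
  shows "j < gt_of_tab mu T k i \<longleftrightarrow> j < mu i \<and> T i j < k"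
  unfolding gt_of_tab_def
  by (subst less_card_downclosed) (auto intro: order.strict_trans1 ssyt_row_mono[OF assms])

lemma nat_eqI: "(\<And>j. j < a \<longleftrightarrow> j < b) \<Longrightarrow> a = (b::nat)"
  by (metis less_irrefl_nat linorder_neqE_nat)

lemma nat_leI: "(\<And>j. j < a \<Longrightarrow> j < b) \<Longrightarrow> a \<le> (b::nat)"
  using not_le by blast

lemma gt_of_tab_in_gt:
  assumes mu: "antimono mu" and T: "T \<in> ssyt n mu"
  shows "gt_of_tab mu T \<in> gt_patterns n mu"
  unfolding gt_patterns_def mem_Collect_eq
proof (intro conjI allI impI)
  show "gt_of_tab mu T 0 i = 0" for i by (rule nat_eqI) (simp add: less_gt_of_tab[OF T])
  show "gt_of_tab mu T k i \<le> gt_of_tab mu T (Suc k) i" for k i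
    by (rule nat_leI) (auto simp: less_gt_of_tab[OF T])
  show "gt_of_tab mu T (Suc k) (Suc i) \<le> gt_of_tab mu T k i" for k i
  proof (rule nat_leI)
    fix j assume j: "j < gt_of_tab mu T (Suc k) (Suc i)"
    have "mu (Suc i) \<le> mu i" using antimonoD[OF mu, of i "Suc i"] by simp
    then have "j < mu i" using j by (auto simp: less_gt_of_tab[OF T])
    moreover from this have "T i j < T (Suc i) j" using ssytD(3)[OF T, of j i] j
      by (auto simp: less_gt_of_tab[OF T])
    ultimately show "j < gt_of_tab mu T k i" using j by (auto simp: less_gt_of_tab[OF T])
  qed
  show "gt_of_tab mu T k = mu" if "n \<le> k" for k
  proof
    fix i show "gt_of_tab mu T k i = mu i"
    proof (rule nat_eqI)
      fix j show "j < gt_of_tab mu T k i \<longleftrightarrow> j < mu i"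
        using ssytD(1)[OF T, of j i] that by (auto simp: less_gt_of_tab[OF T])
    qed
  qed
qed

text \<open>A cell belongs to row \<open>k\<close> of the pattern if and only if its entry is less than \<open>k\<close>; this
  determines the tableau and the pattern by each other.\<close>

lemma tab_of_gt_less_iff:
  assumes x: "x \<in> gt_patterns n mu"
  shows "j < mu i \<and> tab_of_gt mu x i j < k \<longleftrightarrow> j < x k i"
proof
  assume a: "j < mu i \<and> tab_of_gt mu x i j < k"
  have "j < x (Suc n) i" using gtD(4)[OF x, of "Suc n"] a by simp
  then have "j < x (Suc (tab_of_gt mu x i j)) i" using a LeastI[of "\<lambda>k. j < x (Suc k) i" n] by (simp add: tab_of_gt_def)
  also have "\<dots> \<le> x k i" using a by (intro gt_mono[OF x]) auto
  finally show "j < x k i" .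
next
  assume a: "j < x k i"
  then obtain l where l: "k = Suc l" using gtD(1)[OF x, of i] by (cases k) auto
  have "j < mu i" using a gt_le[OF x, of k i] by simp
  moreover have "(LEAST k. j < x (Suc k) i) \<le> l" using a l by (intro Least_le) simp
  ultimately show "j < mu i \<and> tab_of_gt mu x i j < k" using l by (simp add: tab_of_gt_def)
qed

lemma tab_of_gt_in_ssyt:
  assumes mu: "antimono mu" and x: "x \<in> gt_patterns n mu"
  shows "tab_of_gt mu x \<in> ssyt n mu"
proof -
  note iff = tab_of_gt_less_iff[OF x]
  have 1: "tab_of_gt mu x i j < n" if "j < mu i" for i j
    using iff[of j i n] that gtD(4)[OF x, of n] by simp
  have 2: "tab_of_gt mu x i j \<le> tab_of_gt mu x i (Suc j)" if "j < mu i" "Suc j < mu i" for i j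
    using iff[of j i "Suc (tab_of_gt mu x i (Suc j))"] iff[of "Suc j" i "Suc (tab_of_gt mu x i (Suc j))"] that by simp
  have 3: "tab_of_gt mu x i j < tab_of_gt mu x (Suc i) j" if "j < mu i" "j < mu (Suc i)" for i j
  proof -
    let ?k = "tab_of_gt mu x (Suc i) j"
    have "j < x (Suc ?k) (Suc i)" using iff[of j "Suc i" "Suc ?k"] that by simp
    also have "\<dots> \<le> x ?k i" by (rule gtD(3)[OF x])
    finally show ?thesis using iff[of j i ?k] by simp
  qed
  have 4: "tab_of_gt mu x i j = 0" if "\<not> j < mu i" for i j using that by (simp add: tab_of_gt_def)
  show ?thesis unfolding ssyt_def cells_def using 1 2 3 4 by blast
qed

lemma bij_betw_ssyt_gt:
  assumes mu: "antimono mu"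
  shows "bij_betw (gt_of_tab mu) (ssyt n mu) (gt_patterns n mu)"
proof (rule bij_betw_byWitness[where f' = "tab_of_gt mu"])
  show "\<forall>T\<in>ssyt n mu. tab_of_gt mu (gt_of_tab mu T) = T"
  proof (intro ballI ext)
    fix T i j assume T: "T \<in> ssyt n mu"
    show "tab_of_gt mu (gt_of_tab mu T) i j = T i j"
    proof (cases "j < mu i")
      case True
      have "(LEAST k. j < gt_of_tab mu T (Suc k) i) = T i j"
        by (rule Least_equality) (auto simp: less_gt_of_tab[OF T] True)
      then show ?thesis using True by (simp add: tab_of_gt_def)
    next
      case False
      then show ?thesis using ssytD(4)[OF T] by (simp add: tab_of_gt_def)
    qed
  qed
  show "\<forall>x\<in>gt_patterns n mu. gt_of_tab mu (tab_of_gt mu x) = x"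
  proof (intro ballI ext)
    fix x k i assume x: "x \<in> gt_patterns n mu"
    show "gt_of_tab mu (tab_of_gt mu x) k i = x k i"
      by (rule nat_eqI)
        (simp add: less_gt_of_tab[OF tab_of_gt_in_ssyt[OF mu x]] tab_of_gt_less_iff[OF x])
  qed
qed (use gt_of_tab_in_gt[OF mu] tab_of_gt_in_ssyt[OF mu] in auto)

definition expo :: "nat \<Rightarrow> (nat \<Rightarrow> nat) \<Rightarrow> (nat \<Rightarrow>\<^sub>0 nat)" where
  "expo n p = (\<Sum>i<n. single i (p i))"

definition monomial :: "nat \<Rightarrow> (nat \<Rightarrow> nat) \<Rightarrow> mpoly" where
  "monomial n p = single (expo n p) 1"

lemma lookup_expo: "lookup (expo n p) i = (if i < n then p i else 0)"
  unfolding expo_def lookup_sum lookup_single when_def by simp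

lemma expo_add: "expo n p + expo n q = expo n (\<lambda>i. p i + q i)"
  by (rule poly_mapping_eqI) (simp add: lookup_add lookup_expo)

lemma expo_eq_iff: "expo n p = expo n q \<longleftrightarrow> (\<forall>i<n. p i = q i)"
proof
  assume "expo n p = expo n q"
  then show "\<forall>i<n. p i = q i" by (metis lookup_expo)
next
  assume "\<forall>i<n. p i = q i"
  then show "expo n p = expo n q" by (intro poly_mapping_eqI) (simp add: lookup_expo)
qed

lemma partitionD: "partition mu \<Longrightarrow> antimono mu" "partition mu \<Longrightarrow> finite {i. mu i \<noteq> 0}"
  by (auto simp: partition_def)

lemma partition_bound:
  assumes "partition mu" obtains N where "\<And>i. i \<ge> N \<Longrightarrow> mu i = 0"
proof -
  have "\<forall>i\<in>{i. mu i \<noteq> 0}. i \<le> Max {i. mu i \<noteq> 0}" using partitionD(2)[OF assms] by auto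
  then have "\<And>i. i \<ge> Suc (Max {i. mu i \<noteq> 0}) \<Longrightarrow> mu i = 0" by fastforce
  then show ?thesis using that by blast
qed

lemma finite_cells: assumes "partition mu" shows "finite (cells mu)"
proof -
  obtain N where N: "\<And>i. i \<ge> N \<Longrightarrow> mu i = 0" using partition_bound[OF assms] by blast
  have "cells mu \<subseteq> {..<N} \<times> {..<mu 0}"
  proof safe
    fix i j assume "(i, j) \<in> cells mu"
    then have j: "j < mu i" by (simp add: cells_def)
    show "i < N" using N[of i] j by (cases "N \<le> i") auto
    show "j < mu 0" using antimonoD[OF partitionD(1)[OF assms], of 0 i] j by simp
  qed
  then show ?thesis by (rule finite_subset) auto
qed

lemma prod_var: "finite A \<Longrightarrow> (\<Prod>c\<in>A. var (t c)) = single (\<Sum>c\<in>A. single (t c) 1) 1"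
  by (induction A rule: finite_induct) (auto simp: var_def mult_single)

lemma tab_monomial:
  assumes mu: "partition mu" and T: "T \<in> ssyt n mu"
  shows "(\<Prod>(i, j)\<in>cells mu. var (T i j)) = monomial n (weight (gt_of_tab mu T))"
proof -
  let ?x = "gt_of_tab mu T"
  have x: "?x \<in> gt_patterns n mu" by (rule gt_of_tab_in_gt[OF partitionD(1)[OF mu] T])
  obtain N0 where N0: "\<And>i. i \<ge> N0 \<Longrightarrow> mu i = 0" using partition_bound[OF mu] by blast
  have card: "card {c\<in>cells mu. (case c of (i, j) \<Rightarrow> T i j) = k} = weight ?x k" for k
  proof -
    define N where "N = max N0 (Suc k)"
    have iN: "i < N" if "j < mu i" for i j
      using N0[of i] that unfolding N_def by (cases "N0 \<le> i") auto
    have "{c\<in>cells mu. (case c of (i, j) \<Rightarrow> T i j) = k} = Sigma {..<N} (\<lambda>i. {j. j < mu i \<and> T i j = k})"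
      using iN by (auto simp: cells_def)
    also have "card \<dots> = (\<Sum>i<N. card {j. j < mu i \<and> T i j = k})" by simp
    also have "\<dots> = (\<Sum>i<N. ?x (Suc k) i - ?x k i)"
    proof (rule sum.cong[OF refl])
      fix i
      have "{j. j < mu i \<and> T i j = k} = {j. j < mu i \<and> T i j < Suc k} - {j. j < mu i \<and> T i j < k}" by auto
      also have "card \<dots> = ?x (Suc k) i - ?x k i"
        unfolding gt_of_tab_def by (rule card_Diff_subset) auto
      finally show "card {j. j < mu i \<and> T i j = k} = ?x (Suc k) i - ?x k i" .
    qed
    also have "\<dots> = (\<Sum>i<N. ?x (Suc k) i) - (\<Sum>i<N. ?x k i)"
      by (rule sum_subtractf_nat) (rule gtD(2)[OF x])
    also have "\<dots> = weight ?x k"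
      unfolding weight_def using row_sum_eq[OF x, of k N] row_sum_eq[OF x, of "Suc k" N] by (simp add: N_def)
    finally show ?thesis .
  qed
  have "(\<Sum>c\<in>cells mu. single (case c of (i, j) \<Rightarrow> T i j) 1) = expo n (weight ?x)"
  proof (rule poly_mapping_eqI)
    fix k
    have "lookup (\<Sum>c\<in>cells mu. single (case c of (i, j) \<Rightarrow> T i j) (1::nat)) k
        = (\<Sum>c\<in>cells mu. if (case c of (i, j) \<Rightarrow> T i j) = k then 1 else 0)"
      unfolding lookup_sum by (rule sum.cong) (auto simp: lookup_single when_def)
    also have "\<dots> = card {c\<in>cells mu. (case c of (i, j) \<Rightarrow> T i j) = k}"
      using finite_cells[OF mu] by (simp add: sum.If_cases Int_def)
    also have "\<dots> = weight ?x k" by (rule card)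
    also have "\<dots> = (if k < n then weight ?x k else 0)"
      using gtD(4)[OF x, of k] gtD(4)[OF x, of "Suc k"] row_sum_eq[OF x, of k "Suc k"]
      by (auto simp: weight_def row_sum_def)
    finally show "lookup (\<Sum>c\<in>cells mu. single (case c of (i, j) \<Rightarrow> T i j) (1::nat)) k
        = lookup (expo n (weight ?x)) k" by (simp add: lookup_expo)
  qed
  then show ?thesis
    using prod_var[OF finite_cells[OF mu], of "\<lambda>c. case c of (i, j) \<Rightarrow> T i j"]
    by (simp add: monomial_def case_prod_unfold)
qed

lemma schur_gt:
  assumes "partition mu"
  shows "schur n mu = (\<Sum>x\<in>gt_patterns n mu. monomial n (weight x))"
  unfolding schur_def
  by (simp add: tab_monomial[OF assms] sum.reindex_bij_betw[OF bij_betw_ssyt_gt[OF partitionD(1)[OF assms]], symmetric])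

section \<open>Bender-Knuth involutions on patterns\<close>

text \<open>A Bender-Knuth involution, written in terms of patterns: the entries of row \<open>k + 1\<close> from
  position \<open>h\<close> on are reflected in the intervals that interlacing leaves to them, except that
  the upper end of the interval at position \<open>h\<close> is replaced with \<open>B\<close>. For \<open>h = 0\<close> and
  \<open>B = x (k + 2) 0\<close> this exchanges the numbers of entries \<open>k\<close> and \<open>k + 1\<close> in the whole tableau;
  suitable other choices restrict the exchange to the part of the tableau in its first \<open>B\<close>
  columns.\<close>

definition toggle :: "nat \<Rightarrow> nat \<Rightarrow> nat \<Rightarrow> (nat \<Rightarrow> nat \<Rightarrow> nat) \<Rightarrow> nat \<Rightarrow> nat \<Rightarrow> nat" where
  "toggle k h B x = x(Suc k := (\<lambda>i. if i < h then x (Suc k) i else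
     (if i = h then B else min (x (Suc (Suc k)) i) (x k (i - 1))) +
     max (x (Suc (Suc k)) (Suc i)) (x k i) - x (Suc k) i))"

definition togglable :: "nat \<Rightarrow> nat \<Rightarrow> nat \<Rightarrow> (nat \<Rightarrow> nat \<Rightarrow> nat) \<Rightarrow> bool" where
  "togglable k h B x \<longleftrightarrow> x (Suc k) h \<le> B \<and> B \<le> x (Suc (Suc k)) h \<and> (\<forall>i. h = Suc i \<longrightarrow> B \<le> x k i)"

context
  fixes n mu k h B x
  assumes x: "x \<in> gt_patterns n mu" and k: "Suc k < n" and t: "togglable k h B x"
begin

lemma toggle_bounds:
  assumes "h \<le> i"
  shows "max (x (Suc (Suc k)) (Suc i)) (x k i) \<le> x (Suc k) i"
    and "x (Suc k) i \<le> (if i = h then B else min (x (Suc (Suc k)) i) (x k (i - 1)))"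
proof -
  show "max (x (Suc (Suc k)) (Suc i)) (x k i) \<le> x (Suc k) i" using gtD(2,3)[OF x] by simp
  show "x (Suc k) i \<le> (if i = h then B else min (x (Suc (Suc k)) i) (x k (i - 1)))"
  proof (cases "i = h")
    case True
    then show ?thesis using t by (simp add: togglable_def)
  next
    case False
    then obtain j where "i = Suc j" using assms by (cases i) auto
    then show ?thesis using False gtD(2)[OF x, of "Suc k" i] gtD(3)[OF x, of k j] by simp
  qed
qed

lemma toggle_row:
  assumes "h \<le> i"
  shows "max (x (Suc (Suc k)) (Suc i)) (x k i) \<le> toggle k h B x (Suc k) i"
    and "toggle k h B x (Suc k) i \<le> (if i = h then B else min (x (Suc (Suc k)) i) (x k (i - 1)))"
  using toggle_bounds[OF assms] assms unfolding toggle_def by (auto simp del: max.bounded_iff min.bounded_iff)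

lemma toggle_gt: "toggle k h B x \<in> gt_patterns n mu"
  unfolding gt_patterns_def mem_Collect_eq
proof (intro conjI allI impI)
  let ?y = "toggle k h B x"
  have other: "?y l = x l" if "l \<noteq> Suc k" for l using that by (simp add: toggle_def)
  have low: "?y (Suc k) i = x (Suc k) i" if "i < h" for i using that by (simp add: toggle_def)
  show "?y 0 i = 0" for i by (simp add: other gtD(1)[OF x])
  show "?y l = mu" if "n \<le> l" for l using that k by (simp add: other gtD(4)[OF x])
  show "?y l i \<le> ?y (Suc l) i" for l i
  proof -
    consider "l = k" | "l = Suc k" | "l \<noteq> k" "l \<noteq> Suc k" by blast
    then show ?thesis
    proof cases
      case 1
      then show ?thesis using toggle_row(1)[of i] low[of i] gtD(2)[OF x, of k i] by (cases "h \<le> i") (auto simp: other)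
    next
      case 2
      then show ?thesis using toggle_row(2)[of i] low[of i] gtD(2)[OF x, of "Suc k" i] t
        by (cases "h \<le> i") (auto simp: other togglable_def split: if_splits)
    next
      case 3
      then show ?thesis by (simp add: other gtD(2)[OF x])
    qed
  qed
  show "?y (Suc l) (Suc i) \<le> ?y l i" for l i
  proof -
    consider "l = k" | "l = Suc k" | "l \<noteq> k" "l \<noteq> Suc k" by blast
    then show ?thesis
    proof cases
      case 1
      then show ?thesis using toggle_row(2)[of "Suc i"] low[of "Suc i"] gtD(3)[OF x, of k i] t
        by (cases "h \<le> Suc i") (auto simp: other togglable_def split: if_splits)
    next
      case 2
      then show ?thesis using toggle_row(1)[of i] low[of i] gtD(3)[OF x, of "Suc k" i]
        by (cases "h \<le> i") (auto simp: other)
    next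
      case 3
      then show ?thesis by (simp add: other gtD(3)[OF x])
    qed
  qed
qed

lemma toggle_tog: "toggle k h B (toggle k h B x) = x"
proof (rule ext)
  fix l show "toggle k h B (toggle k h B x) l = x l"
  proof (cases "l = Suc k")
    case True
    show ?thesis
    proof
      fix i show "toggle k h B (toggle k h B x) l i = x l i"
        using toggle_bounds[of i] True unfolding toggle_def
        by (cases "i < h") (auto simp del: max.bounded_iff min.bounded_iff)
    qed
  qed (simp add: toggle_def)
qed

text \<open>A reflected entry and the original one add up to the sum of the two ends of the interval. The
  upper end at \<open>i + 1\<close> is the minimum and the lower end at \<open>i\<close> is the maximum of the same two
  numbers, so that these ends add up to a sum of entries of the neighbouring rows.\<close>

lemma toggle_row_sum:
  assumes h: "h \<le> Suc k"
  shows "row_sum (toggle k h B x) (Suc k) + row_sum x (Suc k) + (\<Sum>i\<le>h. x (Suc (Suc k)) i) + (\<Sum>i<h. x k i)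
    = 2 * (\<Sum>i<h. x (Suc k) i) + B + row_sum x (Suc (Suc k)) + row_sum x k"
proof -
  let ?y = "toggle k h B x"
  have y: "?y \<in> gt_patterns n mu" by (rule toggle_gt)
  define bm where "bm i = ?y (Suc k) i + x (Suc k) i" for i
  have bm: "bm i = (if i = h then B else min (x (Suc (Suc k)) i) (x k (i - 1))) + max (x (Suc (Suc k)) (Suc i)) (x k i)"
    if "h \<le> i" for i
    using toggle_bounds[OF that] that unfolding bm_def toggle_def by (auto simp del: max.bounded_iff min.bounded_iff)
  have s: "(\<Sum>i=h..<Suc N. bm i) = B + (\<Sum>i=h..<N. x (Suc (Suc k)) (Suc i) + x k i) + max (x (Suc (Suc k)) (Suc N)) (x k N)"
    if "h \<le> N" for N
    using that
  proof (induction N rule: dec_induct)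
    case base
    show ?case using bm[of h] by simp
  next
    case (step N)
    have "(\<Sum>i=h..<Suc (Suc N). bm i) = (\<Sum>i=h..<Suc N. bm i) + bm (Suc N)" using step by simp
    then show ?case using step bm[of "Suc N"] by simp
  qed
  have N: "max (x (Suc (Suc k)) (Suc (Suc k))) (x k (Suc k)) = 0"
    using gt_zero[OF x, of "Suc (Suc k)" "Suc (Suc k)"] gt_zero[OF x, of k "Suc k"] by simp
  have spl: "(\<Sum>i<Suc (Suc k). f i) = (\<Sum>i<h. f i) + (\<Sum>i=h..<Suc (Suc k). f i)" for f :: "nat \<Rightarrow> nat"
    using h by (simp add: lessThan_atLeast0 sum.atLeastLessThan_concat del: sum.op_ivl_Suc)
  have spl2: "(\<Sum>i<Suc k. f i) = (\<Sum>i<h. f i) + (\<Sum>i=h..<Suc k. f i)" for f :: "nat \<Rightarrow> nat"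
    using h by (simp add: lessThan_atLeast0 sum.atLeastLessThan_concat del: sum.op_ivl_Suc)
  have 1: "row_sum ?y (Suc k) + row_sum x (Suc k) = 2 * (\<Sum>i<h. x (Suc k) i) + (\<Sum>i=h..<Suc (Suc k). bm i)"
  proof -
    have "row_sum ?y (Suc k) + row_sum x (Suc k) = (\<Sum>i<Suc (Suc k). bm i)"
      unfolding bm_def sum.distrib
      by (simp only: row_sum_eq[OF y, of "Suc k" "Suc (Suc k)"] row_sum_eq[OF x, of "Suc k" "Suc (Suc k)"] le_SucI order_refl)
    also have "\<dots> = (\<Sum>i<h. bm i) + (\<Sum>i=h..<Suc (Suc k). bm i)" by (rule spl)
    also have "(\<Sum>i<h. bm i) = 2 * (\<Sum>i<h. x (Suc k) i)"
      unfolding sum_distrib_left by (rule sum.cong) (auto simp: bm_def toggle_def)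
    finally show ?thesis .
  qed
  have 2: "row_sum x (Suc (Suc k)) = (\<Sum>i\<le>h. x (Suc (Suc k)) i) + (\<Sum>i=h..<Suc k. x (Suc (Suc k)) (Suc i))"
  proof -
    have "row_sum x (Suc (Suc k)) = (\<Sum>i<Suc h. x (Suc (Suc k)) i) + (\<Sum>i=Suc h..<Suc (Suc k). x (Suc (Suc k)) i)"
      unfolding row_sum_def using h by (simp add: lessThan_atLeast0 sum.atLeastLessThan_concat del: sum.op_ivl_Suc)
    then show ?thesis by (simp add: lessThan_Suc_atMost sum.shift_bounds_Suc_ivl del: sum.op_ivl_Suc)
  qed
  have 3: "row_sum x k = (\<Sum>i<h. x k i) + (\<Sum>i=h..<Suc k. x k i)"
    using row_sum_eq[OF x, of k "Suc k"] spl2[of "x k"] by simp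
  show ?thesis using 1 2 3 s[OF h] N by (simp add: sum.distrib)
qed

end

lemma weight_outside: assumes x: "x \<in> gt_patterns n mu" and k: "n \<le> k" shows "weight x k = 0"
  using gtD(4)[OF x, of k] gtD(4)[OF x, of "Suc k"] row_sum_eq[OF x, of k "Suc k"] k
  by (auto simp: weight_def row_sum_def)

lemma row_sum_toggle_other: "l \<noteq> Suc k \<Longrightarrow> row_sum (toggle k h B x) l = row_sum x l"
  by (simp add: row_sum_def toggle_def)

lemma full_toggle:
  assumes x: "x \<in> gt_patterns n mu" and k: "Suc k < n"
  defines "y \<equiv> toggle k 0 (x (Suc (Suc k)) 0) x"
  shows "y \<in> gt_patterns n mu" "toggle k 0 (y (Suc (Suc k)) 0) y = x" "weight y = weight x \<circ> transpose k (Suc k)"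
proof -
  have t: "togglable k 0 (x (Suc (Suc k)) 0) x" using gtD(2)[OF x] by (simp add: togglable_def)
  show y: "y \<in> gt_patterns n mu" unfolding y_def by (rule toggle_gt[OF x k t])
  have "y (Suc (Suc k)) 0 = x (Suc (Suc k)) 0" by (simp add: y_def toggle_def)
  then show "toggle k 0 (y (Suc (Suc k)) 0) y = x" unfolding y_def using toggle_tog[OF x k t] by simp
  have s: "row_sum y (Suc k) + row_sum x (Suc k) = row_sum x (Suc (Suc k)) + row_sum x k"
    using toggle_row_sum[OF x k t] by (simp add: y_def)
  have o: "row_sum y l = row_sum x l" if "l \<noteq> Suc k" for l using that unfolding y_def by (rule row_sum_toggle_other)
  show "weight y = weight x \<circ> transpose k (Suc k)"
  proof
    fix l
    consider "l = k" | "l = Suc k" | "l \<noteq> k" "l \<noteq> Suc k" by blast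
    then show "weight y l = (weight x \<circ> transpose k (Suc k)) l"
    proof cases
      case 1
      then show ?thesis using s o[of k] o[of "Suc (Suc k)"] by (simp add: weight_def)
    next
      case 2
      then show ?thesis using s o[of k] o[of "Suc (Suc k)"] by (simp add: weight_def)
    next
      case 3
      then show ?thesis using o[of l] o[of "Suc l"] by (simp add: weight_def)
    qed
  qed
qed

section \<open>Products of alternants and Schur polynomials\<close>

text \<open>The antisymmetrisation of the monomial with exponents \<open>p\<close>.\<close>

definition alternant :: "nat \<Rightarrow> (nat \<Rightarrow> nat) \<Rightarrow> mpoly" where
  "alternant n p = (\<Sum>w | w permutes {..<n}. single (expo n (p \<circ> w)) (sign w))"

lemma alternant_transpose:
  assumes "a < n" "b < n" "a \<noteq> b"
  shows "alternant n (p \<circ> transpose a b) = - alternant n p"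
proof -
  let ?t = "transpose a b"
  have t: "?t permutes {..<n}" using assms by (intro permutes_swap_id) auto
  have tt: "?t \<circ> (?t \<circ> w) = w" for w by (simp add: fun_eq_iff)
  have "alternant n (p \<circ> ?t) = (\<Sum>w | w permutes {..<n}. single (expo n (p \<circ> w)) (- sign w))"
    unfolding alternant_def
  proof (rule sum.reindex_bij_witness[where i = "(\<circ>) ?t" and j = "(\<circ>) ?t"])
    fix w assume "w \<in> {w. w permutes {..<n}}"
    then have w: "w permutes {..<n}" by simp
    show "?t \<circ> (?t \<circ> w) = w" by (rule tt)
    show "?t \<circ> w \<in> {w. w permutes {..<n}}" using permutes_compose[OF w t] by simp
    have "sign (?t \<circ> w) = - sign w"
      using assms w by (subst sign_compose) (auto simp: sign_swap_id permutation_swap_id intro: permutation_permutes[THEN iffD2])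
    then show "single (expo n (p \<circ> (?t \<circ> w))) (- sign (?t \<circ> w)) =
       single (expo n ((p \<circ> ?t) \<circ> w)) (sign w)" by (simp add: o_assoc)
  next
    fix w assume "w \<in> {w. w permutes {..<n}}"
    then have w: "w permutes {..<n}" by simp
    show "?t \<circ> (?t \<circ> w) = w" by (rule tt)
    show "?t \<circ> w \<in> {w. w permutes {..<n}}" using permutes_compose[OF w t] by simp
  qed
  also have "\<dots> = - alternant n p"
    unfolding alternant_def sum_negf[symmetric] single_uminus ..
  finally show ?thesis .
qed

lemma permutes_adjacent_induct [consumes 1, case_names id comp adjacent]:
  fixes n :: nat
  assumes w: "w permutes {..<n}"
    and Pid: "P id"
    and Pcomp: "\<And>v w. v permutes {..<n} \<Longrightarrow> w permutes {..<n} \<Longrightarrow> P v \<Longrightarrow> P w \<Longrightarrow> P (v \<circ> w)"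
    and adj: "\<And>k. Suc k < n \<Longrightarrow> P (transpose k (Suc k))"
  shows "P w"
proof -
  have perm: "transpose a b permutes {..<n}" if "a < n" "b < n" for a b
    using that by (intro permutes_swap_id) auto
  have tr: "P (transpose a b)" if "a < b" "b < n" for a b
    using that
  proof (induction b)
    case (Suc b)
    show ?case
    proof (cases "a = b")
      case True
      then show ?thesis using adj[of b] Suc.prems by simp
    next
      case False
      have eq: "transpose a (Suc b) =
        transpose b (Suc b) \<circ> (transpose a b \<circ> transpose b (Suc b))"
        using False Suc.prems by (auto simp: fun_eq_iff transpose_def)
      show ?thesis unfolding eq
        using Suc False by (intro Pcomp adj permutes_compose[OF perm perm] perm) auto
    qed
  qed simp
  show ?thesis using w finite_lessThan
  proof (induction rule: permutes_induct)
    case (swap a b p)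
    have "P (transpose a b)"
      using swap tr[of a b] tr[of b a] by (cases "a < b") (auto simp: transpose_commute)
    then show ?case using swap by (intro Pcomp perm) auto
  qed (rule Pid)
qed

text \<open>For adjacent transpositions this is the full toggle; they generate the symmetric group.\<close>

lemma gt_sum_symmetric:
  fixes f :: "(nat \<Rightarrow> nat) \<Rightarrow> 'a::comm_monoid_add"
  assumes "w permutes {..<n}"
  shows "(\<Sum>x\<in>gt_patterns n mu. f (weight x \<circ> w)) = (\<Sum>x\<in>gt_patterns n mu. f (weight x))"
  using assms
proof (induction arbitrary: f rule: permutes_adjacent_induct)
  case (comp v w)
  show ?case using comp.IH(1)[of "\<lambda>u. f (u \<circ> w)"] comp.IH(2)[of f] by (simp add: comp_def)
next
  case (adjacent k)
  let ?g = "\<lambda>x. toggle k 0 (x (Suc (Suc k)) 0) x"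
  show ?case
    by (rule sum.reindex_bij_witness[where i = ?g and j = ?g]) (use full_toggle[OF _ adjacent] in auto)
qed simp

text \<open>Since the Schur polynomial is symmetric, its monomials may be permuted along with each summand
  of the alternant.\<close>

lemma alternant_schur:
  assumes mu: "partition mu"
  shows "alternant n p * schur n mu = (\<Sum>x\<in>gt_patterns n mu. alternant n (\<lambda>i. p i + weight x i))"
proof -
  have "alternant n p * schur n mu = (\<Sum>w | w permutes {..<n}. single (expo n (p \<circ> w)) (sign w) * (\<Sum>x\<in>gt_patterns n mu. monomial n (weight x)))"
    by (simp add: alternant_def schur_gt[OF mu] sum_distrib_right)
  also have "\<dots> = (\<Sum>w | w permutes {..<n}. \<Sum>x\<in>gt_patterns n mu. single (expo n ((\<lambda>i. p i + weight x i) \<circ> w)) (sign w))"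
  proof (rule sum.cong[OF refl])
    fix w assume "w \<in> {w. w permutes {..<n}}"
    then have w: "w permutes {..<n}" by simp
    have "(\<Sum>x\<in>gt_patterns n mu. monomial n (weight x)) = (\<Sum>x\<in>gt_patterns n mu. monomial n (weight x \<circ> w))"
      by (rule gt_sum_symmetric[OF w, symmetric])
    then show "single (expo n (p \<circ> w)) (sign w) * (\<Sum>x\<in>gt_patterns n mu. monomial n (weight x))
      = (\<Sum>x\<in>gt_patterns n mu. single (expo n ((\<lambda>i. p i + weight x i) \<circ> w)) (sign w))"
      by (simp add: sum_distrib_left monomial_def mult_single expo_add o_def)
  qed
  also have "\<dots> = (\<Sum>x\<in>gt_patterns n mu. alternant n (\<lambda>i. p i + weight x i))"
    unfolding alternant_def by (rule sum.swap)
  finally show ?thesis .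
qed

text \<open>The number of cells of row shape \<open>k\<close> in the columns from \<open>J\<close> on, where columns are counted
  from 0.\<close>

definition tail_sum :: "(nat \<Rightarrow> nat \<Rightarrow> nat) \<Rightarrow> nat \<Rightarrow> nat \<Rightarrow> nat" where
  "tail_sum x k J = (\<Sum>i<k. x k i - J)"

lemma tail_sum_eq: assumes "x \<in> gt_patterns n mu" "k \<le> N" shows "tail_sum x k J = (\<Sum>i<N. x k i - J)"
  unfolding tail_sum_def using assms(2) gt_zero[OF assms(1)]
  by (intro sum.mono_neutral_left) auto

lemma tail_sum_zero: "tail_sum x k 0 = row_sum x k" by (simp add: tail_sum_def row_sum_def)

lemma tail_sum_mono: assumes "x \<in> gt_patterns n mu" shows "tail_sum x k J \<le> tail_sum x (Suc k) J"
  using tail_sum_eq[OF assms, of k "Suc k" J] sum_mono[of "{..<Suc k}" "\<lambda>i. x k i - J" "\<lambda>i. x (Suc k) i - J"]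
    gtD(2)[OF assms] by (simp add: tail_sum_def diff_le_mono)

lemma tail_sum_split:
  assumes x: "x \<in> gt_patterns n mu" and "\<And>l. l < i \<Longrightarrow> J \<le> x k l" "\<And>l. i \<le> l \<Longrightarrow> x k l \<le> J"
  shows "tail_sum x k J + i * J = (\<Sum>l<i. x k l)"
proof -
  have "tail_sum x k J = (\<Sum>l<max k i. x k l - J)" by (rule tail_sum_eq[OF x]) simp
  also have "\<dots> = (\<Sum>l<i. x k l - J)"
    using assms(3) by (intro sum.mono_neutral_right) auto
  also have "\<dots> + i * J = (\<Sum>l<i. (x k l - J) + J)" by (simp only: sum.distrib sum_constant card_lessThan) simp
  also have "\<dots> = (\<Sum>l<i. x k l)" using assms(2) by (intro sum.cong) auto
  finally show ?thesis .
qed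

lemma tail_sum_split_iff:
  assumes x: "x \<in> gt_patterns n mu" and iff: "\<And>l. J < x k l \<longleftrightarrow> l < i"
  shows "tail_sum x k J + i * J = (\<Sum>l<i. x k l)"
proof (rule tail_sum_split[OF x])
  show "J \<le> x k l" if "l < i" for l using iff[of l] that by simp
  show "x k l \<le> J" if "i \<le> l" for l using iff[of l] that by simp
qed

definition col_height :: "(nat \<Rightarrow> nat \<Rightarrow> nat) \<Rightarrow> nat \<Rightarrow> nat \<Rightarrow> nat" where
  "col_height x k J = card {i. J < x k i}"

lemma less_ht:
  assumes x: "x \<in> gt_patterns n mu" shows "i < col_height x k J \<longleftrightarrow> J < x k i"
proof -
  have "finite {i. J < x k i}"
    by (rule finite_subset[of _ "{..<k}"]) (use gt_zero[OF x, of k] in \<open>auto simp: not_le[symmetric]\<close>)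
  then show ?thesis unfolding col_height_def
    using antimonoD[OF gt_anti[OF x, of k]]
    by (subst less_card_downclosed) (auto intro: order.strict_trans2)
qed

lemma col_height_mono: assumes x: "x \<in> gt_patterns n mu" shows "col_height x k J \<le> col_height x (Suc k) J"
proof (rule nat_leI)
  fix i assume "i < col_height x k J"
  then show "i < col_height x (Suc k) J" using gtD(2)[OF x, of k i] by (simp add: less_ht[OF x])
qed

lemma col_height_Suc: assumes x: "x \<in> gt_patterns n mu" shows "col_height x (Suc k) J \<le> Suc (col_height x k J)"
proof (rule nat_leI)
  fix i assume i: "i < col_height x (Suc k) J"
  show "i < Suc (col_height x k J)"
  proof (cases i)
    case (Suc j)
    then show ?thesis using i gtD(3)[OF x, of k j] by (simp add: less_ht[OF x])
  qed simp
qed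

lemma col_height_le: assumes x: "x \<in> gt_patterns n mu" shows "col_height x k J \<le> k"
proof (rule nat_leI)
  fix i assume "i < col_height x k J"
  then show "i < k" using gt_zero[OF x, of k i] by (cases "k \<le> i") (auto simp: less_ht[OF x])
qed

lemma tail_sum_Suc: assumes x: "x \<in> gt_patterns n mu" shows "tail_sum x k J = tail_sum x k (Suc J) + col_height x k J"
proof -
  have "tail_sum x k J = (\<Sum>i<k. (x k i - Suc J) + (if J < x k i then 1 else 0))"
    unfolding tail_sum_def by (rule sum.cong) auto
  also have "\<dots> = tail_sum x k (Suc J) + card ({i. i < k \<and> J < x k i})"
    by (simp add: sum.distrib tail_sum_def sum.If_cases Int_def)
  also have "{i. i < k \<and> J < x k i} = {i. J < x k i}"
    using gt_zero[OF x, of k] by (auto simp: not_le[symmetric])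
  finally show ?thesis by (simp add: col_height_def)
qed

text \<open>The letter \<open>k\<close> occurs \<open>tail_sum x (k + 1) J - tail_sum x k J\<close> times in the columns from \<open>J\<close>
  on. The gap is the difference of the parts \<open>k\<close> and \<open>k + 1\<close> after these columns have been added
  to \<open>la\<close>.\<close>

definition gap :: "(nat \<Rightarrow> nat) \<Rightarrow> (nat \<Rightarrow> nat \<Rightarrow> nat) \<Rightarrow> nat \<Rightarrow> nat \<Rightarrow> int" where
  "gap la x k J = int (la k) - int (la (Suc k)) + 2 * int (tail_sum x (Suc k) J)
     - int (tail_sum x (Suc (Suc k)) J) - int (tail_sum x k J)"

text \<open>Stembridge's condition: adding to \<open>la\<close> the weights of the columns of the tableau, from the
  last column to the first, only passes through partitions.\<close>

definition dominant :: "(nat \<Rightarrow> nat) \<Rightarrow> (nat \<Rightarrow> nat \<Rightarrow> nat) \<Rightarrow> bool" where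
  "dominant la x \<longleftrightarrow> (\<forall>k J. 0 \<le> gap la x k J)"

definition rho :: "nat \<Rightarrow> nat \<Rightarrow> nat" where
  "rho n i = n - 1 - i"

text \<open>At the last column \<open>J\<close> where the condition fails, and for the least \<open>k\<close> for which it fails
  there, the letters \<open>k\<close> and \<open>k + 1\<close> are exchanged in the columns before \<open>J\<close>.\<close>

definition swap_bad :: "(nat \<Rightarrow> nat) \<Rightarrow> (nat \<Rightarrow> nat \<Rightarrow> nat) \<Rightarrow> nat \<Rightarrow> nat \<Rightarrow> nat" where
  "swap_bad la x = (let J = (GREATEST J. \<exists>k. gap la x k J < 0); k = (LEAST k. gap la x k J < 0)
     in toggle k (col_height x k J) J x)"

text \<open>Stembridge's sign-reversing involution. The gap at \<open>J\<close> is negative and the gap at \<open>J + 1\<close> is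
  not; since a single column changes it by at most 1, the gap at \<open>J\<close> is \<open>-1\<close>, and column \<open>J\<close>
  contains \<open>k + 1\<close> but not \<open>k\<close>. The latter makes the restricted toggle admissible. By the
  former, \<open>la + rho\<close> plus the weight of the columns from \<open>J\<close> on has equal entries at \<open>k\<close> and
  \<open>k + 1\<close>, so that exchanging the two letters in the other columns transposes two entries of the
  total exponent. The columns from \<open>J\<close> on are not touched; hence \<open>J\<close> and \<open>k\<close> are found again in
  the new pattern.\<close>

lemma swap_bad:
  assumes la: "antimono la" "\<And>i. i \<ge> n \<Longrightarrow> la i = 0" and x: "x \<in> gt_patterns n mu" and bad: "\<not> dominant la x"
  shows "swap_bad la x \<in> gt_patterns n mu" "\<not> dominant la (swap_bad la x)" "swap_bad la (swap_bad la x) = x"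
    "alternant n (\<lambda>i. la i + rho n i + weight (swap_bad la x) i) = - alternant n (\<lambda>i. la i + rho n i + weight x i)"
proof -
  have la_Suc: "la (Suc k) \<le> la k" for k using antimonoD[OF la(1), of k "Suc k"] by simp
  define Bad where "Bad J \<longleftrightarrow> (\<exists>k. gap la x k J < 0)" for J
  have ex: "\<exists>J. Bad J" using bad by (auto simp: dominant_def Bad_def not_le)
  have bnd: "J \<le> Max (mu ` {..<n})" if "Bad J" for J
  proof (rule ccontr)
    assume c: "\<not> J \<le> Max (mu ` {..<n})"
    have m: "mu i \<le> J" for i
    proof (cases "i < n")
      case True
      then have "mu i \<le> Max (mu ` {..<n})" by (intro Max_ge) auto
      then show ?thesis using c by simp
    next
      case False
      then show ?thesis using gt_zero[OF x, of n i] gtD(4)[OF x, of n] by simp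
    qed
    have "x k i \<le> J" for k i using gt_le[OF x, of k i] m[of i] by simp
    then have "tail_sum x k J = 0" for k by (simp add: tail_sum_def)
    then show False using that la_Suc by (auto simp: Bad_def gap_def not_less[symmetric])
  qed
  define J where "J = (GREATEST J. Bad J)"
  have J: "Bad J" unfolding J_def using ex bnd GreatestI_ex_nat[of Bad] by blast
  have Jmax: "\<not> Bad J'" if "J < J'" for J'
  proof
    assume "Bad J'"
    then have "J' \<le> J" unfolding J_def by (rule Greatest_le_nat) (rule bnd)
    then show False using that by simp
  qed
  define k where "k = (LEAST k. gap la x k J < 0)"
  have k: "gap la x k J < 0" unfolding k_def using J[unfolded Bad_def] by (rule LeastI_ex)
  define h where "h = col_height x k J"
  define y where "y = toggle k h J x"
  have sx: "swap_bad la x = y" by (simp add: swap_bad_def Let_def y_def h_def k_def J_def Bad_def)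
  have kn: "Suc k < n"
  proof (rule ccontr)
    assume "\<not> Suc k < n"
    then have "la (Suc k) = 0" "x (Suc k) = mu" "x (Suc (Suc k)) = mu" using la(2) gtD(4)[OF x] by auto
    then have "tail_sum x (Suc (Suc k)) J = tail_sum x (Suc k) J"
      using tail_sum_eq[OF x, of "Suc k" "Suc (Suc k)" J] by (simp add: tail_sum_def)
    then show False using k tail_sum_mono[OF x, of k J] \<open>la (Suc k) = 0\<close> by (simp add: gap_def)
  qed
  have "0 \<le> gap la x k (Suc J)" using Jmax[of "Suc J"] by (auto simp: Bad_def not_less)
  then have s: "gap la x k J = -1" and h1: "col_height x (Suc k) J = h" and h2: "col_height x (Suc (Suc k)) J = Suc h"
    using k tail_sum_Suc[OF x, of k J] tail_sum_Suc[OF x, of "Suc k" J] tail_sum_Suc[OF x, of "Suc (Suc k)" J]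
      col_height_mono[OF x, of k J] col_height_mono[OF x, of "Suc k" J] col_height_Suc[OF x, of k J] col_height_Suc[OF x, of "Suc k" J]
    unfolding gap_def h_def by linarith+
  have H0: "J < x k i \<longleftrightarrow> i < h" and H1: "J < x (Suc k) i \<longleftrightarrow> i < h" and H2: "J < x (Suc (Suc k)) i \<longleftrightarrow> i < Suc h" for i
    using less_ht[OF x, of i k J] less_ht[OF x, of i "Suc k" J] less_ht[OF x, of i "Suc (Suc k)" J] h1 h2 h_def by auto
  have tg: "togglable k h J x"
    unfolding togglable_def using H0 H1[of h] H2[of h] by (auto simp: not_less intro: less_imp_le)
  have y: "y \<in> gt_patterns n mu" unfolding y_def by (rule toggle_gt[OF x kn tg])
  then show "swap_bad la x \<in> gt_patterns n mu" by (simp add: sx)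
  have ylow: "y (Suc k) i = x (Suc k) i" if "i < h" for i using that by (simp add: y_def toggle_def)
  have yhigh: "y (Suc k) i \<le> J" if "h \<le> i" for i
  proof -
    have "y (Suc k) i \<le> y (Suc k) h" by (rule antimonoD[OF gt_anti[OF y] that])
    also have "\<dots> \<le> J" using toggle_row(2)[OF x kn tg, of h] by (simp add: y_def)
    finally show ?thesis .
  qed
  have xhigh: "x (Suc k) i \<le> J" if "h \<le> i" for i using H1[of i] that by simp
  have yother: "y l = x l" if "l \<noteq> Suc k" for l using that by (simp add: y_def toggle_def)
  have tr: "tail_sum y l J' = tail_sum x l J'" if "J \<le> J'" for l J'
  proof (cases "l = Suc k")
    case True
    show ?thesis unfolding tail_sum_def True
    proof (rule sum.cong[OF refl])
      fix i show "y (Suc k) i - J' = x (Suc k) i - J'"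
        using ylow[of i] yhigh[of i] xhigh[of i] that by (cases "i < h") auto
    qed
  qed (simp add: tail_sum_def yother)
  \<comment> \<open>The choice of \<open>J\<close> and \<open>k\<close> only depends on these gaps, so it is the same for \<open>y\<close>.\<close>
  have sl: "gap la y l J' = gap la x l J'" if "J \<le> J'" for l J'
    by (simp add: gap_def tr[OF that])
  show "\<not> dominant la (swap_bad la x)" unfolding sx dominant_def using k sl[of J k] by (metis not_le order_refl)
  have Jy: "(GREATEST J. \<exists>k. gap la y k J < 0) = J"
  proof (rule Greatest_equality)
    show "\<exists>k. gap la y k J < 0" using k sl[of J k] by (intro exI[of _ k]) simp
    fix J' assume a: "\<exists>k. gap la y k J' < 0"
    show "J' \<le> J"
    proof (rule ccontr)
      assume "\<not> J' \<le> J"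
      then show False using a Jmax[of J'] sl[of J'] by (simp add: Bad_def)
    qed
  qed
  have ky: "(LEAST k. gap la y k J < 0) = k" by (simp add: sl k_def)
  have hy: "col_height y k J = h" by (simp add: col_height_def yother h_def)
  have "swap_bad la y = toggle k h J y" by (simp add: swap_bad_def Let_def Jy ky hy)
  then show "swap_bad la (swap_bad la x) = x"
    unfolding sx by (simp add: y_def toggle_tog[OF x kn tg])
  have t0: "tail_sum x k J + h * J = (\<Sum>l<h. x k l)"
    by (rule tail_sum_split_iff[OF x H0])
  have t1: "tail_sum x (Suc k) J + h * J = (\<Sum>l<h. x (Suc k) l)"
    by (rule tail_sum_split_iff[OF x H1])
  have t2: "tail_sum x (Suc (Suc k)) J + Suc h * J = (\<Sum>l<Suc h. x (Suc (Suc k)) l)"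
    by (rule tail_sum_split_iff[OF x H2])
  have row_sum: "row_sum y (Suc k) + row_sum x (Suc k) + (\<Sum>i\<le>h. x (Suc (Suc k)) i) + (\<Sum>i<h. x k i)
    = 2 * (\<Sum>i<h. x (Suc k) i) + J + row_sum x (Suc (Suc k)) + row_sum x k"
    unfolding y_def by (rule toggle_row_sum[OF x kn tg]) (use col_height_le[OF x, of k J] h_def in simp)
  have key: "int (row_sum y (Suc k)) - int (row_sum x k) + int (la k) + 1 = int (row_sum x (Suc (Suc k))) - int (row_sum x (Suc k)) + int (la (Suc k))"
    using row_sum s t0 t1 t2 unfolding gap_def lessThan_Suc_atMost by simp
  have ro: "row_sum y l = row_sum x l" if "l \<noteq> Suc k" for l using that by (simp add: row_sum_def yother)
  have w1: "la k + 1 + weight y k = la (Suc k) + weight x (Suc k)"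
    using key weight_add[OF y, of k] weight_add[OF x, of "Suc k"] ro[of k] by linarith
  have w2: "weight y k + weight y (Suc k) = weight x k + weight x (Suc k)"
    using weight_add[OF y, of k] weight_add[OF y, of "Suc k"] weight_add[OF x, of k] weight_add[OF x, of "Suc k"] ro[of k] ro[of "Suc (Suc k)"] by linarith
  have rk: "rho n k = Suc (rho n (Suc k))" using kn by (simp add: rho_def)
  let ?t = "transpose k (Suc k)"
  let ?q = "\<lambda>i. la i + rho n i + weight x i"
  have "(\<lambda>i. la i + rho n i + weight y i) = ?q \<circ> ?t"
  proof
    fix i
    consider "i = k" | "i = Suc k" | "i \<noteq> k" "i \<noteq> Suc k" by blast
    then show "la i + rho n i + weight y i = (?q \<circ> ?t) i"
    proof cases
      case 3
      then show ?thesis using ro[of i] ro[of "Suc i"] by (simp add: weight_def)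
    qed (use w1 w2 rk in auto)
  qed
  then show "alternant n (\<lambda>i. la i + rho n i + weight (swap_bad la x) i) = - alternant n ?q"
    unfolding sx using alternant_transpose[of k n "Suc k" ?q] kn by simp
qed

lemma sum_sign_reversing:
  fixes F :: "'b \<Rightarrow> mpoly"
  assumes "\<And>x. x \<in> B \<Longrightarrow> g x \<in> B" "\<And>x. x \<in> B \<Longrightarrow> g (g x) = x" "\<And>x. x \<in> B \<Longrightarrow> F (g x) = - F x"
  shows "(\<Sum>x\<in>B. F x) = 0"
proof -
  have "(\<Sum>x\<in>B. F x) = (\<Sum>x\<in>B. F (g x))"
    by (rule sum.reindex_bij_witness[where i = g and j = g]) (use assms in auto)
  also have "\<dots> = - (\<Sum>x\<in>B. F x)" using assms by (simp add: sum_negf)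
  finally show ?thesis by simp
qed

theorem alternant_schur_good:
  assumes mu: "partition mu" and la: "antimono la" "\<And>i. i \<ge> n \<Longrightarrow> la i = 0"
  shows "alternant n (\<lambda>i. la i + rho n i) * schur n mu = (\<Sum>x | x \<in> gt_patterns n mu \<and> dominant la x. alternant n (\<lambda>i. la i + rho n i + weight x i))"
proof -
  let ?F = "\<lambda>x. alternant n (\<lambda>i. la i + rho n i + weight x i)"
  have "(\<Sum>x | x \<in> gt_patterns n mu \<and> \<not> dominant la x. ?F x) = 0"
    by (rule sum_sign_reversing[where g = "swap_bad la"]) (use swap_bad[OF la] in auto)
  moreover have "(\<Sum>x\<in>gt_patterns n mu. ?F x) = (\<Sum>x | x \<in> gt_patterns n mu \<and> dominant la x. ?F x) + (\<Sum>x | x \<in> gt_patterns n mu \<and> \<not> dominant la x. ?F x)"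
    by (subst sum.union_disjoint[symmetric]) (auto simp: finite_gt intro!: sum.cong)
  ultimately show ?thesis by (simp add: alternant_schur[OF mu])
qed

section \<open>Littlewood-Richardson coefficients as numbers of patterns\<close>

text \<open>The gap at \<open>J = x (k + 1) i\<close>, where no truncation remains. In terms of hives these numbers are
  the values of one of the three kinds of rhombi.\<close>

definition row_gap :: "(nat \<Rightarrow> nat) \<Rightarrow> (nat \<Rightarrow> nat \<Rightarrow> nat) \<Rightarrow> nat \<Rightarrow> nat \<Rightarrow> int" where
  "row_gap la x k i = int (la k) - int (la (Suc k)) + 2 * int (\<Sum>l<i. x (Suc k) l) + int (x (Suc k) i)
     - int (\<Sum>l\<le>i. x (Suc (Suc k)) l) - int (\<Sum>l<i. x k l)"

lemma gap_row_gap: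
  assumes x: "x \<in> gt_patterns n mu"
  shows "gap la x k (x (Suc k) i) = row_gap la x k i"
proof -
  let ?J = "x (Suc k) i"
  have a: "x k j \<le> x k i" if "i \<le> j" for i j k using antimonoD[OF gt_anti[OF x, of k] that] .
  have 1: "tail_sum x (Suc k) ?J + i * ?J = (\<Sum>l<i. x (Suc k) l)"
    by (rule tail_sum_split[OF x]) (auto intro: a)
  have 2: "tail_sum x k ?J + i * ?J = (\<Sum>l<i. x k l)"
  proof (rule tail_sum_split[OF x])
    show "?J \<le> x k l" if "l < i" for l
      using a[of "Suc l" i "Suc k"] gtD(3)[OF x, of k l] that by simp
    show "x k l \<le> ?J" if "i \<le> l" for l
      using a[OF that, of "Suc k"] gtD(2)[OF x, of k l] by simp
  qed
  have 3: "tail_sum x (Suc (Suc k)) ?J + Suc i * ?J = (\<Sum>l<Suc i. x (Suc (Suc k)) l)"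
  proof (rule tail_sum_split[OF x])
    show "?J \<le> x (Suc (Suc k)) l" if "l < Suc i" for l
      using a[of l i "Suc k"] gtD(2)[OF x, of "Suc k" l] that by simp
    show "x (Suc (Suc k)) l \<le> ?J" if le: "Suc i \<le> l" for l
    proof -
      obtain m where m: "l = Suc m" "i \<le> m" using le by (cases l) auto
      show ?thesis using a[OF m(2), of "Suc k"] gtD(3)[OF x, of "Suc k" m] m(1) by simp
    qed
  qed
  show ?thesis using 1 2 3 unfolding gap_def row_gap_def lessThan_Suc_atMost mult_Suc by linarith
qed

text \<open>Let \<open>i\<close> be the height of column \<open>J\<close> in row shape \<open>k + 1\<close>. If \<open>J\<close> contains the letter \<open>k + 1\<close>,
  then the gap at \<open>J\<close> is at least the one at \<open>x (k + 1) i\<close>; otherwise it is at least the one at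
  \<open>x (k + 1) (i - 1)\<close>, or, if \<open>i = 0\<close>, the difference of two parts of \<open>la\<close>.\<close>

lemma dominant_iff_row_gap:
  assumes x: "x \<in> gt_patterns n mu" and la: "antimono la"
  shows "dominant la x \<longleftrightarrow> (\<forall>k i. 0 \<le> row_gap la x k i)"
proof
  assume "dominant la x"
  then show "\<forall>k i. 0 \<le> row_gap la x k i" by (simp add: dominant_def gap_row_gap[OF x, symmetric])
next
  assume r: "\<forall>k i. 0 \<le> row_gap la x k i"
  show "dominant la x" unfolding dominant_def
  proof (intro allI)
    fix k J
    define i where "i = col_height x (Suc k) J"
    have H: "J < x (Suc k) l \<longleftrightarrow> l < i" for l by (simp add: i_def less_ht[OF x])
    have 1: "tail_sum x (Suc k) J + i * J = (\<Sum>l<i. x (Suc k) l)"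
      by (rule tail_sum_split_iff[OF x H])
    have 2: "i = col_height x k J \<or> i = Suc (col_height x k J)"
      using col_height_mono[OF x, of k J] col_height_Suc[OF x, of k J] unfolding i_def by linarith
    have 2: "tail_sum x k J + i * J = (\<Sum>l<i. x k l) + (if i = col_height x k J then 0 else J - x k (col_height x k J))"
    proof (cases "i = col_height x k J")
      case True
      have "tail_sum x k J + i * J = (\<Sum>l<i. x k l)"
        unfolding True by (rule tail_sum_split_iff[OF x less_ht[OF x, symmetric]])
      then show ?thesis using True by simp
    next
      case False
      then have i: "i = Suc (col_height x k J)" using 2 by simp
      have t: "tail_sum x k J + col_height x k J * J = (\<Sum>l<col_height x k J. x k l)"
        by (rule tail_sum_split_iff[OF x less_ht[OF x, symmetric]])
      have "x k (col_height x k J) \<le> J" using less_ht[OF x, of "col_height x k J" k J] by simp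
      then show ?thesis using t i by simp
    qed
    have 3: "tail_sum x (Suc (Suc k)) J + (if J < x (Suc (Suc k)) i then Suc i else i) * J
        = (\<Sum>l<(if J < x (Suc (Suc k)) i then Suc i else i). x (Suc (Suc k)) l)"
    proof -
      have "i \<le> col_height x (Suc (Suc k)) J" "col_height x (Suc (Suc k)) J \<le> Suc i"
        using col_height_mono[OF x, of "Suc k" J] col_height_Suc[OF x, of "Suc k" J] unfolding i_def by auto
      then have e: "(if J < x (Suc (Suc k)) i then Suc i else i) = col_height x (Suc (Suc k)) J"
        using less_ht[OF x, of i "Suc (Suc k)" J] by auto
      show ?thesis unfolding e
        by (rule tail_sum_split_iff[OF x less_ht[OF x, symmetric]])
    qed
    show "0 \<le> gap la x k J"
    proof (cases "J < x (Suc (Suc k)) i")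
      case True
      have xi: "x (Suc k) i \<le> J" using H[of i] by simp
      have h: "i \<noteq> col_height x k J \<Longrightarrow> x (Suc k) i \<le> x k (col_height x k J)"
        using \<open>i = col_height x k J \<or> i = Suc (col_height x k J)\<close> gtD(3)[OF x, of k "col_height x k J"] by auto
      have "row_gap la x k i \<le> gap la x k J"
        using 1 2 3 True xi h unfolding gap_def row_gap_def lessThan_Suc_atMost[symmetric]
        by (cases "i = col_height x k J") (auto simp del: of_nat_sum)
      then show ?thesis using r by (meson order_trans)
    next
      case False
      show ?thesis
      proof (cases i)
        case 0
        then show ?thesis using 1 2 3 False antimonoD[OF la, of k "Suc k"] \<open>i = col_height x k J \<or> i = Suc (col_height x k J)\<close> unfolding gap_def by auto
      next
        case (Suc m)
        have xm: "J < x (Suc k) m" using H[of m] Suc by simp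
        have e1: "tail_sum x (Suc k) J + Suc m * J = (\<Sum>l<m. x (Suc k) l) + x (Suc k) m"
          using 1 Suc by simp
        have e3: "tail_sum x (Suc (Suc k)) J + Suc m * J = (\<Sum>l<Suc m. x (Suc (Suc k)) l)"
          using 3 False Suc by simp
        have "row_gap la x k m \<le> gap la x k J"
        proof (cases "i = col_height x k J")
          case True
          have "tail_sum x k J + Suc m * J = (\<Sum>l<m. x k l) + x k m" using 2 Suc True by simp
          moreover have "x k m \<le> x (Suc k) m" by (rule gtD(2)[OF x])
          ultimately show ?thesis
            using e1 e3 unfolding gap_def row_gap_def lessThan_Suc_atMost[symmetric] by linarith
        next
          case F2: False
          then have hm: "col_height x k J = m" using \<open>i = col_height x k J \<or> i = Suc (col_height x k J)\<close> Suc by simp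
          then have "tail_sum x k J + Suc m * J = (\<Sum>l<m. x k l) + x k m + (J - x k m)" using 2 Suc F2 by simp
          moreover have "x k m \<le> J" using less_ht[OF x, of m k J] hm by simp
          ultimately show ?thesis
            using e1 e3 xm unfolding gap_def row_gap_def lessThan_Suc_atMost[symmetric] by linarith
        qed
        then show ?thesis using r by (meson order_trans)
      qed
    qed
  qed
qed

lemma dominant_weight_antimono:
  assumes x: "x \<in> gt_patterns n mu" and g: "dominant la x"
  shows "antimono (\<lambda>i. la i + weight x i)"
proof -
  have "la (Suc k) + weight x (Suc k) \<le> la k + weight x k" for k
  proof -
    have "0 \<le> gap la x k 0" using g by (simp add: dominant_def)
    then show ?thesis
      using weight_add[OF x, of k] weight_add[OF x, of "Suc k"] by (simp add: gap_def tail_sum_zero)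
  qed
  then show ?thesis by (simp add: decseq_Suc_iff)
qed

text \<open>The pattern of the tableau whose row \<open>i\<close> is filled with \<open>i\<close>.\<close>

definition top_gt :: "(nat \<Rightarrow> nat) \<Rightarrow> nat \<Rightarrow> nat \<Rightarrow> nat" where
  "top_gt mu k i = (if i < k then mu i else 0)"

text \<open>For \<open>la = 0\<close> the conditions say, row by row, that the number of letters \<open>k + 1\<close> in the first
  \<open>i + 1\<close> rows is at most the number of letters \<open>k\<close> in the first \<open>i\<close> rows. By induction on \<open>i\<close>
  this excludes letters greater than \<open>i\<close> from row \<open>i\<close>.\<close>

lemma dominant_zero_eq_top:
  assumes mu: "\<And>i. i \<ge> n \<Longrightarrow> mu i = 0" and x: "x \<in> gt_patterns n mu" and g: "dominant (\<lambda>_. 0) x"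
  shows "x = top_gt mu"
proof -
  have r: "0 \<le> row_gap (\<lambda>_. 0) x k i" for k i
    using g dominant_iff_row_gap[OF x, of "\<lambda>_. 0"] by (simp add: antimono_def)
  have step: "x (Suc k) i = x k i" if "i < k" for k i
    using that
  proof (induction i arbitrary: k rule: less_induct)
    case (less i)
    then obtain m where m: "k = Suc m" "i \<le> m" by (cases k) auto
    have "(\<Sum>l<i. x (Suc m) l) = (\<Sum>l<i. x m l)"
      using less.IH m by (intro sum.cong) auto
    then have "int (\<Sum>l\<le>i. x (Suc (Suc m)) l) \<le> int (\<Sum>l\<le>i. x (Suc m) l)"
      using r[of m i] unfolding row_gap_def lessThan_Suc_atMost[symmetric] by simp
    then have le: "(\<Sum>l\<le>i. x (Suc (Suc m)) l) \<le> (\<Sum>l\<le>i. x (Suc m) l)" by linarith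
    show ?case
    proof (rule ccontr)
      assume "x (Suc k) i \<noteq> x k i"
      then have "x (Suc m) i < x (Suc (Suc m)) i" using gtD(2)[OF x, of "Suc m" i] m by simp
      then have "(\<Sum>l\<le>i. x (Suc m) l) < (\<Sum>l\<le>i. x (Suc (Suc m)) l)"
        by (intro sum_strict_mono_ex1) (auto intro: gtD(2)[OF x])
      then show False using le by simp
    qed
  qed
  show ?thesis
  proof (intro ext)
    fix k i show "x k i = top_gt mu k i"
    proof (cases "i < k")
      case True
      have "x l i = x k i" if "k \<le> l" for l
        using that by (induction rule: dec_induct) (use step True in auto)
      from this[of "max k n"] show ?thesis using True gtD(4)[OF x, of "max k n"] by (simp add: top_gt_def)
    next
      case False
      then show ?thesis using gt_zero[OF x, of k i] by (simp add: top_gt_def)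
    qed
  qed
qed

lemma top_gt:
  assumes mu: "\<And>i. i \<ge> n \<Longrightarrow> mu i = 0" and anti: "antimono mu"
  shows "top_gt mu \<in> gt_patterns n mu" "dominant (\<lambda>_. 0) (top_gt mu)" "weight (top_gt mu) = mu"
proof -
  have "mu (Suc i) \<le> mu i" for i using antimonoD[OF anti, of i "Suc i"] by simp
  then show x: "top_gt mu \<in> gt_patterns n mu"
    using mu by (auto simp: gt_patterns_def top_gt_def fun_eq_iff)
  show "dominant (\<lambda>_. 0) (top_gt mu)"
    unfolding dominant_iff_row_gap[OF x, of "\<lambda>_. 0", OF antimonoI[OF order_refl]]
  proof (intro allI)
    fix k i
    let ?x = "top_gt mu"
    have 1: "(\<Sum>l\<le>i. ?x (Suc (Suc k)) l) = (\<Sum>l<i. ?x (Suc k) l) + ?x (Suc k) i + (\<Sum>l\<le>i. if l = Suc k then mu l else 0)"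
      unfolding lessThan_Suc_atMost[symmetric] sum.lessThan_Suc[symmetric] sum.distrib[symmetric]
      by (rule sum.cong) (auto simp: top_gt_def)
    have 2: "(\<Sum>l<i. ?x (Suc k) l) = (\<Sum>l<i. ?x k l) + (\<Sum>l<i. if l = k then mu l else 0)"
      unfolding sum.distrib[symmetric] by (rule sum.cong) (auto simp: top_gt_def)
    have "mu (Suc k) \<le> mu k" by fact
    then show "0 \<le> row_gap (\<lambda>_. 0) ?x k i" unfolding row_gap_def 1 using 2 by simp
  qed
  show "weight (top_gt mu) = mu"
    by (rule ext) (simp add: weight_def row_sum_def top_gt_def)
qed

text \<open>The bialternant formula; it is the case \<open>la = 0\<close> of \<open>alternant_schur_dominant\<close>.\<close>

theorem alternant_rho_schur:
  assumes mu: "partition mu" "\<And>i. i \<ge> n \<Longrightarrow> mu i = 0"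
  shows "alternant n (rho n) * schur n mu = alternant n (\<lambda>i. mu i + rho n i)"
proof -
  note top = top_gt[of n mu, OF mu(2) partitionD(1)[OF mu(1)]]
  have one: "{x. x \<in> gt_patterns n mu \<and> dominant (\<lambda>_. 0) x} = {top_gt mu}"
    using dominant_zero_eq_top[of n mu, OF mu(2)] top(1,2) by blast
  have "alternant n (\<lambda>i. 0 + rho n i) * schur n mu = (\<Sum>x | x \<in> gt_patterns n mu \<and> dominant (\<lambda>_. 0) x. alternant n (\<lambda>i. 0 + rho n i + weight x i))"
    by (rule alternant_schur_good[OF mu(1)]) (auto simp: antimono_def)
  then show ?thesis unfolding one by (simp add: top(3) add.commute)
qed

definition lr_patterns :: "nat \<Rightarrow> (nat \<Rightarrow> nat) \<Rightarrow> (nat \<Rightarrow> nat) \<Rightarrow> (nat \<Rightarrow> nat) \<Rightarrow> (nat \<Rightarrow> nat \<Rightarrow> nat) set" where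
  "lr_patterns n la mu nu = {x \<in> gt_patterns n mu. dominant la x \<and> (\<forall>k. la k + weight x k = nu k)}"

lemma gt_shrink:
  assumes x: "x \<in> gt_patterns m mu" and w: "\<And>k. k \<ge> n \<Longrightarrow> weight x k = 0"
  shows "x \<in> gt_patterns n mu"
proof -
  have step: "x (Suc k) = x k" if "n \<le> k" for k
  proof
    fix i
    have eq: "(\<Sum>i<Suc k. x k i) = (\<Sum>i<Suc k. x (Suc k) i)"
      using weight_add[OF x, of k] w[OF that] row_sum_eq[OF x, of k "Suc k"] by (simp add: row_sum_def)
    show "x (Suc k) i = x k i"
    proof (cases "i < Suc k")
      case True
      show ?thesis
      proof (rule ccontr)
        assume "x (Suc k) i \<noteq> x k i"
        then have "x k i < x (Suc k) i" using gtD(2)[OF x, of k i] by simp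
        then have "(\<Sum>i<Suc k. x k i) < (\<Sum>i<Suc k. x (Suc k) i)"
          using True by (intro sum_strict_mono_ex1) (auto intro: gtD(2)[OF x])
        then show False using eq by simp
      qed
    next
      case False
      then show ?thesis using gt_zero[OF x, of k i] gt_zero[OF x, of "Suc k" i] by simp
    qed
  qed
  have "x k = mu" if "n \<le> k" for k
  proof -
    have "x l = x k" if "k \<le> l" for l
      using that by (induction rule: dec_induct) (use step \<open>n \<le> k\<close> in auto)
    from this[of "max k m"] show ?thesis using gtD(4)[OF x, of "max k m"] by simp
  qed
  then show ?thesis using x by (auto simp: gt_patterns_def)
qed

lemma gt_extend: "x \<in> gt_patterns n mu \<Longrightarrow> n \<le> m \<Longrightarrow> x \<in> gt_patterns m mu"
  by (auto simp: gt_patterns_def)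

lemma lr_patterns_eq:
  assumes "\<And>k. k \<ge> n \<Longrightarrow> nu k = 0" "n \<le> m"
  shows "lr_patterns n la mu nu = lr_patterns m la mu nu"
proof -
  have "x \<in> gt_patterns n mu" if "x \<in> gt_patterns m mu" "\<forall>k. la k + weight x k = nu k" for x
    by (rule gt_shrink[OF that(1)]) (use that(2) assms(1) in \<open>metis add_is_0\<close>)
  then show ?thesis using gt_extend assms(2) by (auto simp: lr_patterns_def)
qed

lemma support_lessThan:
  fixes f :: "nat \<Rightarrow> nat"
  assumes "\<And>i. i \<ge> N \<Longrightarrow> f i = 0" shows "{i. f i \<noteq> 0} \<subseteq> {..<N}"
proof
  fix i assume "i \<in> {i. f i \<noteq> 0}"
  then show "i \<in> {..<N}" using assms[of i] by (cases "N \<le> i") auto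
qed

lemma psize_eq: assumes "\<And>i. i \<ge> N \<Longrightarrow> mu i = 0" shows "psize mu = (\<Sum>i<N. mu i)"
  unfolding psize_def using support_lessThan[of N mu, OF assms]
  by (intro sum.mono_neutral_left) auto

lemma partition_beyond_psize:
  assumes nu: "partition nu" and k: "k \<ge> psize nu" shows "nu k = 0"
proof (rule ccontr)
  assume n0: "nu k \<noteq> 0"
  obtain N where N: "\<And>i. i \<ge> N \<Longrightarrow> nu i = 0" using partition_bound[OF nu] by blast
  have kN: "k < N" using n0 N[of k] by (cases "N \<le> k") auto
  have "Suc k = (\<Sum>i<Suc k. 1)" by simp
  also have "\<dots> \<le> (\<Sum>i<Suc k. nu i)"
  proof (rule sum_mono)
    fix i assume "i \<in> {..<Suc k}"
    then show "1 \<le> nu i" using antimonoD[OF partitionD(1)[OF nu], of i k] n0 by simp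
  qed
  also have "\<dots> \<le> (\<Sum>i<N. nu i)" using kN by (intro sum_mono2) auto
  finally show False using k psize_eq[of N nu] N by simp
qed

lemma sum_weight: assumes x: "x \<in> gt_patterns n mu" shows "(\<Sum>k<m. weight x k) = row_sum x m"
  by (induction m) (use weight_add[OF x] in \<open>auto simp: row_sum_def\<close>)

lemma lr_patterns_partition:
  assumes la: "partition la" and mu: "partition mu" and x: "x \<in> lr_patterns n la mu nu"
  shows "partition nu" "psize nu = psize la + psize mu"
proof -
  have xg: "x \<in> gt_patterns n mu" and g: "dominant la x" and nu: "nu = (\<lambda>k. la k + weight x k)"
    using x by (auto simp: lr_patterns_def)
  obtain N0 where N0: "\<And>i. i \<ge> N0 \<Longrightarrow> la i = 0" using partition_bound[OF la] by blast
  define N where "N = max N0 n"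
  have z: "nu i = 0" if "i \<ge> N" for i
    using that N0[of i] weight_outside[OF xg, of i] by (simp add: nu N_def)
  have "{i. nu i \<noteq> 0} \<subseteq> {..<N}" using support_lessThan[of N nu] z by blast
  then show p: "partition nu"
    using dominant_weight_antimono[OF xg g] by (auto simp: partition_def nu intro: finite_subset)
  have "mu i = 0" if "i \<ge> N" for i
    using gt_zero[OF xg, of i i] gtD(4)[OF xg, of i] that by (simp add: N_def)
  then show "psize nu = psize la + psize mu"
    using psize_eq[of N nu] psize_eq[of N la] psize_eq[of N mu] z N0 sum_weight[OF xg, of N]
      gtD(4)[OF xg, of N]
    by (simp add: nu sum.distrib row_sum_def N_def)
qed

text \<open>By \<open>lr_patterns_eq\<close> the number of patterns is the same for all numbers of letters that bound
  the length of \<open>nu\<close>; if there is a pattern at all, then the size of \<open>nu\<close> is the sum of the two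
  sizes, and it bounds the length.\<close>

definition lr_count :: "(nat \<Rightarrow> nat) \<Rightarrow> (nat \<Rightarrow> nat) \<Rightarrow> (nat \<Rightarrow> nat) \<Rightarrow> int" where
  "lr_count la mu nu = int (card (lr_patterns (psize la + psize mu) la mu nu))"

lemma finite_lr_patterns: "finite (lr_patterns n la mu nu)"
  unfolding lr_patterns_def using finite_gt by simp

lemma lr_count_eq:
  assumes la: "partition la" and mu: "partition mu" and nu: "\<And>k. k \<ge> n \<Longrightarrow> nu k = 0"
  shows "lr_count la mu nu = int (card (lr_patterns n la mu nu))"
proof -
  let ?N = "psize la + psize mu"
  have "lr_patterns ?N la mu nu = lr_patterns n la mu nu"
  proof (cases "n \<le> ?N")
    case True
    then show ?thesis using lr_patterns_eq[of n nu ?N] nu by simp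
  next
    case False
    then have le: "?N \<le> n" by simp
    show ?thesis
    proof (cases "lr_patterns ?N la mu nu = {} \<and> lr_patterns n la mu nu = {}")
      case False
      then obtain x m where "x \<in> lr_patterns m la mu nu" by blast
      note l = lr_patterns_partition[OF la mu this]
      have "nu k = 0" if "k \<ge> ?N" for k using partition_beyond_psize[OF l(1)] l(2) that by simp
      then show ?thesis using lr_patterns_eq[of ?N nu n] le by simp
    qed auto
  qed
  then show ?thesis by (simp add: lr_count_def)
qed

lemma lr_count_nonzero:
  assumes "lr_count la mu nu \<noteq> 0" obtains x where "x \<in> lr_patterns (psize la + psize mu) la mu nu"
  using assms unfolding lr_count_def by fastforce

lemma schur_zero: assumes "partition mu" "mu i \<noteq> 0" "n \<le> i" shows "schur n mu = 0"
  using gt_empty[of mu i n] assms by (simp add: schur_gt)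

lemma lookup_of_int_mult:
  fixes B :: mpoly shows "lookup (of_int c * B) m = c * lookup B m"
proof -
  have "(of_int c :: mpoly) = single 0 c" by (metis of_int_eq_id id_apply single_of_int)
  then have "of_int c * B = Poly_Mapping.map ((*) c) B"
    by (simp add: mult_map_scale_conv_mult)
  then show ?thesis by (simp add: Poly_Mapping.map.rep_eq when_def)
qed

text \<open>An increasing permutation moves no index down, and the same holds for its inverse.\<close>

lemma perm_eq_id:
  fixes n :: nat
  assumes w: "w permutes {..<n}" and mono: "\<And>i j. i < j \<Longrightarrow> j < n \<Longrightarrow> w i < w j"
  shows "w = id"
proof -
  have ge: "i \<le> v i" if "i < n" and v: "\<And>i j::nat. i < j \<Longrightarrow> j < n \<Longrightarrow> v i < v j" for v :: "nat \<Rightarrow> nat" and i :: nat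
    using that(1)
  proof (induction i)
    case (Suc i)
    then show ?case using v[of i "Suc i"] by simp
  qed simp
  have w1: "w i < n" if "i < n" for i using permutes_in_image[OF w, of i] that by simp
  have iw: "inv w permutes {..<n}" by (rule permutes_inv[OF w])
  have w2: "inv w i < n" if "i < n" for i using permutes_in_image[OF iw, of i] that by simp
  have im: "inv w i < inv w j" if "i < j" "j < n" for i j
  proof (rule ccontr)
    assume "\<not> inv w i < inv w j"
    then consider "inv w i = inv w j" | "inv w j < inv w i" by linarith
    then show False
    proof cases
      case 1
      then have "w (inv w i) = w (inv w j)" by simp
      then show False using that permutes_inverses(1)[OF w] by simp
    next
      case 2
      have "w (inv w j) < w (inv w i)" by (rule mono[OF 2]) (use w2 that in auto)
      then show False using that permutes_inverses(1)[OF w] by simp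
    qed
  qed
  have "w i = i" if "i < n" for i
  proof -
    have "w i \<le> inv w (w i)" using ge[of "w i" "inv w"] im w1[OF that] by blast
    then show ?thesis using ge[of i w] mono that permutes_inverses(2)[OF w] by fastforce
  qed
  then show ?thesis using permutes_not_in[OF w] by (auto simp: fun_eq_iff)
qed

lemma lookup_alt_strict:
  assumes p: "\<And>i j. i < j \<Longrightarrow> j < n \<Longrightarrow> p j < p i" and q: "\<And>i j. i < j \<Longrightarrow> j < n \<Longrightarrow> q j < q i"
  shows "lookup (alternant n p) (expo n q) = (if \<forall>i<n. p i = q i then 1 else (0::int))"
proof -
  have key: "w = id" if "w permutes {..<n}" "expo n (p \<circ> w) = expo n q" for w
  proof (rule perm_eq_id[OF that(1)])
    fix i j assume ij: "i < j" "j < n"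
    have e: "p (w i) = q i" "p (w j) = q j" using that(2) ij by (auto simp: expo_eq_iff)
    have b: "w i < n" "w j < n" using permutes_in_image[OF that(1)] ij by auto
    show "w i < w j"
    proof (rule ccontr)
      assume "\<not> w i < w j"
      then consider "w i = w j" | "w j < w i" by linarith
      then show False using e q[OF ij] p[of "w j" "w i"] b by cases auto
    qed
  qed
  have "lookup (alternant n p) (expo n q) = (\<Sum>w | w permutes {..<n}. if w = id then (if \<forall>i<n. p i = q i then 1 else 0) else 0)"
    unfolding alternant_def lookup_sum
  proof (rule sum.cong[OF refl])
    fix w assume "w \<in> {w. w permutes {..<n}}"
    then show "lookup (single (expo n (p \<circ> w)) (sign w)) (expo n q)
      = (if w = id then (if \<forall>i<n. p i = q i then 1 else 0) else 0)"
      using key[of w] by (auto simp: lookup_single when_def expo_eq_iff)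
  qed
  also have "\<dots> = (if \<forall>i<n. p i = q i then 1 else 0)"
    using finite_permutations[OF finite_lessThan[of n]] by (simp add: permutes_id)
  finally show ?thesis .
qed

lemma strict_rho:
  assumes "antimono nu" "i < j" "j < n" shows "nu j + rho n j < nu i + rho n i"
  using antimonoD[OF assms(1), of i j] assms by (simp add: rho_def)

lemma alternant_rho_nonzero: "alternant n (rho n) \<noteq> 0"
proof
  assume "alternant n (rho n) = 0"
  then have "lookup (alternant n (rho n)) (expo n (rho n)) = 0" by simp
  then show False using lookup_alt_strict[of n "rho n" "rho n"] strict_rho[of "\<lambda>_. 0" _ _ n] by (simp add: antimono_def)
qed

lemma alternant_lambda_schur:
  assumes la: "partition la" "\<And>i. i \<ge> n \<Longrightarrow> la i = 0" and mu: "partition mu"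
  shows "alternant n (\<lambda>i. la i + rho n i) * schur n mu
    = (\<Sum>nu | (\<forall>i\<ge>n. nu i = 0) \<and> lr_count la mu nu \<noteq> 0. of_int (lr_count la mu nu) * alternant n (\<lambda>i. nu i + rho n i))"
proof -
  let ?G = "{x. x \<in> gt_patterns n mu \<and> dominant la x}"
  let ?g = "\<lambda>x k. la k + weight x k"
  have fib: "{x \<in> ?G. ?g x = nu} = lr_patterns n la mu nu" for nu by (auto simp: lr_patterns_def)
  have gz: "?g x i = 0" if "x \<in> ?G" "i \<ge> n" for x i
    using that weight_outside[of x n mu i] la(2) by simp
  have im: "{nu. (\<forall>i\<ge>n. nu i = 0) \<and> lr_count la mu nu \<noteq> 0} = ?g ` ?G"
  proof (intro equalityI subsetI)
    fix nu assume "nu \<in> {nu. (\<forall>i\<ge>n. nu i = 0) \<and> lr_count la mu nu \<noteq> 0}"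
    then have nu: "\<forall>i\<ge>n. nu i = 0" "lr_count la mu nu \<noteq> 0" by auto
    then have "card (lr_patterns n la mu nu) \<noteq> 0" using lr_count_eq[OF la(1) mu, of n nu] by simp
    then obtain x where "x \<in> lr_patterns n la mu nu" by fastforce
    then have "x \<in> ?G" "nu = ?g x" by (auto simp: lr_patterns_def fun_eq_iff)
    then show "nu \<in> ?g ` ?G" by blast
  next
    fix nu assume "nu \<in> ?g ` ?G"
    then obtain x where x: "x \<in> ?G" "nu = ?g x" by blast
    have z: "\<forall>i\<ge>n. nu i = 0" unfolding x(2) by (intro allI impI) (rule gz[OF x(1)])
    have "x \<in> lr_patterns n la mu nu" using x(1) unfolding x(2) by (simp add: lr_patterns_def)
    then have "card (lr_patterns n la mu nu) \<noteq> 0" using finite_lr_patterns[of n la mu nu] by auto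
    then show "nu \<in> {nu. (\<forall>i\<ge>n. nu i = 0) \<and> lr_count la mu nu \<noteq> 0}"
      using z lr_count_eq[OF la(1) mu, of n nu] by simp
  qed
  have "alternant n (\<lambda>i. la i + rho n i) * schur n mu = (\<Sum>x\<in>?G. alternant n (\<lambda>i. la i + rho n i + weight x i))"
    by (rule alternant_schur_good[OF mu partitionD(1)[OF la(1)]]) (rule la(2))
  also have "\<dots> = (\<Sum>x\<in>?G. alternant n (\<lambda>i. ?g x i + rho n i))"
    by (simp add: add_ac)
  also have "\<dots> = (\<Sum>nu\<in>?g ` ?G. \<Sum>x\<in>{x \<in> ?G. ?g x = nu}. alternant n (\<lambda>i. ?g x i + rho n i))"
    by (rule sum.image_gen) (simp add: finite_gt)
  also have "\<dots> = (\<Sum>nu\<in>?g ` ?G. of_int (lr_count la mu nu) * alternant n (\<lambda>i. nu i + rho n i))"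
  proof (rule sum.cong[OF refl])
    fix nu assume nu: "nu \<in> ?g ` ?G"
    have "(\<Sum>x\<in>{x \<in> ?G. ?g x = nu}. alternant n (\<lambda>i. ?g x i + rho n i)) = (\<Sum>x\<in>lr_patterns n la mu nu. alternant n (\<lambda>i. nu i + rho n i))"
      unfolding fib by (rule sum.cong[OF refl]) (simp add: lr_patterns_def)
    also have "\<dots> = of_nat (card (lr_patterns n la mu nu)) * alternant n (\<lambda>i. nu i + rho n i)" by simp
    also have "int (card (lr_patterns n la mu nu)) = lr_count la mu nu"
      using lr_count_eq[OF la(1) mu, of n nu] nu gz by fastforce
    then have "(of_nat (card (lr_patterns n la mu nu)) :: mpoly) = of_int (lr_count la mu nu)" by (metis of_int_of_nat_eq)
    finally show "(\<Sum>x\<in>{x \<in> ?G. ?g x = nu}. alternant n (\<lambda>i. ?g x i + rho n i)) = of_int (lr_count la mu nu) * alternant n (\<lambda>i. nu i + rho n i)" .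
  qed
  finally show ?thesis unfolding im .
qed

text \<open>In a domain the factor \<open>alternant n (rho n)\<close> can be cancelled; multiplied by it, both sides
  become the same sum of alternants. If \<open>la\<close> or \<open>mu\<close> has more than \<open>n\<close> parts, then so has every
  \<open>nu\<close> that occurs, and both sides vanish.\<close>

theorem schur_expansion_lr_count:
  assumes la: "partition la" and mu: "partition mu"
  shows "schur_expansion la mu (lr_count la mu)"
  unfolding schur_expansion_def
proof (intro conjI allI impI)
  let ?N = "psize la + psize mu"
  have "{nu. lr_count la mu nu \<noteq> 0} \<subseteq> (\<lambda>x k. la k + weight x k) ` gt_patterns ?N mu"
  proof
    fix nu assume "nu \<in> {nu. lr_count la mu nu \<noteq> 0}"
    then obtain x where "x \<in> lr_patterns ?N la mu nu" using lr_count_nonzero by blast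
    then have "x \<in> gt_patterns ?N mu" "nu = (\<lambda>k. la k + weight x k)" by (auto simp: lr_patterns_def fun_eq_iff)
    then show "nu \<in> (\<lambda>x k. la k + weight x k) ` gt_patterns ?N mu" by blast
  qed
  then show fin: "finite {nu. lr_count la mu nu \<noteq> 0}" using finite_gt finite_subset by blast
  show part: "partition nu" if "lr_count la mu nu \<noteq> 0" for nu
    using lr_count_nonzero[OF that] lr_patterns_partition[OF la mu] by metis
  fix n
  let ?S = "\<Sum>nu | lr_count la mu nu \<noteq> 0. of_int (lr_count la mu nu) * schur n nu"
  show "schur n la * schur n mu = ?S"
  proof (cases "(\<forall>i\<ge>n. la i = 0) \<and> (\<forall>i\<ge>n. mu i = 0)")
    case True
    have "alternant n (rho n) * ?S = (\<Sum>nu | lr_count la mu nu \<noteq> 0. of_int (lr_count la mu nu) * (alternant n (rho n) * schur n nu))"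
      by (simp add: sum_distrib_left mult_ac)
    also have "\<dots> = (\<Sum>nu | (\<forall>i\<ge>n. nu i = 0) \<and> lr_count la mu nu \<noteq> 0. of_int (lr_count la mu nu) * (alternant n (rho n) * schur n nu))"
    proof (rule sum.mono_neutral_right[OF fin], blast, rule ballI)
      fix nu assume "nu \<in> {nu. lr_count la mu nu \<noteq> 0} - {nu. (\<forall>i\<ge>n. nu i = 0) \<and> lr_count la mu nu \<noteq> 0}"
      then obtain i where "i \<ge> n" "nu i \<noteq> 0" "lr_count la mu nu \<noteq> 0" by blast
      then show "of_int (lr_count la mu nu) * (alternant n (rho n) * schur n nu) = 0"
        using schur_zero[OF part] by simp
    qed
    also have "\<dots> = (\<Sum>nu | (\<forall>i\<ge>n. nu i = 0) \<and> lr_count la mu nu \<noteq> 0. of_int (lr_count la mu nu) * alternant n (\<lambda>i. nu i + rho n i))"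
      by (rule sum.cong[OF refl]) (use alternant_rho_schur part in auto)
    also have "\<dots> = alternant n (\<lambda>i. la i + rho n i) * schur n mu"
      using alternant_lambda_schur[OF la _ mu, of n] True by simp
    also have "\<dots> = alternant n (rho n) * (schur n la * schur n mu)"
      using alternant_rho_schur[OF la, of n] True by (simp add: mult.assoc)
    finally show ?thesis by (rule mult_left_cancel[OF alternant_rho_nonzero, THEN iffD1, symmetric])
  next
    case False
    have "schur n nu = 0" if nz: "lr_count la mu nu \<noteq> 0" for nu
    proof -
      obtain x where x: "x \<in> lr_patterns ?N la mu nu" using lr_count_nonzero[OF nz] by blast
      have "\<exists>i\<ge>n. nu i \<noteq> 0"
      proof (rule ccontr)
        assume c: "\<not> (\<exists>i\<ge>n. nu i \<noteq> 0)"
        have s: "la i + weight x i = nu i" for i using x by (simp add: lr_patterns_def)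
        then have "la i = 0" "weight x i = 0" if "i \<ge> n" for i using c that by (metis add_is_0)+
        moreover have "x \<in> gt_patterns n mu"
          by (rule gt_shrink[of _ ?N]) (use x calculation in \<open>auto simp: lr_patterns_def\<close>)
        ultimately show False using False gt_empty[of mu _ n] by blast
      qed
      then show ?thesis using schur_zero[OF part[OF nz]] by blast
    qed
    then have "?S = 0" by simp
    then show ?thesis using False schur_zero[OF la] schur_zero[OF mu] by auto
  qed
qed

text \<open>After multiplication by \<open>alternant n (rho n)\<close> the coefficient of the monomial with exponents
  \<open>nu0 + rho\<close> is the coefficient of the Schur polynomial of \<open>nu0\<close>.\<close>

lemma schur_expansion_unique:
  assumes c: "schur_expansion la mu c" and d: "schur_expansion la mu d"
  shows "c = d"
proof
  fix nu0
  let ?V = "{nu. c nu \<noteq> 0} \<union> {nu. d nu \<noteq> 0} \<union> {nu0}"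
  have fin: "finite ?V" using c d by (simp add: schur_expansion_def)
  have part: "partition nu" if "nu \<in> ?V" "nu \<noteq> nu0" for nu using c d that by (auto simp: schur_expansion_def)
  show "c nu0 = d nu0"
  proof (cases "partition nu0")
    case False
    then have "c nu0 = 0" "d nu0 = 0" using c d by (auto simp: schur_expansion_def)
    then show ?thesis by simp
  next
    case True
    then have part: "partition nu" if "nu \<in> ?V" for nu using part that by blast
    define n where "n = Max (psize ` ?V)"
    have zero: "nu i = 0" if "nu \<in> ?V" "i \<ge> n" for nu i
    proof -
      have "psize nu \<le> n" unfolding n_def using that fin by (intro Max_ge) auto
      then show ?thesis using partition_beyond_psize[OF part[OF that(1)], of i] that(2) by simp
    qed
    have s: "schur n la * schur n mu = (\<Sum>nu\<in>?V. of_int (e nu) * schur n nu)"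
      if "schur_expansion la mu e" "{nu. e nu \<noteq> 0} \<subseteq> ?V" for e
    proof -
      have "schur n la * schur n mu = (\<Sum>nu | e nu \<noteq> 0. of_int (e nu) * schur n nu)"
        using that(1) by (simp add: schur_expansion_def)
      also have "\<dots> = (\<Sum>nu\<in>?V. of_int (e nu) * schur n nu)"
        using that fin by (intro sum.mono_neutral_left) auto
      finally show ?thesis .
    qed
    have co: "lookup (alternant n (rho n) * (schur n la * schur n mu)) (expo n (\<lambda>i. nu0 i + rho n i)) = e nu0"
      if "schur_expansion la mu e" "{nu. e nu \<noteq> 0} \<subseteq> ?V" for e
    proof -
      have "alternant n (rho n) * (schur n la * schur n mu) = (\<Sum>nu\<in>?V. of_int (e nu) * (alternant n (rho n) * schur n nu))"
        unfolding s[OF that] sum_distrib_left by (simp add: mult_ac)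
      also have "\<dots> = (\<Sum>nu\<in>?V. of_int (e nu) * alternant n (\<lambda>i. nu i + rho n i))"
        by (rule sum.cong[OF refl]) (use alternant_rho_schur part zero in auto)
      finally have "lookup (alternant n (rho n) * (schur n la * schur n mu)) (expo n (\<lambda>i. nu0 i + rho n i))
        = (\<Sum>nu\<in>?V. e nu * lookup (alternant n (\<lambda>i. nu i + rho n i)) (expo n (\<lambda>i. nu0 i + rho n i)))"
        by (simp add: lookup_sum lookup_of_int_mult)
      also have "\<dots> = (\<Sum>nu\<in>?V. if nu = nu0 then e nu else 0)"
      proof (rule sum.cong[OF refl])
        fix nu assume nu: "nu \<in> ?V"
        have "(\<forall>i<n. nu i + rho n i = nu0 i + rho n i) \<longleftrightarrow> nu = nu0"
          using zero[OF nu] zero[of nu0] by (auto simp: fun_eq_iff) (metis not_le)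
        then show "e nu * lookup (alternant n (\<lambda>i. nu i + rho n i)) (expo n (\<lambda>i. nu0 i + rho n i)) = (if nu = nu0 then e nu else 0)"
          using lookup_alt_strict[of n "\<lambda>i. nu i + rho n i" "\<lambda>i. nu0 i + rho n i"]
            strict_rho[OF partitionD(1)[OF part[OF nu]]] strict_rho[OF partitionD(1)[OF True]] by auto
      qed
      also have "\<dots> = e nu0" using fin by simp
      finally show ?thesis .
    qed
    have "{nu. c nu \<noteq> 0} \<subseteq> ?V" "{nu. d nu \<noteq> 0} \<subseteq> ?V" by blast+
    then show ?thesis using co[OF c] co[OF d] by metis
  qed
qed

theorem lr_coeff_eq:
  assumes "partition la" "partition mu"
  shows "lr_coeff la mu nu = lr_count la mu nu"
  unfolding lr_coeff_def
  using the_equality[of "schur_expansion la mu", OF schur_expansion_lr_count[OF assms]]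
    schur_expansion_unique[OF _ schur_expansion_lr_count[OF assms]] by metis

section \<open>Division by the Vandermonde product and Steinberg's formula\<close>

lemma mpoly_sum_singles:
  fixes B :: "'a \<Rightarrow>\<^sub>0 'b::comm_monoid_add"
  shows "(\<Sum>q\<in>keys B. single q (lookup B q)) = B"
proof (rule poly_mapping_eqI)
  fix k
  have "(\<Sum>q\<in>keys B. lookup (single q (lookup B q)) k)
    = (\<Sum>q\<in>keys B. if q = k then lookup B k else 0)"
    by (rule sum.cong) (auto simp: lookup_single when_def)
  then show "lookup (\<Sum>q\<in>keys B. single q (lookup B q)) k = lookup B k"
    by (simp add: lookup_sum in_keys_iff)
qed

lemma mpoly_induct [case_names single add]:
  fixes B :: mpoly
  assumes "\<And>m c. P (single m c)" "\<And>A B. P A \<Longrightarrow> P B \<Longrightarrow> P (A + B)"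
  shows "P B"
proof -
  have P0: "P 0" using assms(1)[of 0 0] by simp
  have "P (\<Sum>q\<in>A. single q (c q))" if "finite A" for A and c :: "_ \<Rightarrow> int"
    using that by (induction A rule: finite_induct) (simp_all add: P0 assms)
  then show ?thesis using mpoly_sum_singles[of B] finite_keys[of B] by metis
qed

definition real_exps :: "(nat \<Rightarrow>\<^sub>0 nat) \<Rightarrow> (nat \<Rightarrow>\<^sub>0 real)" where
  "real_exps m = Poly_Mapping.map real m"

lemma lookup_emb: "lookup (real_exps m) i = real (lookup m i)"
  by (simp add: real_exps_def Poly_Mapping.map.rep_eq when_def)

lemma real_exps_add: "real_exps (m + m') = real_exps m + real_exps m'"
  by (rule poly_mapping_eqI) (simp add: lookup_emb lookup_add)

lemma real_exps_eq_iff: "real_exps m = real_exps m' \<longleftrightarrow> m = m'"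
proof
  assume "real_exps m = real_exps m'"
  then have "real (lookup m i) = real (lookup m' i)" for i by (metis lookup_emb)
  then show "m = m'" by (intro poly_mapping_eqI) simp
qed simp

lemma real_exps_single: "real_exps (single i 1) = single i 1"
  by (rule poly_mapping_eqI) (simp add: lookup_emb lookup_single when_def)

text \<open>The linear functional on polynomials that maps the monomial with exponents \<open>q\<close> to \<open>g q\<close>.\<close>

definition pairing :: "mpoly \<Rightarrow> ((nat \<Rightarrow>\<^sub>0 real) \<Rightarrow> real) \<Rightarrow> real" where
  "pairing B g = (\<Sum>q\<in>keys B. real_of_int (lookup B q) * g (real_exps q))"

lemma pairing_add: "pairing (A + B) g = pairing A g + pairing B g"
  unfolding pairing_def by (rule setsum_keys_plus_distrib) (simp_all add: algebra_simps)

lemma pairing_single: "pairing (single m c) g = real_of_int c * g (real_exps m)"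
  by (simp add: pairing_def)

lemma pairing_zero: "pairing 0 g = 0" by (simp add: pairing_def)

lemma pairing_sum: "pairing (\<Sum>x\<in>A. f x) g = (\<Sum>x\<in>A. pairing (f x) g)"
  by (induction A rule: infinite_finite_induct) (simp_all add: pairing_zero pairing_add)

lemma pairing_diff: "pairing (A - B) g = pairing A g - pairing B g"
  using pairing_add[of "A - B" B g] by simp

lemma pairing_single_mult: "pairing (single m c * B) g = real_of_int c * pairing B (\<lambda>v. g (v + real_exps m))"
  by (induction B rule: mpoly_induct)
     (simp_all add: mult_single pairing_single real_exps_add add.commute distrib_left pairing_add)

lemma pairing_cong_diff: "pairing B (\<lambda>v. g v - h v) = pairing B g - pairing B h"
  by (simp add: pairing_def algebra_simps sum_subtractf)

definition diff_prod :: "(nat \<times> nat) set \<Rightarrow> mpoly" where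
  "diff_prod S = (\<Prod>p\<in>S. var (fst p) - var (snd p))"

definition first_sum :: "(nat \<times> nat) set \<Rightarrow> (nat \<Rightarrow>\<^sub>0 real)" where
  "first_sum S = (\<Sum>p\<in>S. single (fst p) 1)"

text \<open>Each factor is \<open>x_i - x_j = x_i (1 - x_j / x_i)\<close>. Dividing by the factors and expanding in
  powers of the \<open>x_j / x_i\<close> produces the partition function of the vectors \<open>e_i - e_j\<close>, and
  \<open>first_sum S\<close> accounts for the monomials \<open>x_i\<close>. In the proof a factor is moved from the
  polynomial to the function it is paired with, where \<open>vpf_step\<close> absorbs it.\<close>

lemma lookup_by_kostant:
  assumes "S \<subseteq> index_pairs r"
  shows "real_of_int (lookup B m) = pairing (diff_prod S * B) (\<lambda>v. vpf S pos_root (v - first_sum S - real_exps m))"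
proof -
  have "finite S" using assms finite_index_pairs finite_subset by blast
  then show ?thesis using assms
  proof (induction S arbitrary: B rule: finite_induct)
    case empty
    have "vpf {} pos_root v = (if v = 0 then 1 else 0)" for v :: "nat \<Rightarrow>\<^sub>0 real"
    proof -
      have "vpf_sols {} pos_root v = (if v = 0 then {\<lambda>_. 0} else {})" by (auto simp: vpf_sols_def)
      then show ?thesis by (simp add: vpf_def)
    qed
    then have "pairing (diff_prod {} * B) (\<lambda>v. vpf {} pos_root (v - first_sum {} - real_exps m))
       = (\<Sum>q\<in>keys B. if q = m then real_of_int (lookup B m) else 0)"
      unfolding pairing_def diff_prod_def first_sum_def
      by (intro sum.cong) (auto simp: real_exps_eq_iff)
    also have "\<dots> = real_of_int (lookup B m)"
      by (simp add: in_keys_iff)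
    finally show ?case by simp
  next
    case (insert p S)
    let ?S = "insert p S"
    have fin: "finite (vpf_sols ?S pos_root v)" for v
      by (rule finite_vsol_subset[OF finite_index_pairs insert.prems finite_vsol_pos_root])
    define D where "D = diff_prod S * B"
    have "diff_prod ?S * B = (var (fst p) - var (snd p)) * D"
      using insert.hyps by (simp add: diff_prod_def D_def mult.assoc)
    then have "pairing (diff_prod ?S * B) (\<lambda>v. vpf ?S pos_root (v - first_sum ?S - real_exps m))
      = pairing D (\<lambda>v. vpf ?S pos_root (v + single (fst p) 1 - first_sum ?S - real_exps m) -
                       vpf ?S pos_root (v + single (snd p) 1 - first_sum ?S - real_exps m))"
      by (simp add: left_diff_distrib pairing_diff var_def pairing_single_mult real_exps_single pairing_cong_diff
          del: One_nat_def)
    also have "(\<lambda>v. vpf ?S pos_root (v + single (fst p) 1 - first_sum ?S - real_exps m) -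
                       vpf ?S pos_root (v + single (snd p) 1 - first_sum ?S - real_exps m))
       = (\<lambda>v. vpf S pos_root (v - first_sum S - real_exps m))"
    proof
      fix v
      let ?w = "v + single (snd p) 1 - first_sum ?S - real_exps m"
      have fs: "first_sum ?S = single (fst p) 1 + first_sum S"
        using insert.hyps by (simp add: first_sum_def)
      have w: "?w + pos_root p = v + single (fst p) 1 - first_sum ?S - real_exps m"
        by (simp add: pos_root_def algebra_simps)
      have w2: "v + single (fst p) 1 - first_sum ?S - real_exps m = v - first_sum S - real_exps m"
        by (simp add: fs algebra_simps)
      have "vpf ?S pos_root (?w + pos_root p) = vpf ?S pos_root ?w + vpf (?S - {p}) pos_root (?w + pos_root p)"
        using insert.hyps by (intro vpf_step fin) auto
      moreover have "?S - {p} = S" using insert.hyps by auto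
      ultimately show "vpf ?S pos_root (v + single (fst p) 1 - first_sum ?S - real_exps m) - vpf ?S pos_root ?w
        = vpf S pos_root (v - first_sum S - real_exps m)"
        unfolding w w2 by simp
    qed
    also have "pairing D \<dots> = real_of_int (lookup B m)"
      unfolding D_def using insert by simp
    finally show ?case by simp
  qed
qed

definition permute_exps :: "(nat \<Rightarrow> nat) \<Rightarrow> (nat \<Rightarrow>\<^sub>0 nat) \<Rightarrow> (nat \<Rightarrow>\<^sub>0 nat)" where
  "permute_exps t m = Poly_Mapping.map_key t m"

text \<open>For an involution \<open>t\<close>, the only case considered, permuting the exponents by \<open>t\<close> amounts to
  permuting the variables by \<open>t\<close>.\<close>

definition permute_vars :: "(nat \<Rightarrow> nat) \<Rightarrow> mpoly \<Rightarrow> mpoly" where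
  "permute_vars t B = (\<Sum>q\<in>keys B. single (permute_exps t q) (lookup B q))"

lemma permute_vars_add: "permute_vars t (A + B) = permute_vars t A + permute_vars t B"
  unfolding permute_vars_def by (rule setsum_keys_plus_distrib) (simp_all add: single_add)

lemma permute_vars_single: "permute_vars t (single m c) = single (permute_exps t m) c"
  by (simp add: permute_vars_def)

lemma permute_vars_diff: "permute_vars t (A - B) = permute_vars t A - permute_vars t B"
  using permute_vars_add[of t "A - B" B] by simp

context
  fixes t :: "nat \<Rightarrow> nat"
  assumes invol: "t \<circ> t = id"
begin

lemma invol_inj: "inj t" using invol by (metis inj_on_id inj_on_imageI2)

lemma lookup_pm: "lookup (permute_exps t m) i = lookup m (t i)"
  by (simp add: permute_exps_def map_key.rep_eq[OF invol_inj])

lemma permute_exps_add: "permute_exps t (m + m') = permute_exps t m + permute_exps t m'"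
  by (rule poly_mapping_eqI) (simp add: lookup_pm lookup_add)

lemma permute_exps_pm: "permute_exps t (permute_exps t m) = m"
  using invol by (intro poly_mapping_eqI) (simp add: lookup_pm fun_eq_iff)

lemma permute_vars_mult: "permute_vars t (A * B) = permute_vars t A * permute_vars t B"
proof (induction A rule: mpoly_induct)
  case (single m c)
  show ?case
    by (induction B rule: mpoly_induct) (simp_all add: mult_single permute_vars_single permute_exps_add distrib_left permute_vars_add)
qed (simp add: distrib_right permute_vars_add)

lemma permute_vars_prod: "finite S \<Longrightarrow> permute_vars t (\<Prod>p\<in>S. f p) = (\<Prod>p\<in>S. permute_vars t (f p))"
proof (induction S rule: finite_induct)
  case empty
  have "permute_exps t 0 = 0" by (rule poly_mapping_eqI) (simp add: lookup_pm)
  then have "permute_vars t (single 0 1) = single 0 1" by (simp only: permute_vars_single)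
  then show ?case by simp
qed (simp add: permute_vars_mult)

lemma permute_vars_var: "permute_vars t (var i) = var (t i)"
proof -
  have "t (t j) = j" for j using invol by (simp add: fun_eq_iff)
  then have "permute_exps t (single i 1) = single (t i) 1"
    by (intro poly_mapping_eqI) (auto simp: lookup_pm lookup_single when_def)
  then show ?thesis by (simp only: var_def permute_vars_single)
qed

lemma lookup_act: "lookup (permute_vars t B) (permute_exps t m) = lookup B m"
proof -
  have "lookup (permute_vars t B) (permute_exps t m) = (\<Sum>q\<in>keys B. if q = m then lookup B m else 0)"
    unfolding permute_vars_def lookup_sum by (rule sum.cong) (auto simp: lookup_single when_def, metis permute_exps_pm)
  then show ?thesis by (simp add: in_keys_iff)
qed

end

lemma permute_vars_diff_prod:
  assumes k: "Suc k < r"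
  shows "permute_vars (transpose k (Suc k)) (diff_prod (index_pairs r)) = - diff_prod (index_pairs r)"
proof -
  let ?t = "transpose k (Suc k)"
  have inv: "?t \<circ> ?t = id" by (simp add: fun_eq_iff)
  let ?p = "(k, Suc k)"
  let ?S = "index_pairs r - {?p}"
  have p: "?p \<in> index_pairs r" using k by (simp add: index_pairs_def)
  let ?m = "\<lambda>p::nat \<times> nat. (?t (fst p), ?t (snd p))"
  have sp: "(\<Prod>p\<in>index_pairs r. f p) = f ?p * (\<Prod>p\<in>?S. f p)" for f :: "nat \<times> nat \<Rightarrow> mpoly"
    using p finite_index_pairs[of r] by (simp add: prod.remove)
  have mS: "?m p \<in> ?S" if "p \<in> ?S" for p
    using that k by (auto simp: index_pairs_def transpose_def split: if_splits)
  have "permute_vars ?t (diff_prod (index_pairs r)) = (\<Prod>p\<in>index_pairs r. var (?t (fst p)) - var (?t (snd p)))"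
    unfolding diff_prod_def permute_vars_prod[OF inv finite_index_pairs] permute_vars_diff permute_vars_var[OF inv] ..
  also have "\<dots> = (var (Suc k) - var k) * (\<Prod>p\<in>?S. var (?t (fst p)) - var (?t (snd p)))"
    unfolding sp[of "\<lambda>p. var (?t (fst p)) - var (?t (snd p))"] by simp
  also have "(\<Prod>p\<in>?S. var (?t (fst p)) - var (?t (snd p))) = (\<Prod>p\<in>?S. var (fst p) - var (snd p))"
    by (rule prod.reindex_bij_witness[where i = ?m and j = ?m]) (use mS in auto)
  also have "(var (Suc k) - var k) * \<dots> = - diff_prod (index_pairs r)"
    unfolding diff_prod_def sp[of "\<lambda>p. var (fst p) - var (snd p)"] by (simp add: algebra_simps)
  finally show ?thesis .
qed

lemma permute_exps_expo:
  assumes "w permutes {..<r}" "w \<circ> w = id" shows "permute_exps w (expo r p) = expo r (p \<circ> w)"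
proof (rule poly_mapping_eqI)
  fix i
  have "w i < r \<longleftrightarrow> i < r" using permutes_in_image[OF assms(1), of i] by simp
  then show "lookup (permute_exps w (expo r p)) i = lookup (expo r (p \<circ> w)) i"
    by (simp add: lookup_pm[OF assms(2)] lookup_expo)
qed

text \<open>An adjacent transposition maps one factor to its negative and permutes the others.\<close>

lemma diff_prod_antisymmetric:
  assumes "w permutes {..<r}"
  shows "lookup (diff_prod (index_pairs r)) (expo r (p \<circ> w)) = sign w * lookup (diff_prod (index_pairs r)) (expo r p)"
  using assms
proof (induction arbitrary: p rule: permutes_adjacent_induct)
  case (comp v w)
  have "permutation v" "permutation w" using comp.hyps by (auto intro: permutation_permutes[THEN iffD2])
  then have "sign (v \<circ> w) = sign v * sign w" by (rule sign_compose)
  then show ?case using comp.IH(2)[of "p \<circ> v"] comp.IH(1)[of p] by (simp only: o_assoc mult_ac)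
next
  case (adjacent k)
  let ?t = "transpose k (Suc k)"
  have inv: "?t \<circ> ?t = id" by (simp add: fun_eq_iff)
  have t: "?t permutes {..<r}" using adjacent by (intro permutes_swap_id) auto
  have "lookup (diff_prod (index_pairs r)) (expo r p) = lookup (permute_vars ?t (diff_prod (index_pairs r))) (expo r (p \<circ> ?t))"
    unfolding permute_exps_expo[OF t inv, symmetric] by (rule lookup_act[OF inv, symmetric])
  then show ?case by (simp add: permute_vars_diff_prod[OF adjacent] sign_swap_id comp_def)
qed simp

lemma diff_prod_homogeneous:
  assumes "finite S" "S \<subseteq> index_pairs r" "m \<in> keys (diff_prod S)"
  shows "(\<Sum>i<r. lookup m i) = card S \<and> (\<forall>i\<ge>r. lookup m i = 0)"
  using assms
proof (induction S arbitrary: m rule: finite_induct)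
  case empty
  then show ?case by (simp add: diff_prod_def)
next
  case (insert p S)
  have ins: "diff_prod (insert p S) = (var (fst p) - var (snd p)) * diff_prod S" using insert.hyps by (simp add: diff_prod_def)
  obtain q m' where q: "q \<in> keys (var (fst p) - var (snd p))" "m' \<in> keys (diff_prod S)" "m = q + m'"
    using insert.prems(2) keys_mult unfolding ins by blast
  have IH: "(\<Sum>i<r. lookup m' i) = card S" "\<forall>i\<ge>r. lookup m' i = 0"
    using insert.IH[of m'] insert.prems q(2) by auto
  obtain i where i: "i < r" "q = single i 1"
  proof -
    have "q = single (fst p) 1 \<or> q = single (snd p) 1"
      using q(1) keys_diff[of "var (fst p)" "var (snd p)"] by (auto simp: var_def)
    moreover have "fst p < r" "snd p < r" using insert.prems by (auto simp: index_pairs_def)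
    ultimately show thesis using that by blast
  qed
  have "(\<Sum>l<r. lookup q l) = (\<Sum>l<r. if l = i then 1 else 0)"
    by (rule sum.cong) (auto simp: i(2) lookup_single when_def)
  then have "(\<Sum>l<r. lookup q l) = 1" using i(1) by simp
  then show ?case using IH insert.hyps i unfolding q(3) lookup_add sum.distrib
    by (auto simp: lookup_single when_def)
qed

lemma card_index_pairs: "card (index_pairs r) = (\<Sum>i<r. i)"
proof -
  have "index_pairs r = prod.swap ` (SIGMA j:{..<r}. {..<j})" by (auto simp: index_pairs_def image_iff)
  then have "card (index_pairs r) = card (SIGMA j:{..<r}. {..<j})" by (simp add: card_image)
  then show ?thesis by simp
qed

text \<open>Exchanging the elements from \<open>r\<close> on for the missing ones below \<open>r\<close> would lower the sum.\<close>

lemma initial_segment_by_sum: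
  fixes A :: "nat set"
  assumes "finite A" "card A = r" "\<Sum>A \<le> (\<Sum>i<r. i)"
  shows "A = {..<r}"
proof (rule ccontr)
  assume "A \<noteq> {..<r}"
  moreover have "card A = card {..<r}" using assms by simp
  ultimately have "\<not> A \<subseteq> {..<r}" using card_subset_eq[of "{..<r}" A] by auto
  then have ne: "A - {..<r} \<noteq> {}" by blast
  have c: "card (A - {..<r}) = card ({..<r} - A)"
    using assms(1,2) card_Diff_subset_Int[of A "{..<r}"] card_Diff_subset_Int[of "{..<r}" A]
    by (simp add: Int_commute)
  have k: "card (A - {..<r}) > 0" using ne assms(1) by (simp add: card_gt_0_iff)
  have "\<Sum>({..<r} - A) < card ({..<r} - A) * r"
    using k c sum_strict_mono[of "{..<r} - A" "\<lambda>i. i" "\<lambda>_. r"] by (auto simp: card_gt_0_iff)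
  also have "\<dots> \<le> \<Sum>(A - {..<r})"
  proof -
    have "card ({..<r} - A) * r = (\<Sum>i\<in>A - {..<r}. r)" by (simp add: c)
    also have "\<dots> \<le> \<Sum>(A - {..<r})" by (rule sum_mono) auto
    finally show ?thesis .
  qed
  finally have "\<Sum>({..<r} - A) < \<Sum>(A - {..<r})" .
  moreover have "\<Sum>A = \<Sum>(A \<inter> {..<r}) + \<Sum>(A - {..<r})" using sum.Int_Diff[OF assms(1)] .
  moreover have "\<Sum>{..<r} = \<Sum>({..<r} \<inter> A) + \<Sum>({..<r} - A)" using sum.Int_Diff[of "{..<r}"] by simp
  ultimately show False using assms(3) by (simp add: Int_commute)
qed

text \<open>The product is antisymmetric and homogeneous of degree \<open>0 + 1 + \<dots> + (r - 1)\<close>. Antisymmetry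
  allows only monomials with distinct exponents, and in this degree distinct exponents are a
  permutation of \<open>0, \<dots>, r - 1\<close>. Hence the product is a multiple of the alternant of \<open>rho\<close>.\<close>

theorem vandermonde:
  obtains c where "c \<noteq> 0" "diff_prod (index_pairs r) = of_int c * alternant r (rho r)"
proof -
  let ?L = "\<lambda>p. lookup (diff_prod (index_pairs r)) (expo r p)"
  have inj: "inj_on p {..<r}" if "?L p \<noteq> 0" for p
  proof (rule inj_onI, rule ccontr)
    fix a b assume ab: "a \<in> {..<r}" "b \<in> {..<r}" "p a = p b" "a \<noteq> b"
    have "p \<circ> transpose a b = p" using ab(3) by (auto simp: fun_eq_iff transpose_def)
    moreover have "transpose a b permutes {..<r}" using ab by (intro permutes_swap_id) auto
    ultimately have "?L p = - ?L p" using diff_prod_antisymmetric[of "transpose a b" r p] ab(4) by (simp add: sign_swap_id)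
    then show False using \<open>?L p \<noteq> 0\<close> by simp
  qed
  have eq: "diff_prod (index_pairs r) = of_int (?L (rho r)) * alternant r (rho r)"
  proof (rule poly_mapping_eqI)
    fix m
    let ?R = "lookup (of_int (?L (rho r)) * alternant r (rho r)) m"
    have R: "?R = ?L (rho r) * (\<Sum>w | w permutes {..<r}. if expo r (rho r \<circ> w) = m then sign w else 0)"
      unfolding lookup_of_int_mult alternant_def lookup_sum by (simp add: lookup_single when_def)
    show "lookup (diff_prod (index_pairs r)) m = ?R"
    proof (cases "\<exists>w. w permutes {..<r} \<and> expo r (rho r \<circ> w) = m")
      case True
      then obtain w0 where w0: "w0 permutes {..<r}" "expo r (rho r \<circ> w0) = m" by blast
      have u: "expo r (rho r \<circ> w) = m \<longleftrightarrow> w = w0" if "w permutes {..<r}" for w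
      proof
        assume "expo r (rho r \<circ> w) = m"
        then have "rho r (w i) = rho r (w0 i)" if "i < r" for i
          using w0(2) that expo_eq_iff[of r "rho r \<circ> w" "rho r \<circ> w0"] by simp
        moreover have "w i < r" "w0 i < r" if "i < r" for i
          using permutes_in_image[OF \<open>w permutes {..<r}\<close>] permutes_in_image[OF w0(1)] that by auto
        ultimately have "w i = w0 i" if "i < r" for i using that by (fastforce simp: rho_def)
        then show "w = w0"
          using permutes_not_in[OF \<open>w permutes {..<r}\<close>] permutes_not_in[OF w0(1)]
          by (metis ext lessThan_iff)
      qed (use w0 in simp)
      have "(\<Sum>w | w permutes {..<r}. if expo r (rho r \<circ> w) = m then sign w else 0)
        = (\<Sum>w | w permutes {..<r}. if w = w0 then sign w0 else 0)"
        by (rule sum.cong) (use u in auto)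
      also have "\<dots> = sign w0" using w0 finite_permutations[OF finite_lessThan[of r]] by simp
      finally show ?thesis unfolding R using diff_prod_antisymmetric[OF w0(1), of "rho r"] w0(2) by (simp add: mult.commute)
    next
      case False
      have "lookup (diff_prod (index_pairs r)) m = 0"
      proof (rule ccontr)
        assume nz: "lookup (diff_prod (index_pairs r)) m \<noteq> 0"
        define p where "p = lookup m"
        have h: "(\<Sum>i<r. p i) = card (index_pairs r)" "\<forall>i\<ge>r. p i = 0"
          using diff_prod_homogeneous[OF finite_index_pairs order_refl, of m r] nz by (auto simp: p_def in_keys_iff)
        have m: "m = expo r p"
          by (rule poly_mapping_eqI) (use h(2) in \<open>simp add: lookup_expo p_def\<close>)
        have ip: "inj_on p {..<r}" by (rule inj) (use nz m in simp)
        have im: "p ` {..<r} = {..<r}"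
        proof (rule initial_segment_by_sum)
          show "card (p ` {..<r}) = r" using card_image[OF ip] by simp
          have "\<Sum>(p ` {..<r}) = (\<Sum>i<r. p i)" using sum.reindex[OF ip, of "\<lambda>i. i"] by simp
          then show "\<Sum>(p ` {..<r}) \<le> (\<Sum>i<r. i)" using h(1) card_index_pairs[of r] by simp
        qed simp
        have pr: "p i < r" if "i < r" for i using im that by blast
        define w where "w i = (if i < r then r - 1 - p i else i)" for i
        have "inj_on w {..<r}"
        proof (rule inj_onI)
          fix a b assume ab: "a \<in> {..<r}" "b \<in> {..<r}" "w a = w b"
          then have "p a = p b" using pr[of a] pr[of b] by (simp add: w_def)
          then show "a = b" using ip ab by (auto dest: inj_onD)
        qed
        moreover have "w ` {..<r} \<subseteq> {..<r}" by (auto simp: w_def)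
        ultimately have "bij_betw w {..<r} {..<r}"
          by (simp add: bij_betw_def endo_inj_surj)
        then have "w permutes {..<r}" by (rule bij_imp_permutes) (simp add: w_def)
        moreover have "expo r (rho r \<circ> w) = m"
          unfolding m expo_eq_iff using pr by (force simp: w_def rho_def)
        ultimately show False using False by blast
      qed
      then show ?thesis unfolding R using False by (simp add: sum.neutral)
    qed
  qed
  have "diff_prod (index_pairs r) \<noteq> 0"
  proof
    assume "diff_prod (index_pairs r) = 0"
    then obtain p where p: "p \<in> index_pairs r" "var (fst p) = var (snd p)"
      unfolding diff_prod_def prod_zero_iff[OF finite_index_pairs] by auto
    then have "single (fst p) (1::nat) = single (snd p) 1"
      unfolding var_def by (metis lookup_single_eq lookup_single_not_eq zero_neq_one)
    then have "fst p = snd p" by (metis lookup_single_eq lookup_single_not_eq zero_neq_one)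
    then show False using p(1) by (auto simp: index_pairs_def)
  qed
  then have "?L (rho r) \<noteq> 0" using eq by auto
  then show ?thesis using that eq by blast
qed

text \<open>Steinberg's formula: the coefficient is that of \<open>nu + rho\<close> in
  \<open>alternant (la + rho) * schur mu\<close>. Up to the constant \<open>c\<close>, the product of the latter with
  \<open>diff_prod\<close> is a product of two alternants, so that \<open>lookup_by_kostant\<close> expresses the
  coefficient as a signed sum of values of Kostant's partition function at points that move
  along arithmetic progressions.\<close>

theorem lr_count_ev_poly:
  assumes la: "partition_of_length_le r la0" "partition_of_length_le r la1"
    and mu: "partition_of_length_le r mu0" "partition_of_length_le r mu1"
    and nu: "partition_of_length_le r nu0" "partition_of_length_le r nu1"
  shows "ev_poly (\<lambda>n. real_of_int (lr_count (\<lambda>i. la0 i + n * la1 i) (\<lambda>i. mu0 i + n * mu1 i) (\<lambda>i. nu0 i + n * nu1 i)))"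
proof -
  define la where "la n i = la0 i + n * la1 i" for n i
  define mu where "mu n i = mu0 i + n * mu1 i" for n i
  define nu where "nu n i = nu0 i + n * nu1 i" for n i
  have comb: "partition (\<lambda>i. a i + n * b i) \<and> (\<forall>i\<ge>r. a i + n * b i = 0)"
    if "partition_of_length_le r a" "partition_of_length_le r b" for a b n
  proof -
    have "{i. a i + n * b i \<noteq> 0} \<subseteq> {..<r}"
      using support_lessThan[of r "\<lambda>i. a i + n * b i"] that by (auto simp: partition_of_length_le_def)
    then have "finite {i. a i + n * b i \<noteq> 0}" using finite_subset by blast
    moreover have "antimono (\<lambda>i. a i + n * b i)"
      using that by (auto simp: partition_of_length_le_def partition_def antimono_def intro!: add_mono mult_le_mono2)
    ultimately show ?thesis using that by (simp add: partition_of_length_le_def partition_def)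
  qed
  have pla: "partition (la n)" "\<And>i. i \<ge> r \<Longrightarrow> la n i = 0" for n using comb[OF la, of n] by (simp_all add: la_def[abs_def])
  have pmu: "partition (mu n)" "\<And>i. i \<ge> r \<Longrightarrow> mu n i = 0" for n using comb[OF mu, of n] by (simp_all add: mu_def[abs_def])
  have pnu: "partition (nu n)" "\<And>i. i \<ge> r \<Longrightarrow> nu n i = 0" for n using comb[OF nu, of n] by (simp_all add: nu_def[abs_def])
  obtain c where c: "c \<noteq> 0" "diff_prod (index_pairs r) = of_int c * alternant r (rho r)" by (rule vandermonde)
  define W where "W = {w. w permutes {..<r}}"
  define E where "E p = real_exps (expo r p)" for p
  have count: "lr_count (la n) (mu n) (nu n)
     = lookup (alternant r (\<lambda>i. la n i + rho r i) * schur r (mu n)) (expo r (\<lambda>i. nu n i + rho r i))" for n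
  proof -
    let ?V = "{ka. (\<forall>i\<ge>r. ka i = 0) \<and> lr_count (la n) (mu n) ka \<noteq> 0}"
    have part: "partition ka" if "ka \<in> ?V" for ka
      using that schur_expansion_lr_count[OF pla(1) pmu(1), of n n] by (auto simp: schur_expansion_def)
    have finV: "finite ?V"
      using schur_expansion_lr_count[OF pla(1) pmu(1), of n n] finite_subset[of ?V "{ka. lr_count (la n) (mu n) ka \<noteq> 0}"]
      by (auto simp: schur_expansion_def)
    have "lookup (alternant r (\<lambda>i. la n i + rho r i) * schur r (mu n)) (expo r (\<lambda>i. nu n i + rho r i))
      = (\<Sum>ka\<in>?V. lr_count (la n) (mu n) ka * lookup (alternant r (\<lambda>i. ka i + rho r i)) (expo r (\<lambda>i. nu n i + rho r i)))"
    proof -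
      have "alternant r (\<lambda>i. la n i + rho r i) * schur r (mu n)
        = (\<Sum>ka\<in>?V. of_int (lr_count (la n) (mu n) ka) * alternant r (\<lambda>i. ka i + rho r i))"
        by (rule alternant_lambda_schur[OF pla(1) _ pmu(1)]) (rule pla(2))
      then show ?thesis by (simp only: lookup_sum lookup_of_int_mult)
    qed
    also have "\<dots> = (\<Sum>ka\<in>?V. if ka = nu n then lr_count (la n) (mu n) (nu n) else 0)"
    proof (rule sum.cong[OF refl])
      fix ka assume ka: "ka \<in> ?V"
      have "(\<forall>i<r. ka i + rho r i = nu n i + rho r i) \<longleftrightarrow> ka = nu n"
      proof
        assume a: "\<forall>i<r. ka i + rho r i = nu n i + rho r i"
        show "ka = nu n"
        proof
          fix i show "ka i = nu n i" using a ka pnu(2)[of i n] by (cases "i < r") auto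
        qed
      qed simp
      then show "lr_count (la n) (mu n) ka * lookup (alternant r (\<lambda>i. ka i + rho r i)) (expo r (\<lambda>i. nu n i + rho r i))
        = (if ka = nu n then lr_count (la n) (mu n) (nu n) else 0)"
        using lookup_alt_strict[of r "\<lambda>i. ka i + rho r i" "\<lambda>i. nu n i + rho r i",
            OF strict_rho[OF partitionD(1)[OF part[OF ka]]] strict_rho[OF partitionD(1)[OF pnu(1)]]] by auto
    qed
    also have "\<dots> = (if nu n \<in> ?V then lr_count (la n) (mu n) (nu n) else 0)" using finV by simp
    also have "\<dots> = lr_count (la n) (mu n) (nu n)" using pnu(2)[of _ n] by auto
    finally show ?thesis by simp
  qed
  have prod: "diff_prod (index_pairs r) * (alternant r (\<lambda>i. la n i + rho r i) * schur r (mu n))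
    = of_int c * (\<Sum>w\<in>W. \<Sum>v\<in>W. single (expo r ((\<lambda>i. la n i + rho r i) \<circ> w) + expo r ((\<lambda>i. mu n i + rho r i) \<circ> v)) (sign w * sign v))" for n
  proof -
    have "diff_prod (index_pairs r) * (alternant r (\<lambda>i. la n i + rho r i) * schur r (mu n))
      = of_int c * (alternant r (\<lambda>i. la n i + rho r i) * (alternant r (rho r) * schur r (mu n)))"
      unfolding c(2) by (simp only: mult_ac)
    also have "alternant r (rho r) * schur r (mu n) = alternant r (\<lambda>i. mu n i + rho r i)"
      by (rule alternant_rho_schur[OF pmu(1) pmu(2)])
    finally show ?thesis by (simp add: alternant_def W_def sum_product mult_single)
  qed
  have E_lin: "E (\<lambda>i. p i + n * q i) = E p + real n *\<^sub>R E q" for p q n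
    by (rule poly_mapping_eqI) (simp add: E_def lookup_emb lookup_expo lookup_add lookup_scaleR)
  define u where "u w v = E (la1 \<circ> w) + E (mu1 \<circ> v) - E nu1" for w v
  define z where "z w v = E ((\<lambda>i. la0 i + rho r i) \<circ> w) + E ((\<lambda>i. mu0 i + rho r i) \<circ> v) - E (\<lambda>i. nu0 i + rho r i) - first_sum (index_pairs r)" for w v
  have arg: "real_exps (expo r ((\<lambda>i. la n i + rho r i) \<circ> w) + expo r ((\<lambda>i. mu n i + rho r i) \<circ> v)) - first_sum (index_pairs r)
      - real_exps (expo r (\<lambda>i. nu n i + rho r i)) = real n *\<^sub>R u w v + z w v" for n w v
  proof -
    have 1: "real_exps (expo r ((\<lambda>i. la n i + rho r i) \<circ> w)) = E ((\<lambda>i. la0 i + rho r i) \<circ> w) + real n *\<^sub>R E (la1 \<circ> w)"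
      unfolding E_lin[symmetric] by (simp add: E_def la_def o_def add_ac)
    have 2: "real_exps (expo r ((\<lambda>i. mu n i + rho r i) \<circ> v)) = E ((\<lambda>i. mu0 i + rho r i) \<circ> v) + real n *\<^sub>R E (mu1 \<circ> v)"
      unfolding E_lin[symmetric] by (simp add: E_def mu_def o_def add_ac)
    have 3: "real_exps (expo r (\<lambda>i. nu n i + rho r i)) = E (\<lambda>i. nu0 i + rho r i) + real n *\<^sub>R E nu1"
      unfolding E_lin[symmetric] by (simp add: E_def nu_def o_def add_ac)
    show ?thesis unfolding real_exps_add 1 2 3 u_def z_def by (simp add: algebra_simps)
  qed
  have formula: "real_of_int (lr_count (la n) (mu n) (nu n))
    = real_of_int c * (\<Sum>w\<in>W. \<Sum>v\<in>W. real_of_int (sign w * sign v) * vpf (index_pairs r) pos_root (real n *\<^sub>R u w v + z w v))" for n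
  proof -
    have oi: "(of_int c :: mpoly) = single 0 c" by (metis of_int_eq_id id_apply single_of_int)
    have e0: "real_exps 0 = 0" by (rule poly_mapping_eqI) (simp add: lookup_emb)
    show ?thesis
      unfolding count lookup_by_kostant[OF order_refl[of "index_pairs r"]] prod oi pairing_single_mult e0 add_0_right
        pairing_sum pairing_single arg ..
  qed
  have "ev_poly (\<lambda>n. vpf (index_pairs r) pos_root (real n *\<^sub>R u w v + z w v))" for w v
  proof (rule kostant_ev_poly)
    show "lookup (u w v) i \<in> \<int>" for i
      by (simp add: u_def E_def lookup_emb lookup_add lookup_minus)
    show "keys (u w v) \<subseteq> {..<r}"
      by (auto simp: u_def E_def lookup_emb lookup_expo lookup_add lookup_minus in_keys_iff split: if_splits)
  qed
  then have "ev_poly (\<lambda>n. real_of_int (lr_count (la n) (mu n) (nu n)))"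
    unfolding formula by (intro ev_poly_cmult ev_poly_sum)
  then show ?thesis by (simp add: la_def[abs_def] mu_def[abs_def] nu_def[abs_def])
qed

section \<open>Integer hives\<close>

text \<open>The linear forms of the hive description, indexed by a kind and a position: kinds 1, 2 and 3
  are the three kinds of rhombi, where \<open>j\<close> has been shifted by 1 in the third; kinds 4, 5 and 6
  are the three sides of the border.\<close>

definition hive_form :: "nat \<Rightarrow> nat \<times> nat \<times> nat \<Rightarrow> (nat \<Rightarrow> nat \<Rightarrow> real) \<Rightarrow> real" where
  "hive_form r c h = (case c of (k, i, j) \<Rightarrow>
     if k = 1 then h (i+1) j + h (i+1) (j+1) - h i j - h (i+2) (j+1)
     else if k = 2 then h i j + h (i+1) (j+1) - h (i+1) j - h i (j+1)
     else if k = 3 then h i (j+1) + h (i+1) (j+1) - h (i+1) (j+2) - h i j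
     else if k = 4 then h i 0
     else if k = 5 then h i i
     else h r i)"

definition rhombi :: "nat \<Rightarrow> (nat \<times> nat \<times> nat) set" where
  "rhombi r = {(1, i, j) |i j. j \<le> i \<and> i + 2 \<le> r} \<union> {(2, i, j) |i j. j + 1 \<le> i \<and> i + 1 \<le> r}
     \<union> {(3, i, j) |i j. j + 1 \<le> i \<and> i + 1 \<le> r}"

definition borders :: "nat \<Rightarrow> (nat \<times> nat \<times> nat) set" where
  "borders r = {4, 5, 6} \<times> {..r} \<times> {0}"

text \<open>The size of \<open>la\<close> is written as a sum over \<open>r\<close> parts in order to be additive in \<open>la\<close>.\<close>

definition border_value :: "nat \<Rightarrow> (nat \<Rightarrow> nat) \<Rightarrow> (nat \<Rightarrow> nat) \<Rightarrow> (nat \<Rightarrow> nat) \<Rightarrow> nat \<times> nat \<times> nat \<Rightarrow> real" where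
  "border_value r la mu nu c = (case c of (k, i, j) \<Rightarrow>
     if k = 4 then (\<Sum>l<i. real (la l))
     else if k = 5 then (\<Sum>l<i. real (nu l))
     else (\<Sum>l<r. real (la l)) + (\<Sum>l<i. real (mu l)))"

lemma hive_iff: "hive r h \<longleftrightarrow> (\<forall>c\<in>rhombi r. 0 \<le> hive_form r c h)"
proof
  assume h: "hive r h"
  show "\<forall>c\<in>rhombi r. 0 \<le> hive_form r c h"
  proof
    fix c assume "c \<in> rhombi r"
    then consider i j where "c = (1, i, j)" "j \<le> i" "i + 2 \<le> r" | i j where "c = (2, i, j)" "j + 1 \<le> i" "i + 1 \<le> r"
      | i j where "c = (3, i, j)" "j + 1 \<le> i" "i + 1 \<le> r" unfolding rhombi_def by blast
    then show "0 \<le> hive_form r c h"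
    proof cases
      case 1
      then have "h (i+1) j + h (i+1) (j+1) \<ge> h i j + h (i+2) (j+1)"
        using h unfolding hive_def Let_def by auto
      then show ?thesis by (simp add: hive_form_def 1)
    next
      case 2
      then have "h i j + h (i+1) (j+1) \<ge> h (i+1) j + h i (j+1)"
        using h unfolding hive_def Let_def by auto
      then show ?thesis by (simp add: hive_form_def 2)
    next
      case 3
      have "\<forall>i j. j \<ge> 1 \<and> {(i, j), (i+1, j), (i+1, j+1), (i, j-1)} \<subseteq> {(i, j). j \<le> i \<and> i \<le> r} \<longrightarrow>
        h i j + h (i+1) j \<ge> h (i+1) (j+1) + h i (j-1)"
        using h unfolding hive_def Let_def by blast
      from this[rule_format, of "j+1" i] have "h i (j+1) + h (i+1) (j+1) \<ge> h (i+1) (j+2) + h i j" using 3 by auto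
      then show ?thesis by (simp add: hive_form_def 3)
    qed
  qed
next
  assume a: "\<forall>c\<in>rhombi r. 0 \<le> hive_form r c h"
  have 1: "h (i+1) j + h (i+1) (j+1) \<ge> h i j + h (i+2) (j+1)" if "j \<le> i" "i + 2 \<le> r" for i j
    using bspec[OF a, of "(1, i, j)"] that by (auto simp: rhombi_def hive_form_def)
  have 2: "h i j + h (i+1) (j+1) \<ge> h (i+1) j + h i (j+1)" if "j + 1 \<le> i" "i + 1 \<le> r" for i j
    using bspec[OF a, of "(2, i, j)"] that by (auto simp: rhombi_def hive_form_def)
  have 3: "h i j + h (i+1) j \<ge> h (i+1) (j+1) + h i (j-1)" if "1 \<le> j" "j \<le> i" "i + 1 \<le> r" for i j
    using bspec[OF a, of "(3, i, j - 1)"] that by (auto simp: rhombi_def hive_form_def)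
  show "hive r h" unfolding hive_def Let_def using 1 2 3 by auto
qed

lemma hive_border_iff:
  assumes "\<And>i. i \<ge> r \<Longrightarrow> la i = 0"
  shows "hive_border r la mu nu h \<longleftrightarrow> (\<forall>c\<in>borders r. hive_form r c h = border_value r la mu nu c)"
proof -
  have p: "real (psize la) = (\<Sum>l<r. real (la l))" using psize_eq[of r la] assms by simp
  show ?thesis unfolding hive_border_def borders_def p
    by (auto simp: hive_form_def border_value_def)
qed

definition int_hives :: "nat \<Rightarrow> (nat \<Rightarrow> nat) \<Rightarrow> (nat \<Rightarrow> nat) \<Rightarrow> (nat \<Rightarrow> nat) \<Rightarrow> (nat \<Rightarrow> nat \<Rightarrow> nat) set" where
  "int_hives r la mu nu = {h. (\<forall>i j. \<not> (j \<le> i \<and> i \<le> r) \<longrightarrow> h i j = 0) \<and>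
     hive r (\<lambda>i j. real (h i j)) \<and> hive_border r la mu nu (\<lambda>i j. real (h i j))}"

text \<open>The entry \<open>(k, j)\<close> is \<open>la 0 + \<dots> + la (k - 1)\<close> plus the number of entries less than \<open>k\<close> in the
  first \<open>j\<close> rows of the tableau.\<close>

definition hive_of_gt :: "nat \<Rightarrow> (nat \<Rightarrow> nat) \<Rightarrow> (nat \<Rightarrow> nat \<Rightarrow> nat) \<Rightarrow> nat \<Rightarrow> nat \<Rightarrow> nat" where
  "hive_of_gt r la x k j = (if j \<le> k \<and> k \<le> r then (\<Sum>l<k. la l) + (\<Sum>l<j. x k l) else 0)"

definition gt_of_hive :: "nat \<Rightarrow> (nat \<Rightarrow> nat) \<Rightarrow> (nat \<Rightarrow> nat \<Rightarrow> nat) \<Rightarrow> nat \<Rightarrow> nat \<Rightarrow> nat" where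
  "gt_of_hive r mu h k l = (if k \<le> r then (if l < k then h k (Suc l) - h k l else 0) else mu l)"

lemma lr_tripleD:
  assumes "lr_triple r la mu nu"
  shows "partition la" "partition mu" "partition nu"
    "i \<ge> r \<Longrightarrow> la i = 0" "i \<ge> r \<Longrightarrow> mu i = 0" "i \<ge> r \<Longrightarrow> nu i = 0"
    "(\<Sum>i<r. la i) + (\<Sum>i<r. mu i) = (\<Sum>i<r. nu i)"
proof -
  show "partition la" "partition mu" "partition nu"
    "i \<ge> r \<Longrightarrow> la i = 0" "i \<ge> r \<Longrightarrow> mu i = 0" "i \<ge> r \<Longrightarrow> nu i = 0"
    using assms by (auto simp: lr_triple_def partition_of_length_le_def)
  show "(\<Sum>i<r. la i) + (\<Sum>i<r. mu i) = (\<Sum>i<r. nu i)"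
    using assms psize_eq[of r la] psize_eq[of r mu] psize_eq[of r nu]
    by (auto simp: lr_triple_def partition_of_length_le_def)
qed

lemma rhombiI:
  "j \<le> i \<Longrightarrow> i + 2 \<le> r \<Longrightarrow> (1, i, j) \<in> rhombi r"
  "j + 1 \<le> i \<Longrightarrow> i + 1 \<le> r \<Longrightarrow> (2, i, j) \<in> rhombi r"
  "j + 1 \<le> i \<Longrightarrow> i + 1 \<le> r \<Longrightarrow> (3, i, j) \<in> rhombi r"
  by (auto simp: rhombi_def)

lemma rhombiE:
  assumes "c \<in> rhombi r"
  obtains i j where "c = (1, i, j)" "j \<le> i" "i + 2 \<le> r" | i j where "c = (2, i, j)" "j + 1 \<le> i" "i + 1 \<le> r"
    | i j where "c = (3, i, j)" "j + 1 \<le> i" "i + 1 \<le> r"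
  using assms unfolding rhombi_def by blast

text \<open>Two kinds of rhombi are the interlacing conditions, and the remaining kind is the condition on
  columns.\<close>

lemma hive_form_hive_of_gt:
  assumes x: "x \<in> gt_patterns n mu"
  shows "j \<le> i \<Longrightarrow> i + 2 \<le> r \<Longrightarrow> hive_form r (1, i, j) (\<lambda>i j. real (hive_of_gt r la x i j)) = real_of_int (row_gap la x i j)"
    "j + 1 \<le> i \<Longrightarrow> i + 1 \<le> r \<Longrightarrow> hive_form r (2, i, j) (\<lambda>i j. real (hive_of_gt r la x i j)) = real (x (Suc i) j) - real (x i j)"
    "j + 1 \<le> i \<Longrightarrow> i + 1 \<le> r \<Longrightarrow> hive_form r (3, i, j) (\<lambda>i j. real (hive_of_gt r la x i j)) = real (x i j) - real (x (Suc i) (Suc j))"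
  by (simp_all add: hive_form_def hive_of_gt_def row_gap_def lessThan_Suc_atMost[symmetric] algebra_simps)

lemma hive_of_gt_in:
  assumes t: "lr_triple r la mu nu" and x: "x \<in> lr_patterns r la mu nu"
  shows "hive_of_gt r la x \<in> int_hives r la mu nu"
proof -
  note tD = lr_tripleD[OF t]
  have xg: "x \<in> gt_patterns r mu" and g: "dominant la x" and w: "\<And>k. la k + weight x k = nu k" using x by (auto simp: lr_patterns_def)
  let ?h = "\<lambda>i j. real (hive_of_gt r la x i j)"
  have row: "0 \<le> row_gap la x k i" for k i
    using g dominant_iff_row_gap[OF xg partitionD(1)[OF tD(1)]] by blast
  have "hive r ?h"
    unfolding hive_iff
  proof
    fix c assume "c \<in> rhombi r"
    then show "0 \<le> hive_form r c ?h"
    proof (cases rule: rhombiE)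
      case (1 i j)
      then show ?thesis using hive_form_hive_of_gt(1)[OF xg, of j i r la] row[of i j] by simp
    next
      case (2 i j)
      then show ?thesis using hive_form_hive_of_gt(2)[OF xg, of j i r la] gtD(2)[OF xg, of i j] by simp
    next
      case (3 i j)
      then show ?thesis using hive_form_hive_of_gt(3)[OF xg, of j i r la] gtD(3)[OF xg, of i j] by simp
    qed
  qed
  moreover have "hive_border r la mu nu ?h"
    unfolding hive_border_def
  proof (intro conjI allI impI)
    fix i assume i: "i \<le> r"
    show "?h i 0 = (\<Sum>l<i. real (la l))" using i by (simp add: hive_of_gt_def)
    have "(\<Sum>l<i. nu l) = (\<Sum>l<i. la l) + row_sum x i"
      unfolding w[symmetric] sum.distrib sum_weight[OF xg] ..
    then show "?h i i = (\<Sum>l<i. real (nu l))" using i by (simp add: hive_of_gt_def row_sum_def flip: of_nat_sum of_nat_add)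
    show "?h r i = real (psize la) + (\<Sum>l<i. real (mu l))"
      using i psize_eq[of r la] tD(4) gtD(4)[OF xg, of r] by (simp add: hive_of_gt_def)
  qed
  ultimately show ?thesis by (auto simp: int_hives_def hive_of_gt_def)
qed

lemma gt_of_hive_in:
  assumes t: "lr_triple r la mu nu" and h: "h \<in> int_hives r la mu nu"
  shows "gt_of_hive r mu h \<in> lr_patterns r la mu nu" "hive_of_gt r la (gt_of_hive r mu h) = h"
proof -
  note tD = lr_tripleD[OF t]
  let ?h = "\<lambda>i j. real (h i j)" and ?x = "gt_of_hive r mu h"
  have out: "\<And>i j. \<not> (j \<le> i \<and> i \<le> r) \<Longrightarrow> h i j = 0" and hh: "hive r ?h" and hb: "hive_border r la mu nu ?h"
    using h unfolding int_hives_def by blast+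
  have l0: "0 \<le> hive_form r c ?h" if "c \<in> rhombi r" for c using hh that by (simp add: hive_iff)
  have h1: "?h i j + ?h (i+2) (j+1) \<le> ?h (i+1) j + ?h (i+1) (j+1)" if "j \<le> i" "i + 2 \<le> r" for i j
    using l0[OF rhombiI(1)[OF that]] by (simp add: hive_form_def)
  have h2: "?h (i+1) j + ?h i (j+1) \<le> ?h i j + ?h (i+1) (j+1)" if "j + 1 \<le> i" "i + 1 \<le> r" for i j
    using l0[OF rhombiI(2)[OF that]] by (simp add: hive_form_def)
  have h3: "?h (i+1) (j+2) + ?h i j \<le> ?h i (j+1) + ?h (i+1) (j+1)" if "j + 1 \<le> i" "i + 1 \<le> r" for i j
    using l0[OF rhombiI(3)[OF that]] by (simp add: hive_form_def)
  have b1: "h i 0 = (\<Sum>l<i. la l)" if "i \<le> r" for i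
  proof -
    have "?h i 0 = (\<Sum>l<i. real (la l))" using hb that by (simp add: hive_border_def)
    then show ?thesis by (simp flip: of_nat_sum)
  qed
  have b2: "h i i = (\<Sum>l<i. nu l)" if "i \<le> r" for i
  proof -
    have "?h i i = (\<Sum>l<i. real (nu l))" using hb that by (simp add: hive_border_def)
    then show ?thesis by (simp flip: of_nat_sum)
  qed
  have b3: "h r j = psize la + (\<Sum>l<j. mu l)" if "j \<le> r" for j
  proof -
    have "?h r j = real (psize la) + (\<Sum>l<j. real (mu l))" using hb that by (simp add: hive_border_def)
    then have "?h r j = real (psize la + (\<Sum>l<j. mu l))" by simp
    then show ?thesis by (simp only: of_nat_eq_iff)
  qed
  \<comment> \<open>Differences within a row decrease along diagonals, and those of row \<open>r\<close> are parts of \<open>mu\<close>.\<close>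
  have mono: "\<forall>l<k. h k l \<le> h k (Suc l)" if "k \<le> r" for k
    using that
  proof (induction rule: inc_induct)
    case base
    show ?case using b3 by simp
  next
    case (step k)
    show ?case
    proof (intro allI impI)
      fix l assume l: "l < k"
      then have "h (Suc k) (Suc l) \<le> h (Suc k) (Suc (Suc l))" using step.IH by simp
      then show "h k l \<le> h k (Suc l)" using h3[of l k] l step.hyps by simp
    qed
  qed
  have xr: "real (?x k l) = ?h k (Suc l) - ?h k l" if "k \<le> r" "l < k" for k l
    using mono that by (simp add: gt_of_hive_def of_nat_diff)
  have xz: "?x k l = 0" if "k \<le> r" "k \<le> l" for k l using that by (simp add: gt_of_hive_def)
  have xtop: "?x k = mu" if "r \<le> k" for k
  proof (cases "k = r")
    case True
    show ?thesis
    proof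
      fix l show "?x k l = mu l" using b3 tD(5)[of l] True by (auto simp: gt_of_hive_def)
    qed
  next
    case False
    then show ?thesis using that by (simp add: gt_of_hive_def fun_eq_iff)
  qed
  have mu_anti: "mu (Suc i) \<le> mu i" for i using antimonoD[OF partitionD(1)[OF tD(2)], of i "Suc i"] by simp
  have xg: "?x \<in> gt_patterns r mu"
    unfolding gt_patterns_def mem_Collect_eq
  proof (intro conjI allI impI)
    show "?x 0 i = 0" for i by (simp add: xz)
    show "?x k = mu" if "r \<le> k" for k by (rule xtop[OF that])
    show "?x k i \<le> ?x (Suc k) i" for k i
    proof (cases "r \<le> k")
      case True
      then show ?thesis by (simp add: xtop)
    next
      case False
      show ?thesis
      proof (cases "i < k")
        case True
        have "real (?x k i) \<le> real (?x (Suc k) i)" using h2[of i k] True False by (simp add: xr)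
        then show ?thesis by simp
      next
        case F: False
        then show ?thesis using xz[of k i] False by simp
      qed
    qed
    show "?x (Suc k) (Suc i) \<le> ?x k i" for k i
    proof (cases "r \<le> k")
      case True
      then show ?thesis by (simp add: xtop mu_anti)
    next
      case False
      show ?thesis
      proof (cases "i < k")
        case True
        have "real (?x (Suc k) (Suc i)) \<le> real (?x k i)" using h3[of i k] True False by (simp add: xr)
        then show ?thesis by simp
      next
        case F: False
        then show ?thesis using xz[of "Suc k" "Suc i"] False by simp
      qed
    qed
  qed
  have S: "h k 0 + (\<Sum>l<j. ?x k l) = h k j" if "k \<le> r" "j \<le> k" for k j
    using that(2)
  proof (induction j)
    case (Suc j)
    have "h k j \<le> h k (Suc j)" using mono[OF that(1)] Suc.prems by simp
    then show ?case using Suc that by (simp add: gt_of_hive_def)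
  qed simp
  show hx: "hive_of_gt r la ?x = h"
  proof (intro ext)
    fix k j show "hive_of_gt r la ?x k j = h k j"
      using S[of k j] b1[of k] out[of j k] by (auto simp: hive_of_gt_def)
  qed
  have row: "0 \<le> row_gap la ?x k i" for k i
  proof (cases "k + 2 \<le> r")
    case True
    have le: "0 \<le> row_gap la ?x k i" if "i \<le> k" for i
      using l0[OF rhombiI(1)[OF that True]] hive_form_hive_of_gt(1)[OF xg that True, of la] unfolding hx by simp
    show ?thesis
    proof (cases "i \<le> k")
      case False
      then have i: "Suc k \<le> i" by simp
      have c: "(\<Sum>l<m. ?x j l) = (\<Sum>l<j. ?x j l)" if "j \<le> m" for j m
        using gt_zero[OF xg, of j] that by (intro sum.mono_neutral_right) auto
      have "?x (Suc k) i = 0" using gt_zero[OF xg i] .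
      moreover have "?x (Suc (Suc k)) (Suc k) \<le> ?x (Suc k) k" by (rule gtD(3)[OF xg])
      ultimately have "row_gap la ?x k k \<le> row_gap la ?x k i"
        unfolding row_gap_def lessThan_Suc_atMost[symmetric]
        using c[of "Suc k" i] c[of "Suc (Suc k)" "Suc i"] c[of k i] i by simp
      then show ?thesis using le[of k] by simp
    qed (rule le)
  next
    case False
    then have e: "?x (Suc k) = mu" "?x (Suc (Suc k)) = mu" "la (Suc k) = 0" using xtop tD(4) by auto
    have "(\<Sum>l<i. ?x k l) \<le> (\<Sum>l<i. ?x (Suc k) l)" by (intro sum_mono gtD(2)[OF xg])
    then show ?thesis unfolding row_gap_def lessThan_Suc_atMost[symmetric] e by (simp flip: of_nat_sum)
  qed
  have "la k + weight ?x k = nu k" for k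
  proof (cases "k < r")
    case True
    have 1: "(\<Sum>l<k. la l) + row_sum ?x k = (\<Sum>l<k. nu l)"
      using S[of k k] b1[of k] b2[of k] True by (simp add: row_sum_def)
    have 2: "(\<Sum>l<Suc k. la l) + row_sum ?x (Suc k) = (\<Sum>l<Suc k. nu l)"
      using S[of "Suc k" "Suc k"] b1[of "Suc k"] b2[of "Suc k"] True unfolding row_sum_def by simp
    show ?thesis using 1 2 weight_add[OF xg, of k] by simp
  next
    case False
    then show ?thesis using tD(4,6)[of k] weight_outside[OF xg, of k] by simp
  qed
  then show "?x \<in> lr_patterns r la mu nu"
    using xg row dominant_iff_row_gap[OF xg partitionD(1)[OF tD(1)]] by (auto simp: lr_patterns_def)
qed

text \<open>Partial sums of the rows turn patterns into hives, and differences turn hives into patterns.\<close>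

theorem lr_count_hives:
  assumes t: "lr_triple r la mu nu"
  shows "lr_count la mu nu = int (card (int_hives r la mu nu))"
proof -
  note tD = lr_tripleD[OF t]
  have "bij_betw (hive_of_gt r la) (lr_patterns r la mu nu) (int_hives r la mu nu)"
  proof (rule bij_betw_byWitness[where f' = "gt_of_hive r mu"])
    show "\<forall>x\<in>lr_patterns r la mu nu. gt_of_hive r mu (hive_of_gt r la x) = x"
    proof (intro ballI ext)
      fix x k l assume "x \<in> lr_patterns r la mu nu"
      then have x: "x \<in> gt_patterns r mu" by (simp add: lr_patterns_def)
      show "gt_of_hive r mu (hive_of_gt r la x) k l = x k l"
        using gtD(4)[OF x, of k] gt_zero[OF x, of k l] by (auto simp: gt_of_hive_def hive_of_gt_def)
    qed
  qed (use gt_of_hive_in[OF t] hive_of_gt_in[OF t] in auto)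
  then have "card (lr_patterns r la mu nu) = card (int_hives r la mu nu)" by (rule bij_betw_same_card)
  moreover have "lr_count la mu nu = int (card (lr_patterns r la mu nu))"
    by (rule lr_count_eq[OF tD(1,2)]) (rule tD(6))
  ultimately show ?thesis by simp
qed

section \<open>Hives as solutions of a linear system\<close>

definition array :: "nat \<Rightarrow> (nat \<times> nat \<times> nat) set" where
  "array r = {(0, i, j) |i j. j \<le> i \<and> i \<le> r}"

definition unit_array :: "nat \<times> nat \<Rightarrow> nat \<Rightarrow> nat \<Rightarrow> real" where
  "unit_array p i j = (if p = (i, j) then 1 else 0)"

text \<open>Index \<open>(0, i, j)\<close> stands for the hive entry at \<open>(i, j)\<close>, the index of a rhombus for the slack
  of its inequality.\<close>

definition hive_index :: "nat \<Rightarrow> (nat \<times> nat \<times> nat) set" where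
  "hive_index r = array r \<union> rhombi r"

text \<open>The columns of the linear system whose rows are the border values and, for each rhombus, the
  equation between its slack and its form.\<close>

definition hive_gen :: "nat \<Rightarrow> nat \<times> nat \<times> nat \<Rightarrow> (nat \<times> nat \<times> nat \<Rightarrow>\<^sub>0 real)" where
  "hive_gen r q = (if fst q = 0 then
      (\<Sum>c\<in>borders r. single c (hive_form r c (unit_array (snd q)))) -
      (\<Sum>c\<in>rhombi r. single c (hive_form r c (unit_array (snd q))))
    else single q 1)"

definition hive_target :: "nat \<Rightarrow> (nat \<Rightarrow> nat) \<Rightarrow> (nat \<Rightarrow> nat) \<Rightarrow> (nat \<Rightarrow> nat) \<Rightarrow> (nat \<times> nat \<times> nat \<Rightarrow>\<^sub>0 real)" where
  "hive_target r la mu nu = (\<Sum>c\<in>borders r. single c (border_value r la mu nu c))"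

lemma finite_array: "finite (array r)"
  by (rule finite_subset[of _ "{0} \<times> {..r} \<times> {..r}"]) (auto simp: array_def)

lemma finite_rhombi: "finite (rhombi r)"
  by (rule finite_subset[of _ "{1,2,3} \<times> {..r} \<times> {..r}"]) (auto simp: rhombi_def)

lemma finite_borders: "finite (borders r)"
  by (auto simp: borders_def)

lemma finite_hive_index: "finite (hive_index r)"
  by (simp add: hive_index_def finite_array finite_rhombi)

lemma array_kind: "q \<in> array r \<Longrightarrow> fst q = 0" by (auto simp: array_def)
lemma rhombi_kind: "q \<in> rhombi r \<Longrightarrow> fst q \<in> {1, 2, 3}" by (auto simp: rhombi_def)
lemma kinds_disjoint: "q \<in> rhombi r \<Longrightarrow> q \<notin> array r" "q \<in> borders r \<Longrightarrow> q \<notin> rhombi r"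
  by (auto simp: array_def rhombi_def borders_def)

lemma lookup_sum_single:
  assumes "finite A"
  shows "lookup (\<Sum>c\<in>A. single c (g c)) e = (if e \<in> A then g e else 0)"
proof -
  have "lookup (\<Sum>c\<in>A. single c (g c)) e = (\<Sum>c\<in>A. if c = e then g c else 0)"
    unfolding lookup_sum by (rule sum.cong) (auto simp: lookup_single when_def)
  then show ?thesis using assms by simp
qed

lemma array_expand:
  assumes "\<And>i j. \<not> (j \<le> i \<and> i \<le> r) \<Longrightarrow> h i j = (0::real)"
  shows "h i j = (\<Sum>q\<in>array r. h (fst (snd q)) (snd (snd q)) * unit_array (snd q) i j)"
proof -
  have "(\<Sum>q\<in>array r. h (fst (snd q)) (snd (snd q)) * unit_array (snd q) i j) = (\<Sum>q\<in>array r. if q = (0, i, j) then h i j else 0)"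
    by (rule sum.cong) (auto simp: unit_array_def array_def)
  also have "\<dots> = (if (0, i, j) \<in> array r then h i j else 0)" using finite_array by simp
  also have "\<dots> = h i j" using assms[of j i] by (auto simp: array_def)
  finally show ?thesis by simp
qed

lemma hive_form_expand:
  assumes "\<And>i j. \<not> (j \<le> i \<and> i \<le> r) \<Longrightarrow> h i j = (0::real)"
  shows "hive_form r c h = (\<Sum>q\<in>array r. h (fst (snd q)) (snd (snd q)) * hive_form r c (unit_array (snd q)))"
proof -
  note e = array_expand[of r h, OF assms]
  obtain k i j where c: "c = (k, i, j)" by (cases c)
  have "hive_form r c h = hive_form r c (\<lambda>i j. \<Sum>q\<in>array r. h (fst (snd q)) (snd (snd q)) * unit_array (snd q) i j)"
    by (rule arg_cong[where f = "hive_form r c"]) (intro ext e)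
  also have "\<dots> = (\<Sum>q\<in>array r. h (fst (snd q)) (snd (snd q)) * hive_form r c (unit_array (snd q)))"
    unfolding hive_form_def c by (simp add: sum.distrib sum_subtractf algebra_simps)
  finally show ?thesis .
qed

definition values_of :: "nat \<Rightarrow> (nat \<times> nat \<times> nat \<Rightarrow> nat) \<Rightarrow> nat \<Rightarrow> nat \<Rightarrow> nat" where
  "values_of r f i j = (if j \<le> i \<and> i \<le> r then f (0, i, j) else 0)"

lemma lookup_hive_sum:
  fixes f :: "nat \<times> nat \<times> nat \<Rightarrow> nat"
  shows "lookup (\<Sum>q\<in>hive_index r. real (f q) *\<^sub>R hive_gen r q) c =
    (if c \<in> borders r then hive_form r c (\<lambda>i j. real (values_of r f i j))
     else if c \<in> rhombi r then real (f c) - hive_form r c (\<lambda>i j. real (values_of r f i j)) else 0)"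
proof -
  let ?h = "\<lambda>i j. real (values_of r f i j)"
  have dis: "array r \<inter> rhombi r = {}" "c \<in> borders r \<Longrightarrow> c \<notin> rhombi r"
    using kinds_disjoint by blast+
  have hive_form: "hive_form r c ?h = (\<Sum>q\<in>array r. real (f q) * hive_form r c (unit_array (snd q)))" for c
  proof -
    have "hive_form r c ?h = (\<Sum>q\<in>array r. ?h (fst (snd q)) (snd (snd q)) * hive_form r c (unit_array (snd q)))"
      by (rule hive_form_expand) (auto simp: values_of_def)
    also have "\<dots> = (\<Sum>q\<in>array r. real (f q) * hive_form r c (unit_array (snd q)))"
      by (rule sum.cong) (auto simp: array_def values_of_def)
    finally show ?thesis .
  qed
  have "lookup (\<Sum>q\<in>hive_index r. real (f q) *\<^sub>R hive_gen r q) c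
     = (\<Sum>q\<in>array r. real (f q) * lookup (hive_gen r q) c) + (\<Sum>q\<in>rhombi r. real (f q) * lookup (hive_gen r q) c)"
    unfolding hive_index_def
    by (subst sum.union_disjoint) (auto simp: finite_array finite_rhombi dis lookup_add lookup_sum lookup_scaleR)
  also have "(\<Sum>q\<in>array r. real (f q) * lookup (hive_gen r q) c)
     = (\<Sum>q\<in>array r. real (f q) * ((if c \<in> borders r then hive_form r c (unit_array (snd q)) else 0) - (if c \<in> rhombi r then hive_form r c (unit_array (snd q)) else 0)))"
    by (rule sum.cong) (auto simp: hive_gen_def array_kind lookup_minus lookup_sum_single finite_borders finite_rhombi)
  also have "(\<Sum>q\<in>rhombi r. real (f q) * lookup (hive_gen r q) c) = (\<Sum>q\<in>rhombi r. if q = c then real (f c) else 0)"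
  proof (rule sum.cong[OF refl])
    fix q assume "q \<in> rhombi r"
    then have "fst q \<noteq> 0" using rhombi_kind by fastforce
    then show "real (f q) * lookup (hive_gen r q) c = (if q = c then real (f c) else 0)"
      by (simp add: hive_gen_def lookup_single when_def)
  qed
  also have "\<dots> = (if c \<in> rhombi r then real (f c) else 0)" using finite_rhombi by simp
  finally show ?thesis using dis(2) by (auto simp: hive_form sum_negf)
qed

lemma vpf_sols_hive_iff:
  assumes la: "\<And>i. i \<ge> r \<Longrightarrow> la i = 0"
  shows "f \<in> vpf_sols (hive_index r) (hive_gen r) (hive_target r la mu nu) \<longleftrightarrow>
    (\<forall>q. q \<notin> hive_index r \<longrightarrow> f q = 0) \<and> hive_border r la mu nu (\<lambda>i j. real (values_of r f i j)) \<and>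
    (\<forall>c\<in>rhombi r. real (f c) = hive_form r c (\<lambda>i j. real (values_of r f i j)))"
proof -
  let ?h = "\<lambda>i j. real (values_of r f i j)"
  have dis: "c \<in> borders r \<Longrightarrow> c \<notin> rhombi r" for c by (rule kinds_disjoint)
  have "(\<Sum>q\<in>hive_index r. real (f q) *\<^sub>R hive_gen r q) = hive_target r la mu nu \<longleftrightarrow>
    (\<forall>c. lookup (\<Sum>q\<in>hive_index r. real (f q) *\<^sub>R hive_gen r q) c = lookup (hive_target r la mu nu) c)"
    by (simp only: poly_mapping_eq_iff fun_eq_iff)
  also have "\<dots> \<longleftrightarrow> (\<forall>c\<in>borders r. hive_form r c ?h = border_value r la mu nu c) \<and> (\<forall>c\<in>rhombi r. real (f c) = hive_form r c ?h)"
    unfolding lookup_hive_sum hive_target_def lookup_sum_single[OF finite_borders]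
  proof (intro iffI conjI ballI allI)
    fix c
    assume a: "\<forall>c. (if c \<in> borders r then hive_form r c ?h else if c \<in> rhombi r then real (f c) - hive_form r c ?h else 0)
      = (if c \<in> borders r then border_value r la mu nu c else 0)"
    show "hive_form r c ?h = border_value r la mu nu c" if "c \<in> borders r" using a[rule_format, of c] that by simp
    show "real (f c) = hive_form r c ?h" if "c \<in> rhombi r" using a[rule_format, of c] that dis[of c] by (cases "c \<in> borders r") auto
  next
    fix c
    assume "(\<forall>c\<in>borders r. hive_form r c ?h = border_value r la mu nu c) \<and> (\<forall>c\<in>rhombi r. real (f c) = hive_form r c ?h)"
    then show "(if c \<in> borders r then hive_form r c ?h else if c \<in> rhombi r then real (f c) - hive_form r c ?h else 0)
      = (if c \<in> borders r then border_value r la mu nu c else 0)" by simp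
  qed
  also have "(\<forall>c\<in>borders r. hive_form r c ?h = border_value r la mu nu c) \<longleftrightarrow> hive_border r la mu nu ?h"
    by (rule hive_border_iff[symmetric]) (rule la)
  finally show ?thesis unfolding vpf_sols_def by simp
qed

text \<open>The slacks are determined by the hive; they are natural numbers because the rhombus
  inequalities hold.\<close>

lemma vpf_hives:
  assumes la: "\<And>i. i \<ge> r \<Longrightarrow> la i = 0"
  shows "vpf (hive_index r) (hive_gen r) (hive_target r la mu nu) = real (card (int_hives r la mu nu))"
proof -
  let ?V = "vpf_sols (hive_index r) (hive_gen r) (hive_target r la mu nu)"
  have iff: "f \<in> ?V \<longleftrightarrow>
    (\<forall>q. q \<notin> hive_index r \<longrightarrow> f q = 0) \<and> hive_border r la mu nu (\<lambda>i j. real (values_of r f i j)) \<and>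
    (\<forall>c\<in>rhombi r. real (f c) = hive_form r c (\<lambda>i j. real (values_of r f i j)))" for f
    by (rule vpf_sols_hive_iff) (rule la)
  define with_slacks :: "(nat \<Rightarrow> nat \<Rightarrow> nat) \<Rightarrow> nat \<times> nat \<times> nat \<Rightarrow> nat" where
    "with_slacks h q = (if q \<in> array r then h (fst (snd q)) (snd (snd q)) else if q \<in> rhombi r then nat \<lfloor>hive_form r q (\<lambda>i j. real (h i j))\<rfloor> else 0)" for h q
  have dis: "q \<in> rhombi r \<Longrightarrow> q \<notin> array r" for q by (rule kinds_disjoint)
  have isint: "\<exists>z::int. hive_form r q (\<lambda>i j. real (h i j)) = of_int z" for q and h :: "nat \<Rightarrow> nat \<Rightarrow> nat"
  proof -
    have "hive_form r q (\<lambda>i j. real (h i j)) \<in> \<int>" by (auto simp: hive_form_def split: prod.split)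
    then show ?thesis by (auto elim: Ints_cases)
  qed
  have "bij_betw (values_of r) ?V (int_hives r la mu nu)"
  proof (rule bij_betw_byWitness[where f' = with_slacks])
    show "values_of r ` ?V \<subseteq> int_hives r la mu nu"
    proof
      fix h assume "h \<in> values_of r ` ?V"
      then obtain f where f: "f \<in> ?V" and h: "h = values_of r f" by blast
      have "hive r (\<lambda>i j. real (h i j))"
        unfolding hive_iff
      proof
        fix c assume "c \<in> rhombi r"
        then have "real (f c) = hive_form r c (\<lambda>i j. real (h i j))" using f h iff by blast
        then show "0 \<le> hive_form r c (\<lambda>i j. real (h i j))" by (metis of_nat_0_le_iff)
      qed
      then show "h \<in> int_hives r la mu nu" using f h iff by (auto simp: int_hives_def values_of_def)
    qed
    have vb: "values_of r (with_slacks h) = h" if "h \<in> int_hives r la mu nu" for h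
    proof (intro ext)
      fix i j show "values_of r (with_slacks h) i j = h i j"
        using that by (auto simp: values_of_def with_slacks_def array_def int_hives_def)
    qed
    then show "\<forall>h\<in>int_hives r la mu nu. values_of r (with_slacks h) = h" by blast
    show "with_slacks ` int_hives r la mu nu \<subseteq> ?V"
    proof
      fix f assume "f \<in> with_slacks ` int_hives r la mu nu"
      then obtain h where h: "h \<in> int_hives r la mu nu" and f: "f = with_slacks h" by blast
      have "real (with_slacks h c) = hive_form r c (\<lambda>i j. real (h i j))" if c: "c \<in> rhombi r" for c
      proof -
        obtain z where z: "hive_form r c (\<lambda>i j. real (h i j)) = real_of_int z" using isint by blast
        have "0 \<le> hive_form r c (\<lambda>i j. real (h i j))" using h c by (simp add: int_hives_def hive_iff)
        then show ?thesis using c dis[OF c] by (simp add: with_slacks_def z)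
      qed
      then show "f \<in> ?V" unfolding iff f vb[OF h] using h
        by (auto simp: hive_index_def with_slacks_def int_hives_def)
    qed
    show "\<forall>f\<in>?V. with_slacks (values_of r f) = f"
    proof (intro ballI ext)
      fix f q assume f: "f \<in> ?V"
      show "with_slacks (values_of r f) q = f q"
      proof (cases "q \<in> array r")
        case True
        then show ?thesis by (auto simp: with_slacks_def array_def values_of_def)
      next
        case False
        show ?thesis
        proof (cases "q \<in> rhombi r")
          case True
          then have "real (f q) = hive_form r q (\<lambda>i j. real (values_of r f i j))" using f iff by blast
          then show ?thesis using True False by (simp add: with_slacks_def flip: \<open>real (f q) = _\<close>)
        next
          case F: False
          then have "q \<notin> hive_index r" using False by (simp add: hive_index_def)
          then have "f q = 0" using f unfolding iff by blast
          then show ?thesis using False F by (simp add: with_slacks_def)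
        qed
      qed
    qed
  qed
  then show ?thesis unfolding vpf_def by (simp add: bij_betw_same_card)
qed

text \<open>The second kind of rhombi bounds \<open>h k (l + 1) - h k l\<close> by the same difference in row \<open>k + 1\<close>,
  and so on up to row \<open>r\<close>, with an error that depends on the right-hand side \<open>v\<close> only. Hence
  hive entries, and then slacks, are bounded.\<close>

lemma finite_vsol_hive: "finite (vpf_sols (hive_index r) (hive_gen r) v)"
proof -
  define V where "V = (\<Sum>c\<in>borders r \<union> rhombi r. \<bar>lookup v c\<bar>)"
  have fin: "finite (borders r \<union> rhombi r)" by (simp add: finite_borders finite_rhombi)
  have V: "\<bar>lookup v c\<bar> \<le> V" if "c \<in> borders r \<union> rhombi r" for c
    unfolding V_def using fin that by (intro member_le_sum) auto
  have V0: "0 \<le> V" unfolding V_def by (simp add: sum_nonneg)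
  define B where "B = V + real (r + 1) * (real (r + 1) * V)"
  have B0: "0 \<le> B" using V0 by (simp add: B_def)
  have dis: "c \<in> borders r \<Longrightarrow> c \<notin> rhombi r" for c by (rule kinds_disjoint)
  show ?thesis
  proof (rule finite_subset[OF _ finite_subset[OF _ finite_set_of_finite_funs[of "hive_index r" "{..nat \<lceil>V + 4 * B\<rceil>}" 0]]])
    show "vpf_sols (hive_index r) (hive_gen r) v \<subseteq> {f. \<forall>q. (q \<in> hive_index r \<longrightarrow> f q \<in> {..nat \<lceil>V + 4 * B\<rceil>}) \<and> (q \<notin> hive_index r \<longrightarrow> f q = 0)}"
    proof
      fix f assume f: "f \<in> vpf_sols (hive_index r) (hive_gen r) v"
      let ?h = "\<lambda>i j. real (values_of r f i j)"
      have eq: "lookup v c = (if c \<in> borders r then hive_form r c ?h else if c \<in> rhombi r then real (f c) - hive_form r c ?h else 0)" for c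
        using f lookup_hive_sum[of f r c] by (simp add: vpf_sols_def)
      have b4: "?h i 0 \<le> V" if "i \<le> r" for i
        using V[of "(4, i, 0)"] eq[of "(4, i, 0)"] that by (simp add: borders_def hive_form_def)
      have b6: "?h r j \<le> V" if "j \<le> r" for j
        using V[of "(6, j, 0)"] eq[of "(6, j, 0)"] that by (simp add: borders_def hive_form_def)
      have d: "\<forall>l<k. ?h k (Suc l) - ?h k l \<le> V + real (r - k) * V" if "k \<le> r" for k
        using that
      proof (induction rule: inc_induct)
        case base
        show ?case
        proof (intro allI impI)
          fix l assume "l < r"
          then have "?h r (Suc l) \<le> V" using b6 by simp
          moreover have "0 \<le> ?h r l" "real (r - r) * V = 0" by simp_all
          ultimately show "?h r (Suc l) - ?h r l \<le> V + real (r - r) * V" by linarith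
        qed
      next
        case (step k)
        show ?case
        proof (intro allI impI)
          fix l assume l: "l < k"
          have c: "(2, k, l) \<in> rhombi r" using l step.hyps by (intro rhombiI) auto
          have "(2, k, l) \<notin> borders r" using c dis by blast
          then have "real (f (2, k, l)) - hive_form r (2, k, l) ?h \<le> V"
            using V[of "(2, k, l)"] eq[of "(2, k, l)"] c by auto
          then have "?h k (Suc l) - ?h k l \<le> ?h (Suc k) (Suc l) - ?h (Suc k) l + V"
            using of_nat_0_le_iff[of "f (2, k, l)", where 'a = real] by (simp add: hive_form_def)
          moreover have "?h (Suc k) (Suc l) - ?h (Suc k) l \<le> V + real (r - Suc k) * V" using step.IH l by simp
          moreover have "real (r - k) * V = real (r - Suc k) * V + V"
          proof -
            have "r - k = Suc (r - Suc k)" using step.hyps by simp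
            then show ?thesis by (simp only: of_nat_Suc distrib_right mult_1)
          qed
          ultimately show "?h k (Suc l) - ?h k l \<le> V + real (r - k) * V" by linarith
        qed
      qed
      have d': "?h k (Suc l) - ?h k l \<le> real (r + 1) * V" if "k \<le> r" "l < k" for k l
      proof -
        have "real (r - k) * V \<le> real r * V" using V0 by (intro mult_right_mono) auto
        then show ?thesis using d[OF that(1), rule_format, OF that(2)] by (simp add: algebra_simps)
      qed
      have hb': "?h k j \<le> V + real j * (real (r + 1) * V)" if "k \<le> r" "j \<le> k" for k j
        using that(2)
      proof (induction j)
        case 0
        then show ?case using b4[OF that(1)] by simp
      next
        case (Suc j)
        then show ?case using d'[OF that(1), of j] by (simp add: algebra_simps)
      qed
      have hB: "?h k j \<le> B" for k j
      proof (cases "j \<le> k \<and> k \<le> r")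
        case True
        have "real j * (real (r + 1) * V) \<le> real (r + 1) * (real (r + 1) * V)"
          using True V0 by (intro mult_right_mono) auto
        then show ?thesis using hb'[of k j] True unfolding B_def by linarith
      next
        case False
        then show ?thesis using B0 by (auto simp: values_of_def)
      qed
      have "real (f q) \<le> V + 4 * B" if q: "q \<in> hive_index r" for q
      proof (cases "q \<in> array r")
        case True
        then obtain i j where "q = (0, i, j)" "j \<le> i" "i \<le> r" by (auto simp: array_def)
        then show ?thesis using hB[of i j] V0 B0 by (simp add: values_of_def)
      next
        case False
        then have c: "q \<in> rhombi r" using q by (simp add: hive_index_def)
        then have "q \<notin> borders r" using dis by blast
        then have "real (f q) - hive_form r q ?h \<le> V"
          using V[of q] eq[of q] c by auto
        moreover have "hive_form r q ?h \<le> 4 * B"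
        proof -
          obtain k i j where qe: "q = (k, i, j)" by (cases q)
          have n: "0 \<le> ?h i j" for i j by simp
          show ?thesis unfolding hive_form_def qe prod.case
            using hB[of "i+1" j] hB[of "i+1" "j+1"] hB[of i j] hB[of i "j+1"] hB[of i 0] hB[of i i] hB[of r i]
              n[of i j] n[of "i+2" "j+1"] n[of "i+1" j] n[of i "j+1"] n[of "i+1" "j+2"] B0
            by (smt (verit))
        qed
        ultimately show ?thesis by linarith
      qed
      then have "f q \<le> nat \<lceil>V + 4 * B\<rceil>" if "q \<in> hive_index r" for q
        using that by (metis of_nat_le_iff order_trans real_nat_ceiling_ge)
      then show "f \<in> {f. \<forall>q. (q \<in> hive_index r \<longrightarrow> f q \<in> {..nat \<lceil>V + 4 * B\<rceil>}) \<and> (q \<notin> hive_index r \<longrightarrow> f q = 0)}"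
        using f by (auto simp: vpf_sols_def)
    qed
  qed (use finite_hive_index in auto)
qed

lemma hive_target_combination:
  "hive_target r (\<lambda>i. a * la i + b * la' i) (\<lambda>i. a * mu i + b * mu' i) (\<lambda>i. a * nu i + b * nu' i)
    = real a *\<^sub>R hive_target r la mu nu + real b *\<^sub>R hive_target r la' mu' nu'"
proof (rule poly_mapping_eqI)
  fix c
  have "border_value r (\<lambda>i. a * la i + b * la' i) (\<lambda>i. a * mu i + b * mu' i) (\<lambda>i. a * nu i + b * nu' i) c
    = real a * border_value r la mu nu c + real b * border_value r la' mu' nu' c"
    by (cases c) (simp add: border_value_def sum.distrib sum_distrib_left algebra_simps)
  then show "lookup (hive_target r (\<lambda>i. a * la i + b * la' i) (\<lambda>i. a * mu i + b * mu' i) (\<lambda>i. a * nu i + b * nu' i)) c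
    = lookup (real a *\<^sub>R hive_target r la mu nu + real b *\<^sub>R hive_target r la' mu' nu') c"
    by (simp add: hive_target_def lookup_sum_single[OF finite_borders] lookup_add lookup_scaleR)
qed

section \<open>Full-dimensional hive polytopes\<close>

lemma finite_interior: "finite (interior_indices r)"
  by (rule finite_subset[of _ "{..<r} \<times> {..<r}"]) (auto simp: interior_indices_def)

text \<open>Changing a single interior entry of a strict hive by a small amount \<open>eps\<close> gives a hive with
  the same border; so the differences of hives contain a multiple of each unit vector.\<close>

lemma full_dimensional:
  assumes strict: "\<And>c. c \<in> rhombi r \<Longrightarrow> 0 < hive_form r c h" and border: "hive_border r la mu nu h"
  shows "affine_dim (hive_polytope r la mu nu) = int ((r - 1) choose 2)"
proof -
  let ?P = "hive_polytope r la mu nu"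
  let ?I = "interior_indices r"
  let ?e = "\<lambda>p::nat \<times> nat. single p (1::real)"
  define vec :: "(nat \<Rightarrow> nat \<Rightarrow> real) \<Rightarrow> (nat \<times> nat) \<Rightarrow>\<^sub>0 real" where
    "vec g = (\<Sum>p\<in>?I. single p (g (fst p) (snd p)))" for g
  have lv: "lookup (vec g) p = (if p \<in> ?I then g (fst p) (snd p) else 0)" for g p
    unfolding vec_def by (rule lookup_sum_single[OF finite_interior])
  have vecP: "vec g \<in> ?P" if "hive r g" "hive_border r la mu nu g" for g
    unfolding hive_polytope_def using that
    by (auto simp: in_keys_iff lv split: if_splits intro!: exI[of _ g])
  define m where "m = Min (insert 1 ((\<lambda>c. hive_form r c h) ` rhombi r))"
  have m0: "0 < m" unfolding m_def using strict finite_rhombi by (subst Min_gr_iff) auto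
  have mle: "m \<le> hive_form r c h" if "c \<in> rhombi r" for c
    unfolding m_def using finite_rhombi that by (intro Min_le) auto
  \<comment> \<open>A rhombus form has four coefficients of absolute value at most 1.\<close>
  define eps where "eps = m / 4"
  have eps0: "0 < eps" using m0 by (simp add: eps_def)
  have hh: "hive r h" using strict by (auto simp: hive_iff intro: less_imp_le)
  have pert: "hive r (\<lambda>i j. h i j + eps * unit_array p i j) \<and> hive_border r la mu nu (\<lambda>i j. h i j + eps * unit_array p i j)"
    if p: "p \<in> ?I" for p
  proof
    have u: "0 \<le> unit_array p i j \<and> unit_array p i j \<le> 1" for i j by (simp add: unit_array_def)
    have "hive_form r c (\<lambda>i j. h i j + eps * unit_array p i j) = hive_form r c h + eps * hive_form r c (unit_array p)" for c
      by (cases c) (simp add: hive_form_def algebra_simps)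
    moreover have "-4 \<le> hive_form r c (unit_array p)" for c
    proof -
      obtain k i j where c: "c = (k, i, j)" by (cases c)
      show ?thesis unfolding hive_form_def c prod.case
        using u[of i j] u[of "i+1" j] u[of "i+1" "j+1"] u[of "i+2" "j+1"] u[of i "j+1"] u[of "i+1" "j+2"]
          u[of i 0] u[of i i] u[of r i] by (smt (verit))
    qed
    then have "- m \<le> eps * hive_form r c (unit_array p)" for c
      using mult_left_mono[of "-4" "hive_form r c (unit_array p)" eps] eps0 by (simp add: eps_def)
    ultimately show "hive r (\<lambda>i j. h i j + eps * unit_array p i j)"
      unfolding hive_iff using mle by (smt (verit))
    obtain a b where ab: "p = (a, b)" "0 < b" "b < a" "a < r" using p by (auto simp: interior_indices_def)
    show "hive_border r la mu nu (\<lambda>i j. h i j + eps * unit_array p i j)"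
      using border ab unfolding hive_border_def unit_array_def by auto
  qed
  let ?D = "{x - y |x y. x \<in> ?P \<and> y \<in> ?P}"
  let ?B = "(\<lambda>p. eps *\<^sub>R ?e p) ` ?I"
  have ne: "?P \<noteq> {}" using vecP[OF hh border] by blast
  have BD: "?B \<subseteq> ?D"
  proof
    fix v assume "v \<in> ?B"
    then obtain p where p: "p \<in> ?I" "v = eps *\<^sub>R ?e p" by blast
    have "v = vec (\<lambda>i j. h i j + eps * unit_array p i j) - vec h"
      by (rule poly_mapping_eqI)
         (auto simp: p lookup_minus lv lookup_scaleR lookup_single when_def unit_array_def prod_eq_iff)
    then show "v \<in> ?D" using vecP[of "\<lambda>i j. h i j + eps * unit_array p i j"] pert[OF p(1)] vecP[OF hh border] by blast
  qed
  have inj: "inj_on (\<lambda>p. eps *\<^sub>R ?e p) ?I"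
  proof (rule inj_onI)
    fix p q assume "eps *\<^sub>R ?e p = eps *\<^sub>R ?e q"
    then have "?e p = ?e q" using eps0 by simp
    then show "p = q" by (metis lookup_single_eq lookup_single_not_eq zero_neq_one)
  qed
  have keys: "keys x \<subseteq> ?I" if "x \<in> ?P" for x using that by (simp add: hive_polytope_def)
  have DB: "?D \<subseteq> span ?B"
  proof
    fix v assume "v \<in> ?D"
    then obtain x y where xy: "x \<in> ?P" "y \<in> ?P" "v = x - y" by blast
    have "v = (\<Sum>p\<in>?I. (lookup v p / eps) *\<^sub>R (eps *\<^sub>R ?e p))"
    proof (rule poly_mapping_eqI)
      fix q
      have "lookup (\<Sum>p\<in>?I. (lookup v p / eps) *\<^sub>R (eps *\<^sub>R ?e p)) q = (\<Sum>p\<in>?I. if p = q then lookup v q else 0)"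
        unfolding lookup_sum by (rule sum.cong) (use eps0 in \<open>auto simp: lookup_scaleR lookup_single when_def\<close>)
      also have "\<dots> = (if q \<in> ?I then lookup v q else 0)" using finite_interior by simp
      also have "\<dots> = lookup v q"
      proof (cases "q \<in> ?I")
        case False
        then have "q \<notin> keys x" "q \<notin> keys y"
          using keys[OF xy(1)] keys[OF xy(2)] by blast+
        then have "lookup x q = 0" "lookup y q = 0"
          by (simp_all only: not_in_keys_iff_lookup_eq_zero)
        then show ?thesis by (simp add: xy(3) lookup_minus)
      qed simp
      finally show "lookup v q = lookup (\<Sum>p\<in>?I. (lookup v p / eps) *\<^sub>R (eps *\<^sub>R ?e p)) q" by simp
    qed
    also have "\<dots> \<in> span ?B" by (intro span_sum span_scale span_base) auto
    finally show "v \<in> span ?B" .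
  qed
  have ind: "independent ?B"
  proof (rule independent_if_scalars_zero)
    show "finite ?B" using finite_interior by simp
    fix f x assume s: "(\<Sum>x\<in>?B. f x *\<^sub>R x) = 0" and x: "x \<in> ?B"
    obtain q where q: "q \<in> ?I" "x = eps *\<^sub>R ?e q" using x by blast
    have "(\<Sum>p\<in>?I. f (eps *\<^sub>R ?e p) *\<^sub>R (eps *\<^sub>R ?e p)) = 0" using s by (simp add: sum.reindex[OF inj])
    then have "lookup (\<Sum>p\<in>?I. f (eps *\<^sub>R ?e p) *\<^sub>R (eps *\<^sub>R ?e p)) q = 0" by simp
    moreover have "lookup (\<Sum>p\<in>?I. f (eps *\<^sub>R ?e p) *\<^sub>R (eps *\<^sub>R ?e p)) q = (\<Sum>p\<in>?I. if p = q then f x * eps else 0)"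
      unfolding lookup_sum by (rule sum.cong) (auto simp: q lookup_scaleR lookup_single when_def)
    ultimately have "f x * eps = 0" using q finite_interior by simp
    then show "f x = 0" using eps0 by simp
  qed
  have "dim ?D = card ?B" by (rule dim_unique[OF BD DB ind refl])
  also have "\<dots> = (r - 1) choose 2" using card_image[OF inj] card_interior_indices by simp
  finally show ?thesis using ne by (simp add: affine_dim_def)
qed

section \<open>Polynomials determined on progressions\<close>

lemma poly_eq_on_nats:
  fixes p q :: "real poly"
  assumes "\<And>n. n \<ge> N \<Longrightarrow> poly p (real n) = poly q (real n)"
  shows "p = q"
proof (rule ccontr)
  assume "p \<noteq> q"
  then have "finite {x. poly (p - q) x = 0}" by (intro poly_roots_finite) simp
  moreover have "real ` {N..} \<subseteq> {x. poly (p - q) x = 0}" using assms by auto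
  ultimately have "finite (real ` {N..})" by (rule finite_subset[rotated])
  then have "finite {N..}" by (rule finite_imageD) (simp add: inj_on_def)
  then show False by (simp add: infinite_Ici)
qed

text \<open>On each residue class the polynomial agrees with the eventual one at infinitely many points,
  hence everywhere.\<close>

lemma poly_fun_glue:
  assumes M: "M \<ge> 1" and res: "\<And>s. s < M \<Longrightarrow> poly_fun d (\<lambda>n. g (s + n * M))" and ev: "ev_poly g"
  shows "poly_fun d g"
proof -
  obtain p N where p: "\<And>n. n \<ge> N \<Longrightarrow> g n = poly p (real n)" using ev unfolding ev_poly_def by auto
  have key: "\<exists>q. degree q \<le> d \<and> q = pcompose p [:real s, real M:] \<and> (\<forall>n. g (s + n * M) = poly q (real n))" if sM: "s < M" for s
  proof -
    obtain q where q: "degree q \<le> d" "\<And>n. g (s + n * M) = poly q (real n)"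
      using res[OF sM] unfolding poly_fun_def by auto
    have "q = pcompose p [:real s, real M:]"
    proof (rule poly_eq_on_nats)
      fix n assume n: "n \<ge> N"
      have "n * 1 \<le> n * M" by (rule mult_le_mono2[OF M])
      then have "s + n * M \<ge> N" using n by linarith
      then have "g (s + n * M) = poly p (real (s + n * M))" by (rule p)
      then show "poly q (real n) = poly (pcompose p [:real s, real M:]) (real n)"
        using q(2)[of n] by (simp add: poly_pcompose algebra_simps)
    qed
    then show ?thesis using q by blast
  qed
  have "degree (pcompose p [:real 0, real M:]) \<le> d" using key[of 0] M by auto
  then have "degree p \<le> d" using M by (simp add: degree_pcompose)
  moreover have "g n = poly p (real n)" for n
  proof -
    have "n mod M < M" using M by simp
    from key[OF this] obtain q where q: "q = pcompose p [:real (n mod M), real M:]" "\<And>n'. g (n mod M + n' * M) = poly q (real n')"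
      by blast
    have "g (n mod M + (n div M) * M) = poly (pcompose p [:real (n mod M), real M:]) (real (n div M))"
      unfolding q(2) q(1) ..
    also have "\<dots> = poly p (real (n mod M + (n div M) * M))"
      unfolding of_nat_add of_nat_mult poly_pcompose by (simp add: mult.commute)
    finally show ?thesis by simp
  qed
  ultimately show ?thesis unfolding poly_fun_def by blast
qed

text \<open>The Lagrange polynomials for the nodes \<open>0, \<dots>, d\<close>.\<close>

lemma interpolation_basis:
  "\<exists>L :: nat \<Rightarrow> real poly. \<forall>q x. degree q \<le> d \<longrightarrow> poly q x = (\<Sum>i\<le>d. poly q (real i) * poly (L i) x)"
proof -
  define L :: "nat \<Rightarrow> real poly" where
    "L i = (\<Prod>j\<in>{..d} - {i}. smult (1 / (real i - real j)) [:- real j, 1:])" for i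
  have Lval: "poly (L i) (real j) = (if i = j then 1 else 0)" if "i \<le> d" "j \<le> d" for i j
  proof (cases "i = j")
    case True
    have "poly (L i) (real i) = (\<Prod>j\<in>{..d} - {i}. 1)"
      unfolding L_def poly_prod by (rule prod.cong) (auto simp: divide_simps)
    then show ?thesis using True by simp
  next
    case False
    have "poly (L i) (real j) = 0"
      unfolding L_def poly_prod by (rule prod_zero) (use False that in \<open>auto intro!: bexI[of _ j]\<close>)
    then show ?thesis using False by simp
  qed
  have Ldeg: "degree (L i) \<le> d" if "i \<le> d" for i
  proof -
    have "degree (L i) \<le> (\<Sum>j\<in>{..d} - {i}. degree (smult (1 / (real i - real j)) [:- real j, 1:]))"
      using degree_prod_sum_le[of "{..d} - {i}" "\<lambda>j. smult (1 / (real i - real j)) [:- real j, 1:]"]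
      by (simp only: L_def o_def finite_Diff finite_atMost)
    also have "\<dots> \<le> (\<Sum>j\<in>{..d} - {i}. 1)"
      by (intro sum_mono order_trans[OF degree_smult_le]) simp
    also have "\<dots> = d" using that by simp
    finally show ?thesis .
  qed
  show ?thesis
  proof (intro exI[of _ L] allI impI)
    fix q :: "real poly" and x assume q: "degree q \<le> d"
    define q' where "q' = (\<Sum>i\<le>d. smult (poly q (real i)) (L i))"
    have q'v: "poly q' y = (\<Sum>i\<le>d. poly q (real i) * poly (L i) y)" for y
      by (simp add: q'_def poly_sum)
    have "q = q'"
    proof (rule poly_eqI_degree[where A = "real ` {..d}"])
      fix y assume "y \<in> real ` {..d}"
      then obtain j where j: "j \<le> d" "y = real j" by auto
      have "poly q' y = (\<Sum>i\<le>d. if i = j then poly q (real j) else 0)"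
        unfolding q'v by (rule sum.cong) (use j Lval in auto)
      then show "poly q y = poly q' y" using j by simp
    next
      have c: "card (real ` {..d}) = Suc d" by (subst card_image) (auto simp: inj_on_def)
      show "degree q < card (real ` {..d})" using q c by simp
      have "degree q' \<le> d" unfolding q'_def
        by (intro degree_sum_le order_trans[OF degree_smult_le] Ldeg) auto
      then show "degree q' < card (real ` {..d})" using c by simp
    qed
    then show "poly q x = (\<Sum>i\<le>d. poly q (real i) * poly (L i) x)" using q'v by metis
  qed
qed

text \<open>Interpolation in the first variable with the nodes \<open>0, \<dots>, d\<close> has the values \<open>H i n\<close> as
  coefficients, which are polynomial in \<open>n\<close>.\<close>

lemma separately_poly:
  fixes H :: "nat \<Rightarrow> nat \<Rightarrow> real"
  assumes "\<And>n. poly_fun d (\<lambda>m. H m n)" "\<And>m. poly_fun d (\<lambda>n. H m n)"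
  obtains L p :: "nat \<Rightarrow> real poly" where "\<And>m n. H m n = (\<Sum>i\<le>d. poly (L i) (real m) * poly (p i) (real n))"
proof -
  obtain L :: "nat \<Rightarrow> real poly" where L: "\<And>q x. degree q \<le> d \<Longrightarrow> poly q x = (\<Sum>i\<le>d. poly q (real i) * poly (L i) x)"
    using interpolation_basis[of d] by blast
  obtain p where p: "\<And>m n. H m n = poly (p m) (real n)" using assms(2) unfolding poly_fun_def by metis
  have "H m n = (\<Sum>i\<le>d. poly (L i) (real m) * poly (p i) (real n))" for m n
  proof -
    obtain q where q: "degree q \<le> d" "\<And>m. H m n = poly q (real m)" using assms(1)[of n] unfolding poly_fun_def by auto
    show ?thesis using L[OF q(1), of "real m"] by (simp add: q(2)[symmetric] p[symmetric] mult.commute)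
  qed
  then show thesis by (rule that)
qed

section \<open>Partition functions near a ray\<close>

lemma qcone_add: "v \<in> qcone J b \<Longrightarrow> w \<in> qcone J b \<Longrightarrow> v + w \<in> qcone J b"
proof -
  assume "v \<in> qcone J b" "w \<in> qcone J b"
  then obtain c e where c: "\<forall>i\<in>J. 0 \<le> c i \<and> c i \<in> \<rat>" "v = (\<Sum>i\<in>J. c i *\<^sub>R b i)"
    and e: "\<forall>i\<in>J. 0 \<le> e i \<and> e i \<in> \<rat>" "w = (\<Sum>i\<in>J. e i *\<^sub>R b i)" unfolding qcone_def by blast
  have "v + w = (\<Sum>i\<in>J. (c i + e i) *\<^sub>R b i)" by (simp add: c(2) e(2) scaleR_add_left sum.distrib)
  then show ?thesis unfolding qcone_def using c(1) e(1)
    by (intro CollectI exI[of _ "\<lambda>i. c i + e i"]) auto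
qed

lemma qcone_scale: "v \<in> qcone J b \<Longrightarrow> t \<in> \<rat> \<Longrightarrow> 0 \<le> t \<Longrightarrow> t *\<^sub>R v \<in> qcone J b"
proof -
  assume "v \<in> qcone J b" and t: "t \<in> \<rat>" "0 \<le> t"
  then obtain c where c: "\<forall>i\<in>J. 0 \<le> c i \<and> c i \<in> \<rat>" "v = (\<Sum>i\<in>J. c i *\<^sub>R b i)" unfolding qcone_def by blast
  have "t *\<^sub>R v = (\<Sum>i\<in>J. (t * c i) *\<^sub>R b i)" by (simp add: c(2) scaleR_right.sum)
  then show ?thesis unfolding qcone_def using c(1) t
    by (intro CollectI exI[of _ "\<lambda>i. t * c i"]) auto
qed

text \<open>By convexity the rational numbers \<open>s\<close> with \<open>s X + D\<close> in the cone form an interval: if it is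
  unbounded above, it contains all sufficiently large \<open>s\<close>, and otherwise none of them. There are
  finitely many subsets \<open>J\<close>.\<close>

lemma qcone_dichotomy:
  fixes X D :: "'a::real_vector"
  assumes I: "finite I"
  shows "\<exists>K :: nat. \<forall>J. J \<subseteq> I \<longrightarrow>
    (\<forall>s\<in>\<rat>. real K \<le> s \<longrightarrow> s *\<^sub>R X + D \<notin> qcone J b) \<or> (\<forall>s\<in>\<rat>. real K \<le> s \<longrightarrow> s *\<^sub>R X + D \<in> qcone J b)"
proof -
  define settled where "settled J N \<longleftrightarrow> (\<forall>s\<in>\<rat>. real N \<le> s \<longrightarrow> s *\<^sub>R X + D \<notin> qcone J b) \<or> (\<forall>s\<in>\<rat>. real N \<le> s \<longrightarrow> s *\<^sub>R X + D \<in> qcone J b)" for J N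
  have "\<exists>N. settled J N" for J
  proof (cases "\<exists>N::nat. \<forall>s\<in>\<rat>. real N \<le> s \<longrightarrow> s *\<^sub>R X + D \<notin> qcone J b")
    case True
    then show ?thesis unfolding settled_def by blast
  next
    case False
    then have unb: "\<exists>s\<in>\<rat>. real N \<le> s \<and> s *\<^sub>R X + D \<in> qcone J b" for N :: nat by blast
    obtain s0 where s0: "s0 \<in> \<rat>" "s0 *\<^sub>R X + D \<in> qcone J b" using unb[of 0] by blast
    define N where "N = nat \<lceil>s0\<rceil>"
    have "s *\<^sub>R X + D \<in> qcone J b" if s: "s \<in> \<rat>" "real N \<le> s" for s
    proof (cases "s = s0")
      case True
      then show ?thesis using s0 by simp
    next
      case False
      have "s0 \<le> real N" unfolding N_def by (rule real_nat_ceiling_ge)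
      then have ss: "s0 < s" using s False by simp
      obtain s1 where s1: "s1 \<in> \<rat>" "real (nat \<lceil>s\<rceil>) \<le> s1" "s1 *\<^sub>R X + D \<in> qcone J b" using unb by blast
      have ss1: "s \<le> s1" using s1(2) real_nat_ceiling_ge[of s] by linarith
      define t where "t = (s - s0) / (s1 - s0)"
      have t: "t \<in> \<rat>" "0 \<le> t" "t \<le> 1" using s s0 s1 ss ss1 by (auto simp: t_def)
      have "t * (s1 - s0) = s - s0" using ss ss1 by (simp add: t_def)
      then have st: "s = (1 - t) * s0 + t * s1" by (simp add: algebra_simps)
      have "(1 - t) *\<^sub>R (s0 *\<^sub>R X + D) + t *\<^sub>R (s1 *\<^sub>R X + D) \<in> qcone J b"
        using t by (intro qcone_add[OF qcone_scale[OF s0(2)] qcone_scale[OF s1(3)]]) auto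
      also have "(1 - t) *\<^sub>R (s0 *\<^sub>R X + D) + t *\<^sub>R (s1 *\<^sub>R X + D) = ((1 - t) * s0 + t * s1) *\<^sub>R X + D"
        by (simp add: algebra_simps)
      finally show ?thesis unfolding st .
    qed
    then show ?thesis unfolding settled_def by blast
  qed
  then obtain N where N: "\<And>J. settled J (N J)" by metis
  define K where "K = Max (N ` Pow I)"
  have "settled J K" if "J \<subseteq> I" for J
  proof -
    have "N J \<le> K" unfolding K_def using I that by (intro Max_ge) auto
    then have "real (N J) \<le> real K" by simp
    then show ?thesis using N[of J] unfolding settled_def by (meson order_trans)
  qed
  then show ?thesis unfolding settled_def by blast
qed

text \<open>The set \<open>C\<close> of \<open>vpf_poly_on_ray\<close> is the thin cone of the \<open>\<alpha> X + \<beta> D\<close> with \<open>0 < \<beta>\<close> and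
  \<open>K \<beta> \<le> \<alpha>\<close>, which lies in the cone of \<open>J\<close> or misses it, for each \<open>J\<close>. Points with \<open>\<beta> = 0\<close> do
  not belong to it, but they are of the form \<open>y - eps D\<close> with \<open>y\<close> in \<open>C\<close>, and if \<open>eps\<close> is small
  then \<open>eps D\<close> is a combination of the vectors with coefficients in the unit interval. This is
  what makes \<open>c = 0\<close> admissible.\<close>

lemma vpf_poly_near_ray:
  fixes X D :: "'a::real_vector"
  assumes I: "finite I" and fin: "\<And>v. finite (vpf_sols I b v)"
    and D: "vpf_sols I b D \<noteq> {}"
    and K: "\<And>J. J \<subseteq> I \<Longrightarrow>
      (\<forall>s\<in>\<rat>. real K \<le> s \<longrightarrow> s *\<^sub>R X + D \<notin> qcone J b) \<or> (\<forall>s\<in>\<rat>. real K \<le> s \<longrightarrow> s *\<^sub>R X + D \<in> qcone J b)"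
    and \<kappa>: "K \<le> \<kappa>"
  obtains M :: nat where "M \<ge> 1" "\<And>a c :: nat. K * c + 1 \<le> a \<Longrightarrow>
    poly_fun (card I) (\<lambda>n. vpf I b (real (a + n * M * \<kappa>) *\<^sub>R X + real (c + n * M) *\<^sub>R D))"
proof -
  define C where "C = {\<alpha> *\<^sub>R X + \<beta> *\<^sub>R D |\<alpha> \<beta>. \<alpha> \<in> \<rat> \<and> \<beta> \<in> \<rat> \<and> 0 < \<beta> \<and> real K * \<beta> \<le> \<alpha>}"
  define u where "u = real \<kappa> *\<^sub>R X + D"
  have uC: "u \<in> C" unfolding u_def C_def using \<kappa>
    by (intro CollectI exI[of _ "real \<kappa>"] exI[of _ 1]) auto
  have Cu: "y + t *\<^sub>R u \<in> C" if y: "y \<in> C" and t: "t \<in> \<rat>" "0 \<le> t" for y t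
  proof -
    obtain \<alpha> \<beta> where ab: "y = \<alpha> *\<^sub>R X + \<beta> *\<^sub>R D" "\<alpha> \<in> \<rat>" "\<beta> \<in> \<rat>" "0 < \<beta>" "real K * \<beta> \<le> \<alpha>"
      using y unfolding C_def by blast
    have "real K * t \<le> real \<kappa> * t" using \<kappa> t by (intro mult_right_mono) auto
    then have "real K * (\<beta> + t) \<le> \<alpha> + t * real \<kappa>" using ab by (simp add: algebra_simps)
    moreover have "y + t *\<^sub>R u = (\<alpha> + t * real \<kappa>) *\<^sub>R X + (\<beta> + t) *\<^sub>R D"
      by (simp add: ab u_def algebra_simps)
    ultimately show ?thesis unfolding C_def using ab t
      by (intro CollectI exI[of _ "\<alpha> + t * real \<kappa>"] exI[of _ "\<beta> + t"]) auto
  qed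
  have dich: "C \<inter> qcone J b = {} \<or> u \<in> qcone J b" if J: "J \<subseteq> I" for J
  proof (rule disjCI)
    assume "u \<notin> qcone J b"
    then have "\<not> (\<forall>s\<in>\<rat>. real K \<le> s \<longrightarrow> s *\<^sub>R X + D \<in> qcone J b)" using \<kappa> unfolding u_def by fastforce
    then have no: "\<forall>s\<in>\<rat>. real K \<le> s \<longrightarrow> s *\<^sub>R X + D \<notin> qcone J b" using K[OF J] by blast
    show "C \<inter> qcone J b = {}"
    proof (rule ccontr)
      assume "C \<inter> qcone J b \<noteq> {}"
      then obtain \<alpha> \<beta> where ab: "\<alpha> \<in> \<rat>" "\<beta> \<in> \<rat>" "0 < \<beta>" "real K * \<beta> \<le> \<alpha>" "\<alpha> *\<^sub>R X + \<beta> *\<^sub>R D \<in> qcone J b"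
        unfolding C_def by blast
      have "(1 / \<beta>) *\<^sub>R (\<alpha> *\<^sub>R X + \<beta> *\<^sub>R D) \<in> qcone J b" using ab by (intro qcone_scale) auto
      also have "(1 / \<beta>) *\<^sub>R (\<alpha> *\<^sub>R X + \<beta> *\<^sub>R D) = (\<alpha> / \<beta>) *\<^sub>R X + D" using ab by (simp add: algebra_simps)
      finally have "(\<alpha> / \<beta>) *\<^sub>R X + D \<in> qcone J b" .
      moreover have "\<alpha> / \<beta> \<in> \<rat>" "real K \<le> \<alpha> / \<beta>" using ab by (auto simp: field_simps)
      ultimately show False using no by blast
    qed
  qed
  obtain M :: nat where M: "M \<ge> 1" and poly: "\<And>y \<theta>. y \<in> C \<Longrightarrow> (\<forall>i\<in>I. \<theta> i \<in> \<rat> \<and> 0 \<le> \<theta> i \<and> \<theta> i \<le> 1) \<Longrightarrow>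
      poly_fun (card I) (\<lambda>n. vpf I b (y - (\<Sum>i\<in>I. \<theta> i *\<^sub>R b i) + (real n * real M) *\<^sub>R u))"
    using vpf_poly_on_ray[OF I fin Cu dich] by blast
  obtain k where k: "D = (\<Sum>i\<in>I. real (k i) *\<^sub>R b i)" using D by (auto simp: vpf_sols_def)
  define T where "T = real (Suc (K + (\<Sum>i\<in>I. k i)))"
  define eps where "eps = 1 / T"
  have T: "0 < T" "real K \<le> T" unfolding T_def of_nat_0_less_iff of_nat_le_iff by simp_all
  have "T \<in> \<rat>" unfolding T_def by (rule Rats_of_nat)
  then have eps: "eps \<in> \<rat>" "0 < eps" "eps * real K \<le> 1" using T by (auto simp: eps_def)
  have th: "\<forall>i\<in>I. eps * real (k i) \<in> \<rat> \<and> 0 \<le> eps * real (k i) \<and> eps * real (k i) \<le> 1"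
  proof
    fix i assume i: "i \<in> I"
    have "k i \<le> (\<Sum>i\<in>I. k i)" using I i by (intro member_le_sum) auto
    then have "real (k i) \<le> T" unfolding T_def of_nat_le_iff by simp
    then show "eps * real (k i) \<in> \<rat> \<and> 0 \<le> eps * real (k i) \<and> eps * real (k i) \<le> 1"
      using eps T by (intro conjI Rats_mult Rats_of_nat) (auto simp: eps_def)
  qed
  have "poly_fun (card I) (\<lambda>n. vpf I b (real (a + n * M * \<kappa>) *\<^sub>R X + real (c + n * M) *\<^sub>R D))"
    if ac: "K * c + 1 \<le> a" for a c :: nat
  proof -
    define y where "y = real a *\<^sub>R X + (real c + eps) *\<^sub>R D"
    have "real K * real c + 1 \<le> real a" using ac by (metis of_nat_1 of_nat_add of_nat_le_iff of_nat_mult)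
    then have "real K * (real c + eps) \<le> real a" using eps(3) by (simp add: distrib_left mult.commute)
    then have "y \<in> C" unfolding y_def C_def using eps
      by (intro CollectI exI[of _ "real a"] exI[of _ "real c + eps"]) (auto intro: add_nonneg_pos)
    from poly[OF this th]
    have "poly_fun (card I) (\<lambda>n. vpf I b (y - (\<Sum>i\<in>I. (eps * real (k i)) *\<^sub>R b i) + (real n * real M) *\<^sub>R u))" .
    moreover have "y - (\<Sum>i\<in>I. (eps * real (k i)) *\<^sub>R b i) + (real n * real M) *\<^sub>R u
      = real (a + n * M * \<kappa>) *\<^sub>R X + real (c + n * M) *\<^sub>R D" for n
    proof -
      have "(\<Sum>i\<in>I. (eps * real (k i)) *\<^sub>R b i) = eps *\<^sub>R D" unfolding k scaleR_right.sum by simp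
      then show ?thesis by (simp add: y_def u_def algebra_simps)
    qed
    ultimately show ?thesis by simp
  qed
  then show thesis using that M by blast
qed

section \<open>A strict hive\<close>

text \<open>A triple with a hive for which all rhombus inequalities are strict. The hive is the concave
  quadratic form \<open>- 2 i^2 + 2 i j - 2 j^2\<close>, on which all rhombus forms have the value 2, plus
  the linear form \<open>4 r (i + j)\<close>, which has no effect on rhombi and makes the border increase.\<close>

definition strict_la :: "nat \<Rightarrow> nat \<Rightarrow> nat" where "strict_la r i = (if i < r then 4 * r - 4 * i - 2 else 0)"
definition strict_mu :: "nat \<Rightarrow> nat \<Rightarrow> nat" where "strict_mu r i = (if i < r then 6 * r - 4 * i - 2 else 0)"
definition strict_nu :: "nat \<Rightarrow> nat \<Rightarrow> nat" where "strict_nu r i = (if i < r then 8 * r - 4 * i - 2 else 0)"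

definition strict_hive :: "nat \<Rightarrow> nat \<Rightarrow> nat \<Rightarrow> nat" where
  "strict_hive r i j = (if j \<le> i \<and> i \<le> r then 4 * r * i + 4 * r * j + 2 * i * j - (2 * i * i + 2 * j * j) else 0)"

lemma real_strict_hive:
  assumes "j \<le> i" "i \<le> r"
  shows "real (strict_hive r i j) = 4 * real r * real i + 4 * real r * real j + 2 * real i * real j - 2 * real i * real i - 2 * real j * real j"
proof -
  have "i * i \<le> r * i" "j * j \<le> r * j" using assms by (auto intro: mult_le_mono1)
  then have "2 * (i * i) + 2 * (j * j) \<le> 4 * (r * i) + 4 * (r * j) + 2 * (i * j)" by linarith
  then have "2 * i * i + 2 * j * j \<le> 4 * r * i + 4 * r * j + 2 * i * j" by (simp only: mult.assoc)
  then show ?thesis using assms by (simp add: strict_hive_def of_nat_diff)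
qed

lemma sum_strict:
  assumes "i \<le> r" "4 * r \<le> c"
  shows "(\<Sum>l<i. real (c - 4 * l - 2)) = real c * real i - 2 * real i * real i"
  using assms(1)
proof (induction i)
  case (Suc i)
  have "real (c - 4 * i - 2) = real c - 4 * real i - 2" using Suc.prems assms(2) by (simp add: of_nat_diff)
  then show ?case using Suc by (simp add: algebra_simps)
qed simp

lemma sum_strict_parts:
  assumes "i \<le> r"
  shows "(\<Sum>l<i. real (strict_la r l)) = 4 * real r * real i - 2 * real i * real i"
    "(\<Sum>l<i. real (strict_mu r l)) = 6 * real r * real i - 2 * real i * real i"
    "(\<Sum>l<i. real (strict_nu r l)) = 8 * real r * real i - 2 * real i * real i"
proof -
  have "(\<Sum>l<i. real (strict_la r l)) = (\<Sum>l<i. real (4 * r - 4 * l - 2))"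
    "(\<Sum>l<i. real (strict_mu r l)) = (\<Sum>l<i. real (6 * r - 4 * l - 2))"
    "(\<Sum>l<i. real (strict_nu r l)) = (\<Sum>l<i. real (8 * r - 4 * l - 2))"
    using assms by (auto simp: strict_la_def strict_mu_def strict_nu_def intro!: sum.cong)
  then show "(\<Sum>l<i. real (strict_la r l)) = 4 * real r * real i - 2 * real i * real i"
    "(\<Sum>l<i. real (strict_mu r l)) = 6 * real r * real i - 2 * real i * real i"
    "(\<Sum>l<i. real (strict_nu r l)) = 8 * real r * real i - 2 * real i * real i"
    using sum_strict[OF assms, of "4 * r"] sum_strict[OF assms, of "6 * r"] sum_strict[OF assms, of "8 * r"] by simp_all
qed

lemma partition_of_length_leI:
  assumes "\<And>i. Suc i < r \<Longrightarrow> f (Suc i) \<le> f i" "\<And>i. i \<ge> r \<Longrightarrow> f i = 0"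
  shows "partition_of_length_le r f"
proof -
  have "f (Suc i) \<le> f i" for i using assms(1)[of i] assms(2)[of "Suc i"] by (cases "Suc i < r") auto
  then have "antimono f" by (simp add: decseq_Suc_iff)
  moreover have "finite {i. f i \<noteq> 0}" using support_lessThan[of r f] assms(2) finite_subset by blast
  ultimately show ?thesis using assms(2) by (simp add: partition_of_length_le_def partition_def)
qed

lemma lr_tripleI:
  assumes "partition_of_length_le r la" "partition_of_length_le r mu" "partition_of_length_le r nu"
    "(\<Sum>i<r. la i) + (\<Sum>i<r. mu i) = (\<Sum>i<r. nu i)"
  shows "lr_triple r la mu nu"
  using assms psize_eq[of r la] psize_eq[of r mu] psize_eq[of r nu]
  by (auto simp: lr_triple_def partition_of_length_le_def)

lemma strict_triple: "lr_triple r (strict_la r) (strict_mu r) (strict_nu r)"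
proof (rule lr_tripleI)
  have "real ((\<Sum>i<r. strict_la r i) + (\<Sum>i<r. strict_mu r i)) = real (\<Sum>i<r. strict_nu r i)"
    using sum_strict_parts[of r r] by simp
  then show "(\<Sum>i<r. strict_la r i) + (\<Sum>i<r. strict_mu r i) = (\<Sum>i<r. strict_nu r i)"
    by (simp only: of_nat_eq_iff)
qed (rule partition_of_length_leI; simp add: strict_la_def strict_mu_def strict_nu_def)+

lemma strict_hive_border: "hive_border r (strict_la r) (strict_mu r) (strict_nu r) (\<lambda>i j. real (strict_hive r i j))"
proof -
  note tD = lr_tripleD[OF strict_triple[of r]]
  have p: "real (psize (strict_la r)) = (\<Sum>l<r. real (strict_la r l))" using psize_eq[of r "strict_la r"] tD(4) by simp
  show ?thesis
    unfolding hive_border_def p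
    by (auto simp: real_strict_hive sum_strict_parts algebra_simps)
qed

lemma strict_hive_lin:
  assumes "c \<in> rhombi r" shows "hive_form r c (\<lambda>i j. real (strict_hive r i j)) = 2"
  using assms
proof (cases rule: rhombiE)
  case (1 i j)
  then show ?thesis by (simp add: hive_form_def real_strict_hive algebra_simps)
next
  case (2 i j)
  then show ?thesis by (simp add: hive_form_def real_strict_hive algebra_simps)
next
  case (3 i j)
  then show ?thesis by (simp add: hive_form_def real_strict_hive algebra_simps)
qed

lemma strict_hive_int: "strict_hive r \<in> int_hives r (strict_la r) (strict_mu r) (strict_nu r)"
proof -
  have "hive r (\<lambda>i j. real (strict_hive r i j))" unfolding hive_iff using strict_hive_lin by force
  then show ?thesis using strict_hive_border by (auto simp: int_hives_def strict_hive_def)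
qed

section \<open>Two-parameter families of triples\<close>

lemma finite_int_hives: assumes "lr_triple r la mu nu" shows "finite (int_hives r la mu nu)"
proof -
  have "int_hives r la mu nu \<subseteq> hive_of_gt r la ` lr_patterns r la mu nu"
    using gt_of_hive_in[OF assms] by (metis image_eqI subsetI)
  then show ?thesis using finite_lr_patterns finite_subset by blast
qed

lemma lr_triple_combination:
  assumes "lr_triple r la mu nu" "lr_triple r la' mu' nu'"
  shows "lr_triple r (\<lambda>i. a * la i + b * la' i) (\<lambda>i. a * mu i + b * mu' i) (\<lambda>i. a * nu i + b * nu' i)"
proof (rule lr_tripleI)
  note t = lr_tripleD[OF assms(1)] and t' = lr_tripleD[OF assms(2)]
  have part: "partition_of_length_le r (\<lambda>i. a * f i + b * g i)"
    if "partition f" "partition g" "\<And>i. i \<ge> r \<Longrightarrow> f i = 0" "\<And>i. i \<ge> r \<Longrightarrow> g i = 0" for f g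
  proof (rule partition_of_length_leI)
    fix i
    have "f (Suc i) \<le> f i" "g (Suc i) \<le> g i"
      using antimonoD[OF partitionD(1)[OF that(1)], of i "Suc i"] antimonoD[OF partitionD(1)[OF that(2)], of i "Suc i"] by auto
    then show "a * f (Suc i) + b * g (Suc i) \<le> a * f i + b * g i" by (intro add_mono mult_le_mono2)
  qed (use that in auto)
  show "partition_of_length_le r (\<lambda>i. a * la i + b * la' i)" by (rule part) (use t t' in auto)
  show "partition_of_length_le r (\<lambda>i. a * mu i + b * mu' i)" by (rule part) (use t t' in auto)
  show "partition_of_length_le r (\<lambda>i. a * nu i + b * nu' i)" by (rule part) (use t t' in auto)
  have "a * ((\<Sum>i<r. la i) + (\<Sum>i<r. mu i)) + b * ((\<Sum>i<r. la' i) + (\<Sum>i<r. mu' i)) = a * (\<Sum>i<r. nu i) + b * (\<Sum>i<r. nu' i)"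
    using t(7) t'(7) by simp
  then show "(\<Sum>i<r. a * la i + b * la' i) + (\<Sum>i<r. a * mu i + b * mu' i) = (\<Sum>i<r. a * nu i + b * nu' i)"
    by (simp add: sum.distrib sum_distrib_left algebra_simps)
qed

lemma lr_triple_partition: "lr_triple r la mu nu \<Longrightarrow> partition_of_length_le r la \<and> partition_of_length_le r mu \<and> partition_of_length_le r nu"
  by (simp add: lr_triple_def)

text \<open>The region \<open>K b + 1 \<le> a\<close> contains the quadrant of the points
  \<open>(a, b) = (K, 1) m + (K + 1, 1) (n + 1)\<close>. Along both axes of the quadrant the counts are
  polynomial: up to a period by \<open>vpf_poly_near_ray\<close>, and with period 1 because they are
  eventually polynomial by \<open>lr_count_ev_poly\<close>. So they are jointly polynomial on the quadrant.
  The other points of the region, in particular those with \<open>b = 0\<close>, lie on rays in direction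
  \<open>(K, 1)\<close> that run into the quadrant, and along these rays the counts are polynomial from the
  first point on.\<close>

theorem lr_count_two_parameter:
  assumes x: "lr_triple r la mu nu" and y: "lr_triple r la' mu' nu'" and ne: "int_hives r la' mu' nu' \<noteq> {}"
  shows "\<exists>K d. \<exists>L p :: nat \<Rightarrow> real poly. \<forall>a b :: nat. K * b + 1 \<le> a \<longrightarrow>
      real_of_int (lr_count (\<lambda>i. a * la i + b * la' i) (\<lambda>i. a * mu i + b * mu' i) (\<lambda>i. a * nu i + b * nu' i))
      = (\<Sum>i\<le>d. poly (L i) ((real K + 1) * real b - real a) * poly (p i) (real a - real K * real b - 1))"
proof -
  define G where "G a b = real_of_int (lr_count (\<lambda>i. a * la i + b * la' i) (\<lambda>i. a * mu i + b * mu' i) (\<lambda>i. a * nu i + b * nu' i))" for a b :: nat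
  let ?I = "hive_index r" and ?g = "hive_gen r"
  define X where "X = hive_target r la mu nu"
  define D where "D = hive_target r la' mu' nu'"
  let ?d = "card ?I"
  note xD = lr_tripleD[OF x] and yD = lr_tripleD[OF y]
  have G: "G a b = vpf ?I ?g (real a *\<^sub>R X + real b *\<^sub>R D)" for a b
  proof -
    note t = lr_triple_combination[OF x y, of a b]
    have "G a b = real (card (int_hives r (\<lambda>i. a * la i + b * la' i) (\<lambda>i. a * mu i + b * mu' i) (\<lambda>i. a * nu i + b * nu' i)))"
      unfolding G_def lr_count_hives[OF t] by simp
    also have "\<dots> = vpf ?I ?g (hive_target r (\<lambda>i. a * la i + b * la' i) (\<lambda>i. a * mu i + b * mu' i) (\<lambda>i. a * nu i + b * nu' i))"
      by (rule vpf_hives[symmetric]) (use xD(4) yD(4) in auto)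
    finally show ?thesis unfolding hive_target_combination X_def D_def .
  qed
  have Dne: "vpf_sols ?I ?g D \<noteq> {}"
  proof -
    have "vpf ?I ?g D = real (card (int_hives r la' mu' nu'))" unfolding D_def by (rule vpf_hives) (rule yD(4))
    then have "vpf ?I ?g D \<noteq> 0" using ne finite_int_hives[OF y] by simp
    then show ?thesis unfolding vpf_def by auto
  qed
  obtain K :: nat where K: "\<And>J. J \<subseteq> ?I \<Longrightarrow>
    (\<forall>s\<in>\<rat>. real K \<le> s \<longrightarrow> s *\<^sub>R X + D \<notin> qcone J ?g) \<or> (\<forall>s\<in>\<rat>. real K \<le> s \<longrightarrow> s *\<^sub>R X + D \<in> qcone J ?g)"
    using qcone_dichotomy[OF finite_hive_index[of r], of X D "hive_gen r"] by blast
  have line: "poly_fun ?d (\<lambda>n. G (a + n * \<kappa>) (b + n))" if \<kappa>: "K \<le> \<kappa>" and ab: "K * b + 1 \<le> a" for \<kappa> a b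
  proof -
    obtain M :: nat where M: "M \<ge> 1" and P: "\<And>a c :: nat. K * c + 1 \<le> a \<Longrightarrow>
      poly_fun ?d (\<lambda>n. vpf ?I ?g (real (a + n * M * \<kappa>) *\<^sub>R X + real (c + n * M) *\<^sub>R D))"
      using vpf_poly_near_ray[OF finite_hive_index finite_vsol_hive Dne K \<kappa>] by blast
    show ?thesis
    proof (rule poly_fun_glue[OF M])
      fix s
      have "K * s \<le> s * \<kappa>" using \<kappa> by (simp add: mult.commute)
      then have "K * (b + s) + 1 \<le> a + s * \<kappa>" using ab unfolding distrib_left by linarith
      from P[OF this] show "poly_fun ?d (\<lambda>n. G (a + (s + n * M) * \<kappa>) (b + (s + n * M)))"
        by (simp only: G distrib_right add.assoc)
    next
      have e: "(\<lambda>i. (a + n * \<kappa>) * f i + (b + n) * g i) = (\<lambda>i. (a * f i + b * g i) + n * (\<kappa> * f i + 1 * g i))" for n f g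
        by (simp add: fun_eq_iff algebra_simps)
      note t1 = lr_triple_partition[OF lr_triple_combination[OF x y, of a b]]
      note t2 = lr_triple_partition[OF lr_triple_combination[OF x y, of \<kappa> 1]]
      show "ev_poly (\<lambda>n. G (a + n * \<kappa>) (b + n))"
        unfolding G_def e by (rule lr_count_ev_poly) (use t1 t2 in auto)
    qed
  qed
  define H where "H m n = G (K * (m + n + 1) + n + 1) (m + n + 1)" for m n
  have H1: "poly_fun ?d (\<lambda>m. H m n)" for n
  proof -
    have "poly_fun ?d (\<lambda>m. G ((K * (n + 1) + n + 1) + m * K) ((n + 1) + m))"
      by (rule line) auto
    moreover have "(K * (n + 1) + n + 1) + m * K = K * (m + n + 1) + n + 1" "(n + 1) + m = m + n + 1" for m
      by (simp_all add: algebra_simps)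
    ultimately show ?thesis unfolding H_def by (simp only:)
  qed
  have H2: "poly_fun ?d (\<lambda>n. H m n)" for m
  proof -
    have "poly_fun ?d (\<lambda>n. G ((K * (m + 1) + 1) + n * (K + 1)) ((m + 1) + n))"
      by (rule line) auto
    moreover have "(K * (m + 1) + 1) + n * (K + 1) = K * (m + n + 1) + n + 1" "(m + 1) + n = m + n + 1" for n
      by (simp_all add: algebra_simps)
    ultimately show ?thesis unfolding H_def by (simp only:)
  qed
  obtain L p :: "nat \<Rightarrow> real poly" where Lp: "\<And>m n. H m n = (\<Sum>i\<le>?d. poly (L i) (real m) * poly (p i) (real n))"
    using separately_poly[OF H1 H2] by blast
  have "G a b = (\<Sum>i\<le>?d. poly (L i) ((real K + 1) * real b - real a) * poly (p i) (real a - real K * real b - 1))"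
    if ab: "K * b + 1 \<le> a" for a b
  proof -
    define n where "n = a - K * b - 1"
    have a: "a = K * b + n + 1" using ab by (simp add: n_def)
    obtain q where q: "\<And>t. G (a + t * K) (b + t) = poly q (real t)"
      using line[OF order_refl ab] unfolding poly_fun_def by blast
    \<comment> \<open>The formula at \<open>(a + t K, b + t)\<close>; this point lies in the quadrant for \<open>t > n\<close>, where \<open>m = b + t - n - 1\<close>.\<close>
    define q2 where "q2 = (\<Sum>i\<le>?d. smult (poly (p i) (real n)) (pcompose (L i) [:real b - real n - 1, 1:]))"
    have "q = q2"
    proof (rule poly_eq_on_nats)
      fix t assume t: "n + 1 \<le> t"
      define m where "m = b + t - n - 1"
      have bt: "b + t = m + n + 1" using t by (simp add: m_def)
      have "a + t * K = K * (b + t) + n + 1" by (simp add: a algebra_simps)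
      then have "poly q (real t) = H m n" unfolding H_def bt[symmetric] q[symmetric] by simp
      also have "\<dots> = (\<Sum>i\<le>?d. poly (L i) (real m) * poly (p i) (real n))" by (rule Lp)
      also have "real m = real b - real n - 1 + real t" using t by (simp add: m_def of_nat_diff)
      finally show "poly q (real t) = poly q2 (real t)"
        by (simp add: q2_def poly_sum poly_pcompose mult.commute)
    qed
    then have "G a b = poly q2 0" using q[of 0] by simp
    also have "\<dots> = (\<Sum>i\<le>?d. poly (L i) (real b - real n - 1) * poly (p i) (real n))"
      by (simp add: q2_def poly_sum poly_pcompose mult.commute)
    also have "real b - real n - 1 = (real K + 1) * real b - real a" by (simp add: a algebra_simps)
    also have "real n = real a - real K * real b - 1" by (simp add: a)
    finally show ?thesis .
  qed
  then show ?thesis unfolding G_def by blast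
qed

section \<open>From nearby full-dimensional triples to the given one\<close>

lemma lr_poly_eqI:
  assumes "\<And>t. t \<ge> 1 \<Longrightarrow> poly p (real t) = of_int (lr_coeff (stretch t la) (stretch t mu) (stretch t nu))"
  shows "lr_poly la mu nu = p"
  unfolding lr_poly_def
proof (rule the_equality)
  show "\<forall>t::nat\<ge>1. poly p (of_nat t) = of_int (lr_coeff (stretch t la) (stretch t mu) (stretch t nu))"
    using assms by simp
  fix q :: "real poly"
  assume "\<forall>t::nat\<ge>1. poly q (of_nat t) = of_int (lr_coeff (stretch t la) (stretch t mu) (stretch t nu))"
  then show "q = p" using assms by (intro poly_eq_on_nats[of 1]) simp
qed

lemma hive_scale:
  assumes t: "t \<ge> 1" and h: "hive r h" "hive_border r (stretch t la) (stretch t mu) (stretch t nu) h"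
    and la: "\<And>i. i \<ge> r \<Longrightarrow> la i = 0"
  shows "hive r (\<lambda>i j. h i j / real t)" "hive_border r la mu nu (\<lambda>i j. h i j / real t)"
proof -
  have l: "hive_form r c (\<lambda>i j. h i j / real t) = hive_form r c h / real t" for c
    by (cases c) (simp add: hive_form_def add_divide_distrib diff_divide_distrib)
  show "hive r (\<lambda>i j. h i j / real t)" using h(1) by (simp add: hive_iff l)
  have b: "border_value r (stretch t la) (stretch t mu) (stretch t nu) c = real t * border_value r la mu nu c" for c
    by (cases c) (simp add: border_value_def stretch_def sum_distrib_left distrib_left)
  have "\<forall>c\<in>borders r. hive_form r c h = border_value r (stretch t la) (stretch t mu) (stretch t nu) c"
    using h(2) hive_border_iff[of r "stretch t la"] la by (simp add: stretch_def)
  then have "\<forall>c\<in>borders r. hive_form r c (\<lambda>i j. h i j / real t) = border_value r la mu nu c"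
    using t by (simp add: l b)
  then show "hive_border r la mu nu (\<lambda>i j. h i j / real t)"
    using hive_border_iff[of r la] la by simp
qed

lemma stretch_triple: "lr_triple r la mu nu \<Longrightarrow> lr_triple r (stretch t la) (stretch t mu) (stretch t nu)"
  using lr_triple_combination[of r la mu nu la mu nu t 0] by (simp add: stretch_def)

text \<open>A multiple of a real hive plus a strict hive is strict.\<close>

lemma full_dimensional_shift:
  assumes x: "lr_triple r la mu nu" and h: "hive r h" "hive_border r la mu nu h"
  shows "affine_dim (hive_polytope r (\<lambda>i. a * la i + strict_la r i) (\<lambda>i. a * mu i + strict_mu r i) (\<lambda>i. a * nu i + strict_nu r i))
    = int ((r - 1) choose 2)"
proof (rule full_dimensional)
  let ?s = "\<lambda>i j. real (strict_hive r i j)"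
  let ?h = "\<lambda>i j. real a * h i j + ?s i j"
  have l: "hive_form r c ?h = real a * hive_form r c h + hive_form r c ?s" for c
    by (cases c) (simp add: hive_form_def algebra_simps)
  show "0 < hive_form r c ?h" if "c \<in> rhombi r" for c
    using that h(1) strict_hive_lin[OF that] unfolding l hive_iff by (simp add: add_nonneg_pos)
  note xD = lr_tripleD[OF x] and sD = lr_tripleD[OF strict_triple[of r]]
  have 1: "\<forall>c\<in>borders r. hive_form r c h = border_value r la mu nu c" using h(2) hive_border_iff[of r la] xD(4) by simp
  have 2: "\<forall>c\<in>borders r. hive_form r c ?s = border_value r (strict_la r) (strict_mu r) (strict_nu r) c"
    using strict_hive_border[of r] hive_border_iff[of r "strict_la r"] sD(4) by simp
  have b: "border_value r (\<lambda>i. a * la i + strict_la r i) (\<lambda>i. a * mu i + strict_mu r i) (\<lambda>i. a * nu i + strict_nu r i) c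
    = real a * border_value r la mu nu c + border_value r (strict_la r) (strict_mu r) (strict_nu r) c" for c
    by (cases c) (simp add: border_value_def sum.distrib sum_distrib_left algebra_simps)
  have "\<forall>c\<in>borders r. hive_form r c ?h = border_value r (\<lambda>i. a * la i + strict_la r i) (\<lambda>i. a * mu i + strict_mu r i) (\<lambda>i. a * nu i + strict_nu r i) c"
    using 1 2 by (simp add: l b)
  then show "hive_border r (\<lambda>i. a * la i + strict_la r i) (\<lambda>i. a * mu i + strict_mu r i) (\<lambda>i. a * nu i + strict_nu r i) ?h"
    using hive_border_iff[of r "\<lambda>i. a * la i + strict_la r i"] xD(4) sD(4) by simp
qed

lemma lr_coeff_triple: "lr_triple r la mu nu \<Longrightarrow> lr_coeff la mu nu = lr_count la mu nu"
  by (intro lr_coeff_eq lr_tripleD)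

lemma coeff_sum_scaled:
  "coeff (\<Sum>i\<le>d. pcompose (L i) [:0, u:] * pcompose (p i) [:0, v:]) k
    = (\<Sum>i\<le>d. \<Sum>j\<le>k. u ^ j * coeff (L i) j * (v ^ (k - j) * coeff (p i) (k - j)))"
  for L p :: "nat \<Rightarrow> real poly"
  by (simp add: coeff_sum coeff_mult coeff_pcompose_linear)

theorem theorem7:
  fixes r k :: nat
  assumes "r \<ge> 1"
    and "\<forall>la mu nu. lr_triple r la mu nu \<and>
           affine_dim (hive_polytope r la mu nu) = int ((r - 1) choose 2) \<longrightarrow>
           coeff (lr_poly la mu nu) k \<ge> 0"
  shows "\<forall>la mu nu. lr_triple r la mu nu \<longrightarrow> coeff (lr_poly la mu nu) k \<ge> 0"
proof (intro allI impI)
  fix la mu nu assume x: "lr_triple r la mu nu"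
  show "coeff (lr_poly la mu nu) k \<ge> 0"
  proof (cases "\<exists>t\<ge>1. lr_coeff (stretch t la) (stretch t mu) (stretch t nu) \<noteq> 0")
    case False
    then have "lr_poly la mu nu = 0" by (intro lr_poly_eqI) simp
    then show ?thesis by simp
  next
    case True
    then obtain t where t: "t \<ge> 1" "lr_coeff (stretch t la) (stretch t mu) (stretch t nu) \<noteq> 0" by blast
    have "card (int_hives r (stretch t la) (stretch t mu) (stretch t nu)) \<noteq> 0"
      using t(2) lr_coeff_triple[OF stretch_triple[OF x]] lr_count_hives[OF stretch_triple[OF x]] by simp
    then obtain h0 where "h0 \<in> int_hives r (stretch t la) (stretch t mu) (stretch t nu)" by fastforce
    then have h0: "hive r (\<lambda>i j. real (h0 i j))" "hive_border r (stretch t la) (stretch t mu) (stretch t nu) (\<lambda>i j. real (h0 i j))"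
      by (auto simp: int_hives_def)
    note h = hive_scale[OF t(1) h0 lr_tripleD(4)[OF x]]
    let ?la = "\<lambda>a i. a * la i + strict_la r i" and ?mu = "\<lambda>a i. a * mu i + strict_mu r i" and ?nu = "\<lambda>a i. a * nu i + strict_nu r i"
    have ne: "int_hives r (strict_la r) (strict_mu r) (strict_nu r) \<noteq> {}" using strict_hive_int by blast
    obtain K d and L p :: "nat \<Rightarrow> real poly" where Q: "\<And>a b :: nat. K * b + 1 \<le> a \<Longrightarrow>
      real_of_int (lr_count (\<lambda>i. a * la i + b * strict_la r i) (\<lambda>i. a * mu i + b * strict_mu r i) (\<lambda>i. a * nu i + b * strict_nu r i))
      = (\<Sum>i\<le>d. poly (L i) ((real K + 1) * real b - real a) * poly (p i) (real a - real K * real b - 1))"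
      using lr_count_two_parameter[OF x strict_triple ne] by blast
    define p' where "p' i = pcompose (p i) [:-1, 1:]" for i
    have p': "poly (p i) (z - 1) = poly (p' i) z" for i z by (simp add: p'_def poly_pcompose)
    define R where "R u v = (\<Sum>i\<le>d. pcompose (L i) [:0, u:] * pcompose (p' i) [:0, v:])" for u v
    have R: "poly (R u v) z = (\<Sum>i\<le>d. poly (L i) (u * z) * poly (p i) (v * z - 1))" for u v z
      by (simp add: R_def poly_sum poly_pcompose p' mult.commute)
    have base: "lr_poly la mu nu = R (-1) 1"
    proof (rule lr_poly_eqI)
      fix t :: nat assume t: "t \<ge> 1"
      have "lr_coeff (stretch t la) (stretch t mu) (stretch t nu) = lr_count (stretch t la) (stretch t mu) (stretch t nu)"
        by (rule lr_coeff_triple[OF stretch_triple[OF x]])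
      then show "poly (R (-1) 1) (real t) = of_int (lr_coeff (stretch t la) (stretch t mu) (stretch t nu))"
        using Q[of 0 t] t by (simp add: R stretch_def)
    qed
    have shifted: "lr_poly (?la (K + 1 + s)) (?mu (K + 1 + s)) (?nu (K + 1 + s)) = R (- real s) (real s + 1)" for s
    proof (rule lr_poly_eqI)
      fix t :: nat assume t: "t \<ge> 1"
      let ?a = "t * (K + 1 + s)"
      have tr: "lr_triple r (?la (K + 1 + s)) (?mu (K + 1 + s)) (?nu (K + 1 + s))"
        using lr_triple_combination[OF x strict_triple, of "K + 1 + s" 1] by simp
      have st: "stretch t (\<lambda>i. (K + 1 + s) * f i + g i) = (\<lambda>i. ?a * f i + t * g i)" for f g
        by (simp add: stretch_def fun_eq_iff algebra_simps)
      have "t * 1 \<le> t * (1 + s)" by (intro mult_le_mono2) simp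
      then have "K * t + 1 \<le> ?a" using t by (simp add: algebra_simps)
      note q = Q[OF this]
      have 1: "(real K + 1) * real t - real ?a = - real s * real t" by (simp add: algebra_simps)
      have 2: "real ?a - real K * real t - 1 = (real s + 1) * real t - 1" by (simp add: algebra_simps)
      show "poly (R (- real s) (real s + 1)) (real t) = of_int (lr_coeff (stretch t (?la (K + 1 + s))) (stretch t (?mu (K + 1 + s))) (stretch t (?nu (K + 1 + s))))"
        unfolding lr_coeff_triple[OF stretch_triple[OF tr]] unfolding st q 1 2 R ..
    qed
    \<comment> \<open>The hypothesis on full-dimensional hive polytopes enters here.\<close>
    have nonneg: "0 \<le> coeff (R (- real s) (real s + 1)) k" for s
    proof -
      have "lr_triple r (?la (K + 1 + s)) (?mu (K + 1 + s)) (?nu (K + 1 + s))"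
        using lr_triple_combination[OF x strict_triple, of "K + 1 + s" 1] by simp
      then show ?thesis using assms(2) full_dimensional_shift[OF x h, of "K + 1 + s"] unfolding shifted[symmetric] by blast
    qed
    \<comment> \<open>Substituting \<open>- s t\<close> and \<open>(s + 1) t\<close> for the arguments makes each coefficient of \<open>t ^ k\<close> a sum of terms \<open>(- s) ^ j * (s + 1) ^ (k - j)\<close>.\<close>
    have lim: "(\<lambda>s. coeff (R (- real s) (real s + 1)) k / real s ^ k) \<longlonglongrightarrow> coeff (R (-1) 1) k"
    proof -
      have inv: "(\<lambda>s. 1 + 1 / real s) \<longlonglongrightarrow> 1"
        using tendsto_add[OF tendsto_const[of 1] lim_1_over_n] by simp
      have "(\<lambda>s. \<Sum>i\<le>d. \<Sum>j\<le>k. (-1) ^ j * coeff (L i) j * ((1 + 1 / real s) ^ (k - j) * coeff (p' i) (k - j)))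
        \<longlonglongrightarrow> (\<Sum>i\<le>d. \<Sum>j\<le>k. (-1) ^ j * coeff (L i) j * (1 ^ (k - j) * coeff (p' i) (k - j)))"
        by (intro tendsto_intros inv)
      also have "(\<Sum>i\<le>d. \<Sum>j\<le>k. (-1) ^ j * coeff (L i) j * (1 ^ (k - j) * coeff (p' i) (k - j))) = coeff (R (-1) 1) k"
        unfolding R_def coeff_sum_scaled ..
      finally show ?thesis
      proof (rule Lim_transform_eventually)
        show "\<forall>\<^sub>F s in sequentially. (\<Sum>i\<le>d. \<Sum>j\<le>k. (-1) ^ j * coeff (L i) j * ((1 + 1 / real s) ^ (k - j) * coeff (p' i) (k - j)))
          = coeff (R (- real s) (real s + 1)) k / real s ^ k"
          using eventually_gt_at_top[of 0]
        proof eventually_elim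
          fix s :: nat assume s: "0 < s"
          show "(\<Sum>i\<le>d. \<Sum>j\<le>k. (-1) ^ j * coeff (L i) j * ((1 + 1 / real s) ^ (k - j) * coeff (p' i) (k - j)))
            = coeff (R (- real s) (real s + 1)) k / real s ^ k"
            unfolding R_def coeff_sum_scaled sum_divide_distrib
          proof (intro sum.cong refl)
            fix i j assume j: "j \<in> {..k}"
            have e1: "real s ^ k = real s ^ j * real s ^ (k - j)" using j by (simp flip: power_add)
            have e2: "(- real s) ^ j = (-1) ^ j * real s ^ j" by (simp flip: power_mult_distrib)
            have e3: "1 + 1 / real s = (real s + 1) / real s" using s by (simp add: field_simps)
            show "(-1) ^ j * coeff (L i) j * ((1 + 1 / real s) ^ (k - j) * coeff (p' i) (k - j))
              = (- real s) ^ j * coeff (L i) j * ((real s + 1) ^ (k - j) * coeff (p' i) (k - j)) / real s ^ k"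
              unfolding e1 e2 e3 power_divide using s by (simp add: field_simps)
          qed
        qed
      qed
    qed
    have "0 \<le> coeff (R (-1) 1) k"
      by (rule LIMSEQ_le_const[OF lim]) (use nonneg in \<open>auto intro!: exI[of _ 0] divide_nonneg_nonneg\<close>)
    then show ?thesis unfolding base .
  qed
qed

end
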